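(* (a) Given any triple of integers $(m,j,\mu)$ satisfying $\infty\ge j\ge m\ge1$ and $j+m^2=\mu$, there is a harmonic map $g$ with a smooth critical point $z_0$ such that the order of $g$ at $z_0$ is $m$, $\mu(g,z_0)=\mu$, and $(j,j+1)$ is the order-pair of the critical value curve at $g(z_0)$. (b) Given any pair of integers $n^+,n^-\ge1$ satisfying $n^+=n^-$ or $|n^+-n^-|=1$, there are two consecutive integers $k,k+1$ and harmonic maps with order $m=k$ and $m=k+1$ respectively realizing the topological model for the pair $n^\pm$ and the order $m$.
   Context: Identify $\mathbb R^2$ with $\mathbb C$. A planar harmonic map is a map from an open subset of $\mathbb C$ to $\mathbb C$ whose two real components are harmonic; locally $f=p+\overline q$ with $p,q$ holomorphic. $J_f$ is the Jacobian determinant, $\mathcal C_f=\{J_f=0\}$. A point $z_0\in\mathcal C_f$ is a smooth critical point if $\mathcal C_f$ is a 1-dimensional submanifold near $z_0$. The order of an analytic map at $a$ is the lowest total degree of a nonzero monomial in the Taylor expansions at $a$ of the components of $f-f(a)$. At a smooth critical point, $\psi=p'/q'$ extends holomorphically with $|\psi(z_0)|=1$, $\psi'(z_0)\ne0$, and $\mathcal C_f=\psi^{-1}(S^1)$ near $z_0$; the critical value curve is $\beta(t)=f(\gamma(t))$ with $\gamma(t)=\psi^{-1}(\psi(z_0)e^{it})$, $\gamma(0)=z_0$ (natural parametrization). A planar analytic curve $\beta$ has order-pair $(j,k)$ at $\beta(0)$, $1\le j<k\le\infty$, if up to reparametrization in the source and analytic change of coordinates in the range it takes the form $\beta(s)=\beta(0)+(Cs^j+\text{higher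 order terms},\,C's^k+\text{higher order terms})$ with $CC'\ne0$. Multiplicity: for holomorphic $F:W\to\mathbb C^n$, $W\subset\mathbb C^n$ open, $\mu(F,w_0)=\limsup_{w\to w_0}\#(F^{-1}F(w)\cap X)$ with $X$ an open neighborhood of $w_0$ relatively compact in $W$ with $F^{-1}F(w_0)\cap\overline X=\{w_0\}$ ($\infty$ if no such $X$ exists). For a real analytic planar map $\mu$ is the multiplicity of its holomorphic extension to $\mathbb C^2$. A harmonic map $f$ with smooth critical point $z_0$, of order $m$ and finite multiplicity $\mu$ there, realizes the topological model for the pair $n^\pm$ and the order $m$ if there are a neighborhood $\Delta$ of $z_0$ and orientation preserving homeomorphisms $h_1:\Delta\to\mathbb D$ (unit disc), $z_0\mapsto0$, $h_2:\mathbb C\to\mathbb C$, $f(z_0)\mapsto0$, with $h_2\circ f\circ h_1^{-1}(re^{i\theta})=re^{i(2n^+-1)\theta}$ for $0\le\theta\le\pi$ and $=re^{-i(2n^--1)\theta}$ for $\pi\le\theta\le2\pi$, where $(2n^+-1,2n^--1)\in\{(m,m),(m+1,m+1)\}$ if $\mu$ is even and $(2n^+-1,2n^--1)\in\{(m+1,m-1),(m-1,m+1),(m,m+2),(m+2,m)\}$ if $\mu$ is odd.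
   Formalization: In (b), for n⁺=n⁻=1 only a harmonic map of order m=1 is asserted: the model forces m=1 or m=0, and an order is at least 1, so two consecutive orders cannot exist. In (a), j=∞ is read as the order-pair (∞,∞), meaning a curve constant near the point. *)

theory Defs
  imports "HOL-Complex_Analysis.Complex_Analysis"
begin

text \<open>The plane $\mathbb R^2$ is the type \<^typ>\<open>complex\<close>. A map defined on an open set \<open>U\<close> is
  represented by a total function together with \<open>U\<close>; its values outside \<open>U\<close> are never used.\<close>

section \<open>Harmonic maps and their critical sets\<close>

definition dx :: "(complex \<Rightarrow> real) \<Rightarrow> complex \<Rightarrow> real"
  where "dx u z = frechet_derivative u (at z) 1"

definition dy :: "(complex \<Rightarrow> real) \<Rightarrow> complex \<Rightarrow> real"
  where "dy u z = frechet_derivative u (at z) \<i>"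

text \<open>\<open>Ck_on k U u\<close>: \<open>u\<close> is of class $C^k$ on the open set \<open>U\<close>.\<close>

primrec Ck_on :: "nat \<Rightarrow> complex set \<Rightarrow> (complex \<Rightarrow> real) \<Rightarrow> bool" where
  "Ck_on 0 U u \<longleftrightarrow> continuous_on U u"
| "Ck_on (Suc k) U u \<longleftrightarrow>
     (\<forall>z\<in>U. u differentiable (at z)) \<and> Ck_on k U (dx u) \<and> Ck_on k U (dy u)"

definition harmonic_fun_on :: "complex set \<Rightarrow> (complex \<Rightarrow> real) \<Rightarrow> bool" where
  "harmonic_fun_on U u \<longleftrightarrow> Ck_on 2 U u \<and> (\<forall>z\<in>U. dx (dx u) z + dy (dy u) z = 0)"

definition harmonic_map :: "complex set \<Rightarrow> (complex \<Rightarrow> complex) \<Rightarrow> bool" where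
  "harmonic_map U f \<longleftrightarrow> open U \<and>
     harmonic_fun_on U (\<lambda>z. Re (f z)) \<and> harmonic_fun_on U (\<lambda>z. Im (f z))"

definition jacobian :: "(complex \<Rightarrow> complex) \<Rightarrow> complex \<Rightarrow> real" where
  "jacobian f z =
     dx (\<lambda>z. Re (f z)) z * dy (\<lambda>z. Im (f z)) z - dy (\<lambda>z. Re (f z)) z * dx (\<lambda>z. Im (f z)) z"

definition critical_set :: "complex set \<Rightarrow> (complex \<Rightarrow> complex) \<Rightarrow> complex set" where
  "critical_set U f = {z \<in> U. jacobian f z = 0}"

text \<open>A subset of the plane is a smooth 1-dimensional submanifold near \<open>a\<close> if, near \<open>a\<close>, it is
  the zero set of a $C^\infty$ function without critical points.\<close>

definition submanifold1_near :: "complex set \<Rightarrow> complex \<Rightarrow> bool" where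
  "submanifold1_near M a \<longleftrightarrow>
     (\<exists>V \<rho>. open V \<and> a \<in> V \<and> (\<forall>k. Ck_on k V \<rho>) \<and>
        (\<forall>z\<in>V. (dx \<rho> z, dy \<rho> z) \<noteq> (0, 0)) \<and> M \<inter> V = {z \<in> V. \<rho> z = 0})"

definition smooth_critical_point :: "complex set \<Rightarrow> (complex \<Rightarrow> complex) \<Rightarrow> complex \<Rightarrow> bool" where
  "smooth_critical_point U f z0 \<longleftrightarrow>
     z0 \<in> critical_set U f \<and> submanifold1_near (critical_set U f) z0"


section \<open>Taylor expansions and order\<close>

text \<open>One real variable, at the origin.\<close>

definition has_taylor1 :: "(real \<Rightarrow> real) \<Rightarrow> (nat \<Rightarrow> real) \<Rightarrow> bool" where
  "has_taylor1 u b \<longleftrightarrow> (\<forall>\<^sub>F s in nhds 0. (\<lambda>n. b n * s ^ n) sums u s)"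

text \<open>Two real variables, at \<open>a\<close>: the Taylor coefficients at \<open>a\<close> of the two components of \<open>f\<close>
  are the real and imaginary parts of the numbers \<open>c i j\<close>.\<close>

definition has_taylor2 ::
    "(complex \<Rightarrow> complex) \<Rightarrow> complex \<Rightarrow> (nat \<Rightarrow> nat \<Rightarrow> complex) \<Rightarrow> bool" where
  "has_taylor2 f a c \<longleftrightarrow>
     (\<forall>\<^sub>F h in nhds 0.
        ((\<lambda>(i, j). c i j * of_real (Re h ^ i * Im h ^ j)) has_sum f (a + h)) UNIV)"

definition has_order :: "(complex \<Rightarrow> complex) \<Rightarrow> complex \<Rightarrow> nat \<Rightarrow> bool" where
  "has_order f a m \<longleftrightarrow>
     (\<exists>c. has_taylor2 (\<lambda>z. f z - f a) a c \<and>
        (\<exists>i j. c i j \<noteq> 0 \<and> i + j = m) \<and> (\<forall>i j. c i j \<noteq> 0 \<longrightarrow> m \<le> i + j))"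


section \<open>Critical value curve and order-pair\<close>

text \<open>\<open>\<gamma>\<close> is (near \<open>t = 0\<close>) the natural parametrization
  $\gamma(t)=\psi^{-1}(\psi(z_0)e^{it})$ of the critical set, where \<open>\<psi>\<close> is the holomorphic
  extension of $p'/q'$ to \<open>z0\<close>. The zeros of $q'$ being isolated, \<open>V\<close> can be taken so small that
  \<open>z0\<close> is the only possible one; the inverse is that of the injective restriction of \<open>\<psi>\<close> to
  \<open>V\<close>, so that in particular \<open>\<gamma> 0 = z0\<close>. The germ of \<open>\<gamma>\<close> does not depend on the choices.\<close>

definition natural_parametrization ::
    "complex set \<Rightarrow> (complex \<Rightarrow> complex) \<Rightarrow> complex \<Rightarrow> (real \<Rightarrow> complex) \<Rightarrow> bool" where
  "natural_parametrization U f z0 \<gamma> \<longleftrightarrow>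
     (\<exists>V p q \<psi>. open V \<and> z0 \<in> V \<and> V \<subseteq> U \<and>
        p holomorphic_on V \<and> q holomorphic_on V \<and> \<psi> holomorphic_on V \<and>
        (\<forall>z\<in>V. f z = p z + cnj (q z)) \<and>
        (\<forall>z\<in>V - {z0}. deriv q z \<noteq> 0 \<and> \<psi> z = deriv p z / deriv q z) \<and>
        inj_on \<psi> V \<and>
        (\<forall>\<^sub>F t in nhds 0. \<gamma> t \<in> V \<and> \<psi> (\<gamma> t) = \<psi> z0 * cis t))"

text \<open>\<open>leading_order u k\<close>: $u(s)=Cs^k+{}$higher order terms, with $C\neq0$; for \<open>k = \<infinity>\<close> this
  means that \<open>u\<close> vanishes identically near 0.\<close>

definition leading_order :: "(real \<Rightarrow> real) \<Rightarrow> enat \<Rightarrow> bool" where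
  "leading_order u k \<longleftrightarrow>
     (\<exists>b. has_taylor1 u b \<and> (\<forall>n. enat n < k \<longrightarrow> b n = 0) \<and> (\<forall>n. enat n = k \<longrightarrow> b n \<noteq> 0))"

text \<open>Reparametrizations \<open>\<sigma>\<close> are germs of analytic diffeomorphisms of the line fixing 0, and
  coordinate changes \<open>\<Phi>\<close> are germs of analytic diffeomorphisms of the plane (normalized to fix
  \<open>\<beta> 0\<close>), both recognized by their derivative at the base point. Besides the pairs with
  $1\le j<k\le\infty$ we admit the pair $(\infty,\infty)$; it belongs exactly to the curves
  that are constant near 0.\<close>

definition has_order_pair :: "(real \<Rightarrow> complex) \<Rightarrow> enat \<Rightarrow> enat \<Rightarrow> bool" where
  "has_order_pair \<beta> j k \<longleftrightarrow>
     1 \<le> j \<and> (j < k \<or> j = \<infinity> \<and> k = \<infinity>) \<and>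
     (\<exists>\<sigma> b \<Phi> c.
        has_taylor1 \<sigma> b \<and> \<sigma> 0 = 0 \<and> b 1 \<noteq> 0 \<and>
        has_taylor2 \<Phi> (\<beta> 0) c \<and> \<Phi> (\<beta> 0) = \<beta> 0 \<and> jacobian \<Phi> (\<beta> 0) \<noteq> 0 \<and>
        leading_order (\<lambda>s. Re (\<Phi> (\<beta> (\<sigma> s)) - \<beta> 0)) j \<and>
        leading_order (\<lambda>s. Im (\<Phi> (\<beta> (\<sigma> s)) - \<beta> 0)) k)"


section \<open>Multiplicity\<close>

definition ecard :: "'a set \<Rightarrow> enat" where
  "ecard A = (if finite A then enat (card A) else \<infinity>)"

text \<open>Holomorphic maps between open subsets of $\mathbb C^2$: Frechet differentiability with
  $\mathbb C$-linear derivative.\<close>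

definition holomorphic2_on ::
    "(complex \<times> complex \<Rightarrow> complex \<times> complex) \<Rightarrow> (complex \<times> complex) set \<Rightarrow> bool" where
  "holomorphic2_on F W \<longleftrightarrow>
     (\<forall>w\<in>W. \<exists>A B C D. (F has_derivative (\<lambda>(h, k). (A * h + B * k, C * h + D * k))) (at w))"

definition isolating_nbhd ::
    "(complex \<times> complex \<Rightarrow> complex \<times> complex) \<Rightarrow> (complex \<times> complex) set \<Rightarrow>
     complex \<times> complex \<Rightarrow> (complex \<times> complex) set \<Rightarrow> bool" where
  "isolating_nbhd F W w0 X \<longleftrightarrow>
     open X \<and> w0 \<in> X \<and> compact (closure X) \<and> closure X \<subseteq> W \<and>
     {w \<in> closure X. F w = F w0} = {w0}"

text \<open>For holomorphic \<open>F\<close> the upper limit is the same for all isolating \<open>X\<close>, so the infimum is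
  their common value; over the empty family it is \<open>\<infinity>\<close>.\<close>

definition hol_multiplicity ::
    "(complex \<times> complex \<Rightarrow> complex \<times> complex) \<Rightarrow> (complex \<times> complex) set \<Rightarrow>
     complex \<times> complex \<Rightarrow> enat" where
  "hol_multiplicity F W w0 =
     (INF X \<in> {X. isolating_nbhd F W w0 X}. Limsup (at w0) (\<lambda>w. ecard {x \<in> X. F x = F w}))"

definition complexify :: "complex \<Rightarrow> complex \<times> complex" where
  "complexify z = (of_real (Re z), of_real (Im z))"

text \<open>Multiplicity of a real analytic planar map, through its holomorphic extension to
  $\mathbb C^2$, whose germ at the base point is unique.\<close>

definition has_multiplicity :: "(complex \<Rightarrow> complex) \<Rightarrow> complex \<Rightarrow> enat \<Rightarrow> bool" where
  "has_multiplicity f a \<mu> \<longleftrightarrow>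
     (\<exists>W F. open W \<and> complexify a \<in> W \<and> holomorphic2_on F W \<and>
        (\<forall>\<^sub>F z in nhds a. F (complexify z) = complexify (f z)) \<and>
        hol_multiplicity F W (complexify a) = \<mu>)"


section \<open>Topological models\<close>

text \<open>Orientation preserving homeomorphisms between open subsets of the plane, that is, those
  of local degree 1.\<close>

definition op_homeomorphism ::
    "complex set \<Rightarrow> complex set \<Rightarrow> (complex \<Rightarrow> complex) \<Rightarrow> (complex \<Rightarrow> complex) \<Rightarrow> bool" where
  "op_homeomorphism S T h g \<longleftrightarrow>
     open S \<and> open T \<and> homeomorphism S T h g \<and>
     (\<forall>z r. 0 < r \<and> cball z r \<subseteq> S \<longrightarrow> winding_number (h \<circ> circlepath z r) (h z) = 1)"

definition realizes_model ::
    "complex set \<Rightarrow> (complex \<Rightarrow> complex) \<Rightarrow> complex \<Rightarrow> nat \<Rightarrow> nat \<Rightarrow> nat \<Rightarrow> bool" where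
  "realizes_model U f z0 np nm m \<longleftrightarrow>
     harmonic_map U f \<and> smooth_critical_point U f z0 \<and> has_order f z0 m \<and>
     (\<exists>\<mu>::nat. has_multiplicity f z0 (enat \<mu>) \<and>
        (2 * int np - 1, 2 * int nm - 1) \<in>
          (if even \<mu>
           then {(int m, int m), (int m + 1, int m + 1)}
           else {(int m + 1, int m - 1), (int m - 1, int m + 1),
                 (int m, int m + 2), (int m + 2, int m)})) \<and>
     (\<exists>\<Delta> h1 g1 h2 g2. z0 \<in> \<Delta> \<and> \<Delta> \<subseteq> U \<and>
        op_homeomorphism \<Delta> (ball 0 1) h1 g1 \<and> h1 z0 = 0 \<and>
        op_homeomorphism UNIV UNIV h2 g2 \<and> h2 (f z0) = 0 \<and>
        (\<forall>r \<theta>. 0 \<le> r \<and> r < 1 \<and> 0 \<le> \<theta> \<and> \<theta> \<le> pi \<longrightarrow>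
           h2 (f (g1 (of_real r * cis \<theta>))) = of_real r * cis ((2 * real np - 1) * \<theta>)) \<and>
        (\<forall>r \<theta>. 0 \<le> r \<and> r < 1 \<and> pi \<le> \<theta> \<and> \<theta> \<le> 2 * pi \<longrightarrow>
           h2 (f (g1 (of_real r * cis \<theta>))) = of_real r * cis (- (2 * real nm - 1) * \<theta>)))"

text \<open>An order is at least 1, hence the fold model $n^+=n^-=1$ occurs for the order 1 only.\<close>

lemma has_order_pos:
  assumes "has_order f a m"
  shows "1 \<le> m"
proof -
  obtain c i j where c: "has_taylor2 (\<lambda>z. f z - f a) a c" "c i j \<noteq> 0" "i + j = m"
    using assms unfolding has_order_def by blast
  have "((\<lambda>(i, j). c i j * of_real (Re 0 ^ i * Im 0 ^ j)) has_sum (f (a + 0) - f a)) UNIV"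
    using eventually_nhds_x_imp_x[OF c(1)[unfolded has_taylor2_def]] .
  then have "((\<lambda>(i, j). c i j * of_real (Re 0 ^ i * Im 0 ^ j)) has_sum 0) UNIV"
    by simp
  moreover have "((\<lambda>(i, j). c i j * of_real (Re 0 ^ i * Im 0 ^ j)) has_sum c 0 0) UNIV"
  proof -
    have "((\<lambda>(i, j). c i j * of_real (Re 0 ^ i * Im 0 ^ j)) has_sum c 0 0) {(0, 0)}"
      using has_sum_finite[of "{(0::nat, 0::nat)}"
          "\<lambda>(i, j). c i j * of_real (Re 0 ^ i * Im 0 ^ j)"] by simp
    then show ?thesis
      by (rule has_sum_cong_neutral[THEN iffD1, rotated -1]) auto
  qed
  ultimately have "c 0 0 = 0"
    using has_sum_unique by blast
  then show ?thesis
    using c by (cases m) auto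
qed

lemma realizes_model_1_1:
  assumes "realizes_model U f z0 1 1 m"
  shows "m = 1"
  using assms has_order_pos[of f z0 m]
  unfolding realizes_model_def by (auto split: if_splits)

end

theory Submission
  imports Defs
begin

text \<open>
  All examples are of the form $f=(\mathrm{Re}\,V,\mathrm{Re}\,K)$ with $V=e z^n$ and
  $K'=\kappa V'$ for entire $K$, so that the Jacobian is $-|V'|^2\,\mathrm{Im}\,\kappa$.
  With $K'=-(z+i\delta z^k)V'$ the order is $n$, with $K'=(1/z-i\delta)V'$ it is $n-1$.

  Multiplicity: in the complexified coordinates $(z,w)=(x+iy,x-iy)$ the first component is
  fixed by $w^n=\omega z^n+a$. Multiplying the second equation over all roots $w$ gives one
  holomorphic function of $z$ whose zeros dominate the number of solutions, and Rouche's
  theorem bounds those. For $a=0$ the equation splits into the lines $w=\zeta z$, on each of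
  which the solutions can be counted exactly; both counts agree.

  Order-pair: for $e\in\{1,i\}$ the critical set is parametrized by the inverse of
  $z+i\delta z^k$ along the real line, which makes the leading terms of both components
  visible.

  Topological model: the map $f$ followed by the shear $(P,Q)\mapsto(P,Q-b(P))$ sends the
  critical values to the real axis. The rays $P=0$ cut the source into sectors, and in each
  of them $Q$ is strictly monotone along the level curves of $P$ on either side of the
  critical curve. Hence modulus and lifted argument of the sheared map are injective on each
  side, and dividing the argument by the degree yields the homeomorphism onto the standard
  model.
\<close>

section \<open>Harmonic pairs of real parts\<close>

text \<open>Purely imaginary e is the exceptional direction. Then Re (e z^n) vanishes on the real
  axis, whose complexification is one of the lines w = \<zeta> z, and with K' = - z V' the whole
  axis would collapse to a point. That collapse is the example for j = \<infinity>. Otherwise the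
  term with \<delta> removes it, and the exponent k sets the order of contact with that line, hence
  both j and \<mu>. The price is a critical curve that is no longer straight; most of the work on
  the topological models is to control where the bent curve lies among the sectors.

  For a model with degrees 2 n+ - 1 and 2 n- - 1, let n be their mean, \<delta> half their
  difference and e = cis (\<delta> pi / 2). Over the upper half-plane the argument of e z^n runs
  from \<delta> pi / 2 to n pi + \<delta> pi / 2. The interval wanted is the one from 0 to (n +
  \<delta>) pi, and the missing or surplus quarter turn at each end is supplied by the fold along
  the critical curve. Conjugation replaces \<delta> by -\<delta>, so that the other side obtains the
  degree n - \<delta>.\<close>

definition re_pair :: "(complex \<Rightarrow> complex) \<Rightarrow> (complex \<Rightarrow> complex) \<Rightarrow> complex \<Rightarrow> complex"
  where "re_pair V K z = Complex (Re (V z)) (Re (K z))"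

lemma re_pair_simps [simp]: "Re (re_pair V K z) = Re (V z)" "Im (re_pair V K z) = Re (K z)"
  by (auto simp: re_pair_def)

lemma frechet_derivative_Re:
  assumes "(h has_field_derivative h') (at z)"
  shows "(\<lambda>z. Re (h z)) differentiable (at z)"
    and "frechet_derivative (\<lambda>z. Re (h z)) (at z) = (\<lambda>w. Re (h' * w))"
proof -
  have *: "((\<lambda>z. Re (h z)) has_derivative (\<lambda>w. Re (h' * w))) (at z)"
    using assms unfolding has_field_derivative_def by (rule bounded_linear.has_derivative[OF
        bounded_linear_Re])
  show "(\<lambda>z. Re (h z)) differentiable (at z)"
    using * by (rule differentiableI)
  show "frechet_derivative (\<lambda>z. Re (h z)) (at z) = (\<lambda>w. Re (h' * w))"
    using frechet_derivative_at[OF *] by simp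
qed

lemma dx_Re: "(h has_field_derivative h') (at z) \<Longrightarrow> dx (\<lambda>z. Re (h z)) z = Re h'"
  and dy_Re: "(h has_field_derivative h') (at z) \<Longrightarrow> dy (\<lambda>z. Re (h z)) z = - Im h'"
  by (simp_all add: dx_def dy_def frechet_derivative_Re)

text \<open>\<open>dx\<close> and \<open>dy\<close> are taken of total functions, so equality on U
  passes to the derivatives only because U is open. This lets
  \<open>dx (\<lambda>z. Re (h z))\<close> be replaced by a formula that holds on U alone.\<close>

lemma Ck_on_cong:
  assumes "open U" "\<And>z. z \<in> U \<Longrightarrow> u z = v z" "Ck_on k U u"
  shows "Ck_on k U v"
  using assms(2,3)
proof (induction k arbitrary: u v)
  case 0
  then show ?case by (metis Ck_on.simps(1) continuous_on_cong)
next
  case (Suc k)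
  have d: "u differentiable (at z)" if "z \<in> U" for z
    using Suc.prems that by simp
  have e: "frechet_derivative u (at z) = frechet_derivative v (at z)" "v differentiable (at z)" if
      "z \<in> U" for z
  proof -
    have "(u has_derivative frechet_derivative u (at z)) (at z)"
      using d[OF that] frechet_derivative_works by blast
    then have "(v has_derivative frechet_derivative u (at z)) (at z)"
      by (rule has_derivative_transform_within_open[OF _ assms(1) that]) (use Suc.prems in auto)
    then show "frechet_derivative u (at z) = frechet_derivative v (at z)" "v differentiable (at z)"
      by (auto simp: differentiableI dest: frechet_derivative_at)
  qed
  have "dx u z = dx v z" "dy u z = dy v z" if "z \<in> U" for z
    using e[OF that] by (simp_all add: dx_def dy_def)
  then show ?case
    using Suc.prems(2) e(2) Suc.IH[of "dx u" "dx v"] Suc.IH[of "dy u" "dy v"] by simp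
qed

text \<open>The partial derivatives of Re h are Re h' and Re (i h'), again real parts of holomorphic
  functions; hence the induction runs over all h at once.\<close>

lemma Ck_on_Re:
  assumes "open U" "h holomorphic_on U"
  shows "Ck_on k U (\<lambda>z. Re (h z))"
  using assms(2)
proof (induction k arbitrary: h)
  case 0
  then show ?case by (auto intro!: continuous_intros holomorphic_on_imp_continuous_on)
next
  case (Suc k)
  have d: "(h has_field_derivative deriv h z) (at z)" if "z \<in> U" for z
    using Suc.prems that assms(1) by (simp add: holomorphic_derivI)
  have "deriv h holomorphic_on U" "(\<lambda>z. \<i> * deriv h z) holomorphic_on U"
    using Suc.prems assms(1) by (auto intro!: holomorphic_intros)
  then have *: "Ck_on k U (\<lambda>z. Re (deriv h z))" "Ck_on k U (\<lambda>z. Re (\<i> * deriv h z))"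
    using Suc.IH by blast+
  have "Ck_on k U (dx (\<lambda>z. Re (h z)))"
    by (rule Ck_on_cong[OF assms(1) _ *(1)]) (simp add: dx_Re[OF d])
  moreover have "Ck_on k U (dy (\<lambda>z. Re (h z)))"
    by (rule Ck_on_cong[OF assms(1) _ *(2)]) (simp add: dy_Re[OF d])
  ultimately show ?case
    using frechet_derivative_Re(1)[OF d] by simp
qed

lemma harmonic_fun_on_Re:
  assumes "h holomorphic_on UNIV"
  shows "harmonic_fun_on UNIV (\<lambda>z. Re (h z))"
proof -
  have d: "(h has_field_derivative deriv h z) (at z)" for z
    using assms by (simp add: holomorphic_derivI)
  have h': "(deriv h has_field_derivative deriv (deriv h) z) (at z)" for z
    using assms holomorphic_deriv[OF assms] by (simp add: holomorphic_derivI)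
  have x: "dx (\<lambda>z. Re (h z)) = (\<lambda>z. Re (deriv h z))"
    by (auto simp: dx_Re[OF d])
  have y: "dy (\<lambda>z. Re (h z)) = (\<lambda>z. Re (\<i> * deriv h z))"
    by (auto simp: dy_Re[OF d])
  have i: "((\<lambda>z. \<i> * deriv h z) has_field_derivative \<i> * deriv (deriv h) z) (at z)" for z
    by (rule DERIV_cmult[OF h'])
  show ?thesis
    unfolding harmonic_fun_on_def using Ck_on_Re[OF _ assms]
    by (simp only: x y dx_Re[OF h'] dy_Re[OF i]) simp
qed

lemma harmonic_map_re_pair:
  assumes "V holomorphic_on UNIV" "K holomorphic_on UNIV"
  shows "harmonic_map UNIV (re_pair V K)"
  using assms by (simp add: harmonic_map_def harmonic_fun_on_Re)

lemma jacobian_re_pair: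
  assumes "(V has_field_derivative V') (at z)" "(K has_field_derivative K') (at z)"
  shows "jacobian (re_pair V K) z = Im (V' * cnj K')"
  by (simp add: jacobian_def dx_Re[OF assms(1)] dx_Re[OF assms(2)] dy_Re[OF assms(1)] dy_Re[OF
      assms(2)])

lemma smooth_critical_point_re_pair:
  assumes "open A" "z0 \<in> A" "X holomorphic_on A" "\<And>z. z \<in> A \<Longrightarrow> deriv X z \<noteq> 0"
    and "critical_set UNIV f \<inter> A = {z\<in>A. Im (X z) = 0}" "Im (X z0) = 0"
  shows "smooth_critical_point UNIV f z0"
proof -
  \<comment> \<open>Re (-i X) = Im X, and its gradient has the entries Im X' and Re X', so it
    vanishes only where X' does.\<close>
  let ?h = "\<lambda>z. - \<i> * X z"
  have d: "(?h has_field_derivative - \<i> * deriv X z) (at z)" if "z \<in> A" for z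
    using assms(1,3) that by (intro DERIV_cmult) (simp add: holomorphic_derivI)
  have "?h holomorphic_on A"
    using assms(3) by (intro holomorphic_intros)
  then have "\<forall>k. Ck_on k A (\<lambda>z. Re (?h z))"
    using Ck_on_Re[OF assms(1)] by blast
  moreover have "\<forall>z\<in>A. (dx (\<lambda>z. Re (?h z)) z, dy (\<lambda>z. Re (?h z)) z) \<noteq> (0, 0)"
  proof
    fix z assume "z \<in> A"
    then show "(dx (\<lambda>z. Re (?h z)) z, dy (\<lambda>z. Re (?h z)) z) \<noteq> (0, 0)"
      unfolding dx_Re[OF d[OF \<open>z \<in> A\<close>]] dy_Re[OF d[OF \<open>z \<in> A\<close>]]
      using assms(4) by (auto simp: complex_eq_iff)
  qed
  ultimately show ?thesis
    unfolding smooth_critical_point_def submanifold1_near_def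
    using assms(1,2,5,6)
    by (intro conjI exI[of _ A] exI[of _ "\<lambda>z. Re (?h z)"]) auto
qed

section \<open>Taylor coefficients and the order of the polynomial examples\<close>

definition monom_coeff :: "complex \<Rightarrow> complex \<Rightarrow> nat \<Rightarrow> nat \<Rightarrow> nat \<Rightarrow> complex" where
  "monom_coeff u a n i j =
     (if i + j = n then u * of_real (Re (a * of_nat (n choose i) * \<i> ^ j)) else 0)"

lemma has_taylor2_Re_monom: "has_taylor2 (\<lambda>z. u * of_real (Re (a * z ^ n))) 0 (monom_coeff u a n)"
proof -
  have "((\<lambda>(i, j). monom_coeff u a n i j * of_real (Re h ^ i * Im h ^ j)) has_sum u * of_real (Re (a
      * h ^ n))) UNIV" for h
  proof -
    let ?F = "\<lambda>(i, j). monom_coeff u a n i j * of_real (Re h ^ i * Im h ^ j)"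
    let ?S = "(\<lambda>i. (i, n - i)) ` {..n}"
    have "h ^ n = (of_real (Re h) + \<i> * of_real (Im h)) ^ n"
      using complex_eq[of h] by simp
    also have "\<dots> = (\<Sum>i\<le>n. of_nat (n choose i) * of_real (Re h) ^ i * (\<i> * of_real (Im h)) ^ (n -
        i))"
      by (rule binomial_ring)
    finally have "u * of_real (Re (a * h ^ n)) =
       (\<Sum>i\<le>n. u * of_real (Re (a * (of_nat (n choose i) * of_real (Re h) ^ i * (\<i> * of_real (Im h))
           ^ (n - i)))))"
      by (simp only: sum_distrib_left Re_sum of_real_sum)
    also have "\<dots> = (\<Sum>i\<le>n. ?F (i, n - i))"
    proof (rule sum.cong)
      fix i assume "i \<in> {..n}"
      have "a * (of_nat (n choose i) * of_real (Re h) ^ i * (\<i> * of_real (Im h)) ^ (n - i)) =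
            a * of_nat (n choose i) * \<i> ^ (n - i) * of_real (Re h ^ i * Im h ^ (n - i))"
        by (simp add: power_mult_distrib mult_ac)
      then have "Re (a * (of_nat (n choose i) * of_real (Re h) ^ i * (\<i> * of_real (Im h)) ^ (n -
          i))) =
            Re (a * of_nat (n choose i) * \<i> ^ (n - i)) * (Re h ^ i * Im h ^ (n - i))"
        by (metis Re_complex_of_real mult.commute times_complex.simps(1) Im_complex_of_real
            mult_zero_left diff_zero)
      then show "u * of_real (Re (a * (of_nat (n choose i) * of_real (Re h) ^ i * (\<i> * of_real (Im
          h)) ^ (n - i)))) = ?F (i, n - i)"
        using \<open>i \<in> {..n}\<close> by (simp add: monom_coeff_def)
    qed simp
    also have "\<dots> = sum ?F ?S"
      by (subst sum.reindex) (auto simp: inj_on_def)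
    finally have "(?F has_sum u * of_real (Re (a * h ^ n))) ?S"
      by (metis (no_types, lifting) has_sum_finite finite_imageI finite_atMost)
    moreover have "?F p = 0" if "p \<in> UNIV - ?S" for p
      using that by (cases p) (auto simp: monom_coeff_def)
    ultimately show ?thesis
      using has_sum_cong_neutral[of UNIV ?S ?F ?F] by auto
  qed
  then show ?thesis
    by (simp add: has_taylor2_def)
qed

lemma has_taylor2_add:
  assumes "has_taylor2 f a b" "has_taylor2 g a c"
  shows "has_taylor2 (\<lambda>z. f z + g z) a (\<lambda>i j. b i j + c i j)"
  unfolding has_taylor2_def
  using assms[unfolded has_taylor2_def]
proof eventually_elim
  case (elim h)
  show ?case
    using has_sum_add[OF elim] by (simp add: case_prod_unfold algebra_simps)
qed

text \<open>The coefficient of x^n is u Re a and that of x^(n-1) y is -n u Im a; they cannot both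
  vanish.\<close>

lemma monom_coeff_nonzero:
  assumes "a \<noteq> 0" "u \<noteq> 0" "1 \<le> n"
  obtains i j where "monom_coeff u a n i j \<noteq> 0" "i + j = n"
proof (cases "Re a = 0")
  case True
  then have "Im a \<noteq> 0" using assms by (simp add: complex_eq_iff)
  then have "monom_coeff u a n (n - 1) 1 \<noteq> 0"
    using assms True by (auto simp: monom_coeff_def)
  then show ?thesis using that assms by force
next
  case False
  then have "monom_coeff u a n n 0 \<noteq> 0"
    using assms by (simp add: monom_coeff_def)
  then show ?thesis using that by force
qed

text \<open>The shape shared by all examples. For purely imaginary e the terms with e and with
  \<alpha> vanish on the real axis; the extra factor i makes the \<beta> term the one that survives
  there.\<close>

definition poly_pair :: "complex \<Rightarrow> nat \<Rightarrow> real \<Rightarrow> nat \<Rightarrow> real \<Rightarrow> nat \<Rightarrow> complex \<Rightarrow> complex" where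
  "poly_pair e n \<alpha> p \<beta> q =
     re_pair (\<lambda>z. e * z ^ n) (\<lambda>z. e * (of_real \<alpha> * z ^ p + \<i> * of_real \<beta> * z ^ q))"

lemma has_taylor2_poly_pair:
  "has_taylor2 (poly_pair e n \<alpha> p \<beta> q) 0
     (\<lambda>i j. monom_coeff 1 e n i j +
        (monom_coeff \<i> (e * of_real \<alpha>) p i j + monom_coeff \<i> (e * (\<i> * of_real \<beta>)) q i j))"
proof -
  have eq: "poly_pair e n \<alpha> p \<beta> q = (\<lambda>z. 1 * of_real (Re (e * z ^ n)) +
      (\<i> * of_real (Re (e * of_real \<alpha> * z ^ p)) + \<i> * of_real (Re (e * (\<i> * of_real \<beta>) * z ^ q))))"
    by (auto simp: poly_pair_def fun_eq_iff complex_eq_iff algebra_simps)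
  show ?thesis
    unfolding eq by (intro has_taylor2_add has_taylor2_Re_monom)
qed

lemma poly_pair_0 [simp]: "1 \<le> n \<Longrightarrow> 1 \<le> p \<Longrightarrow> 1 \<le> q \<Longrightarrow> poly_pair e n \<alpha> p \<beta> q 0 = 0"
  by (simp add: poly_pair_def re_pair_def complex_eq_iff power_0_left)

lemma has_order_poly_pair:
  assumes "e \<noteq> 0" "1 \<le> n" "1 \<le> p" "1 \<le> q"
    and m: "m = n \<and> n < p \<and> n < q \<or> m = p \<and> p < n \<and> p < q \<and> \<alpha> \<noteq> 0"
  shows "has_order (poly_pair e n \<alpha> p \<beta> q) 0 m"
proof -
  let ?c = "\<lambda>i j. monom_coeff 1 e n i j +
        (monom_coeff \<i> (e * of_real \<alpha>) p i j + monom_coeff \<i> (e * (\<i> * of_real \<beta>)) q i j)"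
  have "\<exists>i j. ?c i j \<noteq> 0 \<and> i + j = m"
    using m
  proof
    assume m: "m = n \<and> n < p \<and> n < q"
    obtain i j where "monom_coeff 1 e n i j \<noteq> 0" "i + j = n"
      using monom_coeff_nonzero[of e 1 n] assms by auto
    then show ?thesis
      using m by (intro exI[of _ i] exI[of _ j]) (auto simp: monom_coeff_def)
  next
    assume m: "m = p \<and> p < n \<and> p < q \<and> \<alpha> \<noteq> 0"
    obtain i j where "monom_coeff \<i> (e * of_real \<alpha>) p i j \<noteq> 0" "i + j = p"
      using monom_coeff_nonzero[of "e * of_real \<alpha>" \<i> p] assms m by auto
    then show ?thesis
      using m by (intro exI[of _ i] exI[of _ j]) (auto simp: monom_coeff_def)
  qed
  moreover have "\<forall>i j. ?c i j \<noteq> 0 \<longrightarrow> m \<le> i + j"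
    using m by (auto simp: monom_coeff_def)
  ultimately show ?thesis
    unfolding has_order_def using has_taylor2_poly_pair[of e n \<alpha> p \<beta> q] assms(2-4)
    by (intro exI[of _ ?c]) simp
qed

section \<open>Norms over the n-th roots\<close>

text \<open>The norm of X + L w over the n-th roots w of y. Writing the roots as multiples of a
  single one by the roots of unity keeps n factors at y = 0, where all roots coincide; this makes
  the norm continuous there.\<close>

definition root_norm :: "nat \<Rightarrow> (complex \<Rightarrow> complex) \<Rightarrow> complex \<Rightarrow> complex \<Rightarrow> complex" where
  "root_norm n L X y = (\<Prod>\<xi> | \<xi> ^ n = 1. X + L (\<xi> * (SOME u. u ^ n = y)))"

text \<open>The disc of radius |y0| about y0 misses 0 and therefore carries a holomorphic
  logarithm.\<close>

lemma holomorphic_root_near: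
  fixes y0 :: complex
  assumes "1 \<le> n" "y0 \<noteq> 0"
  obtains A r where "open A" "y0 \<in> A" "r holomorphic_on A" "\<And>y. y \<in> A \<Longrightarrow> r y ^ n = y" "0 \<notin> A"
proof -
  have nz: "y \<noteq> 0" if "y \<in> ball y0 (norm y0)" for y
    using that by auto
  obtain g where g: "g holomorphic_on ball y0 (norm y0)" "\<And>y. y \<in> ball y0 (norm y0) \<Longrightarrow> y = exp (g y)"
    using contractible_imp_holomorphic_log[of "\<lambda>y. y" "ball y0 (norm y0)"] nz
    by (metis convex_ball convex_imp_contractible holomorphic_on_ident)
  show ?thesis
  proof
    show "(\<lambda>y. exp (g y / of_nat n)) holomorphic_on ball y0 (norm y0)"
      using g(1) assms(1) by (intro holomorphic_intros) auto
    show "exp (g y / of_nat n) ^ n = y" if "y \<in> ball y0 (norm y0)" for y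
      using g(2)[OF that] assms(1) by (simp add: exp_of_nat_mult[symmetric])
    show "0 \<notin> ball y0 (norm y0)" using nz by blast
  qed (use assms in auto)
qed

lemma some_root:
  assumes "1 \<le> n"
  shows "(SOME u::complex. u ^ n = y) ^ n = y"
proof -
  have "\<exists>u. u ^ n = y"
  proof (cases "y = 0")
    case True
    then show ?thesis using assms by (intro exI[of _ 0]) simp
  next
    case False
    then show ?thesis using holomorphic_root_near[OF assms False] by metis
  qed
  then show ?thesis by (rule someI_ex)
qed

text \<open>Two roots of the same nonzero y differ by a root of unity, and multiplication by it
  permutes the factors.\<close>

lemma root_norm_eq:
  assumes "1 \<le> n" "u ^ n = y"
  shows "root_norm n L X y = (\<Prod>\<xi> | \<xi> ^ n = 1. X + L (\<xi> * u))"
proof -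
  define s where "s = (SOME u::complex. u ^ n = y)"
  have s: "s ^ n = y" unfolding s_def by (rule some_root[OF assms(1)])
  show ?thesis
  proof (cases "y = 0")
    case True
    then have "s = u" using s assms by auto
    then show ?thesis by (simp add: root_norm_def s_def)
  next
    case False
    then have nz: "s \<noteq> 0" "u \<noteq> 0" using s assms by (auto simp: power_0_left)
    have "root_norm n L X y = (\<Prod>\<xi> | \<xi> ^ n = 1. X + L (\<xi> * s))"
      by (simp add: root_norm_def s_def)
    also have "\<dots> = (\<Prod>\<xi> | \<xi> ^ n = 1. X + L (\<xi> * u))"
      by (rule prod.reindex_bij_witness[of _ "\<lambda>\<xi>. \<xi> * u / s" "\<lambda>\<xi>. \<xi> * s / u"])
        (use nz s assms False in \<open>auto simp: power_divide power_mult_distrib\<close>)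
    finally show ?thesis .
  qed
qed

lemma continuous_on_root_norm:
  assumes n: "1 \<le> n" and L: "L holomorphic_on UNIV"
  shows "continuous_on UNIV (\<lambda>p. root_norm n L (fst p) (snd p))"
proof -
  have contL: "continuous_on S (\<lambda>x. L (f x))" if "continuous_on S f" for S :: "'a::topological_space
      set" and f
    using continuous_on_compose2[OF holomorphic_on_imp_continuous_on[OF L] that] by auto
  have "isCont (\<lambda>p. root_norm n L (fst p) (snd p)) (X0, y0)" for X0 y0
  proof (cases "y0 = 0")
    case False
    obtain A r where A: "open A" "y0 \<in> A" "r holomorphic_on A" "\<And>y. y \<in> A \<Longrightarrow> r y ^ n = y"
      using holomorphic_root_near[OF n False] by metis
    have "continuous_on (UNIV \<times> A) (\<lambda>p. r (snd p))"
      by (rule continuous_on_compose2[OF holomorphic_on_imp_continuous_on[OF A(3)]])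
        (auto intro: continuous_intros)
    then have "continuous_on (UNIV \<times> A) (\<lambda>p. \<Prod>\<xi> | \<xi> ^ n = 1. fst p + L (\<xi> * r (snd p)))"
      by (intro continuous_intros contL)
    then have "continuous_on (UNIV \<times> A) (\<lambda>p. root_norm n L (fst p) (snd p))"
      by (rule continuous_on_eq) (auto simp: root_norm_eq[OF n A(4)])
    then show ?thesis
      using A(1,2) by (simp add: continuous_on_eq_continuous_at open_Times)
  next
    case True
    define s where "s y = (SOME u::complex. u ^ n = y)" for y
    have s: "s y ^ n = y" for y
      unfolding s_def by (rule some_root[OF n])
    have "norm (s y) = root n (norm y)" for y
      using arg_cong[OF s[of y], of norm] n real_root_power_cancel[of n "norm (s y)"] by (simp add:
          norm_power)
    moreover have "((\<lambda>p. root n (norm (snd p))) \<longlongrightarrow> root n (norm (0::complex))) (at (X0, 0::complex))"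
      by (intro tendsto_intros tendsto_norm) (auto intro!: tendsto_eq_intros)
    ultimately have "((\<lambda>p. norm (s (snd p))) \<longlongrightarrow> 0) (at (X0, 0::complex))"
      using n by simp
    then have "((\<lambda>p. s (snd p)) \<longlongrightarrow> 0) (at (X0, 0::complex))"
      by (rule tendsto_norm_zero_cancel)
    then have "((\<lambda>p. \<xi> * s (snd p)) \<longlongrightarrow> 0) (at (X0, 0::complex))" for \<xi>
      by (rule tendsto_mult_right_zero)
    then have *: "((\<lambda>p. L (\<xi> * s (snd p))) \<longlongrightarrow> L 0) (at (X0, 0::complex))" for \<xi>
      using holomorphic_on_imp_continuous_on[OF L]
      by (intro isCont_tendsto_compose[of 0 L]) (auto simp: continuous_on_eq_continuous_at)
    have "((\<lambda>p. \<Prod>\<xi> | \<xi> ^ n = 1. fst p + L (\<xi> * s (snd p))) \<longlongrightarrow> (\<Prod>\<xi> | (\<xi>::complex) ^ n = 1. X0 + L 0))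
        (at (X0, 0::complex))"
      by (intro tendsto_prod tendsto_add *) (auto intro!: tendsto_eq_intros)
    moreover have "s 0 = 0" using s[of 0] by simp
    ultimately show ?thesis
      using True by (simp add: isCont_def root_norm_def s_def)
  qed
  then show ?thesis
    by (simp add: continuous_on_eq_continuous_at)
qed

lemma root_norm_local:
  assumes n: "1 \<le> n" and hol: "L holomorphic_on UNIV" "X holomorphic_on UNIV" "h holomorphic_on
      UNIV"
    and "h z \<noteq> 0"
  shows "\<exists>B u. open B \<and> z \<in> B \<and> (\<forall>x\<in>B. u x ^ n = h x) \<and>
    (\<forall>x\<in>B. root_norm n L (X x) (h x) = (\<Prod>\<xi> | \<xi> ^ n = 1. X x + L (\<xi> * u x))) \<and>
    (\<forall>\<xi>. (\<lambda>x. X x + L (\<xi> * u x)) holomorphic_on B)"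
proof -
  obtain A r where A: "open A" "h z \<in> A" "r holomorphic_on A" "\<And>y. y \<in> A \<Longrightarrow> r y ^ n = y"
    using holomorphic_root_near[OF n \<open>h z \<noteq> 0\<close>] by metis
  define B where "B = h -` A"
  have B: "open B" "z \<in> B"
    using A holomorphic_on_imp_continuous_on[OF hol(3)] by (auto simp: B_def open_vimage)
  have u: "(\<lambda>x. r (h x)) holomorphic_on B"
    using holomorphic_on_compose_gen[OF holomorphic_on_subset[OF hol(3)] A(3), of B] by (auto simp:
        o_def B_def)
  show ?thesis
  proof (intro exI[of _ B] exI[of _ "\<lambda>x. r (h x)"] conjI allI ballI)
    have "(\<lambda>x. L (\<xi> * r (h x))) holomorphic_on B" for \<xi>
      using holomorphic_on_compose_gen[OF _ hol(1), of "\<lambda>x. \<xi> * r (h x)" B] holomorphic_on_mult[OF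
          holomorphic_on_const u]
      by (simp add: o_def)
    then show "(\<lambda>x. X x + L (\<xi> * r (h x))) holomorphic_on B" for \<xi>
      using holomorphic_on_subset[OF hol(2)] by (intro holomorphic_intros) auto
  qed (use A u B in \<open>auto simp: B_def root_norm_eq[OF n]\<close>)
qed

text \<open>The zeros of h are branch points of the individual factors, but the norm is continuous
  across these finitely many points, so they are removable.\<close>

lemma holomorphic_root_norm:
  assumes n: "1 \<le> n" and hol: "L holomorphic_on UNIV" "X holomorphic_on UNIV" "h holomorphic_on
      UNIV"
    and fin: "finite {z. h z = 0}"
  shows "(\<lambda>z. root_norm n L (X z) (h z)) holomorphic_on UNIV"
proof (rule no_isolated_singularity[OF _ _ _ fin])
  have "continuous_on UNIV (\<lambda>z. (X z, h z))"
    using hol by (intro continuous_on_Pair holomorphic_on_imp_continuous_on)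
  then show "continuous_on UNIV (\<lambda>z. root_norm n L (X z) (h z))"
    using continuous_on_compose[OF _ continuous_on_subset[OF continuous_on_root_norm[OF n hol(1)]],
        of UNIV "\<lambda>z. (X z, h z)"]
    by (simp add: o_def)
  have "(\<lambda>z. root_norm n L (X z) (h z)) field_differentiable at z" if "h z \<noteq> 0" for z
  proof -
    obtain B u where B: "open B" "z \<in> B" "\<forall>x\<in>B. u x ^ n = h x"
      "\<forall>x\<in>B. root_norm n L (X x) (h x) = (\<Prod>\<xi> | \<xi> ^ n = 1. X x + L (\<xi> * u x))"
      "\<forall>\<xi>. (\<lambda>x. X x + L (\<xi> * u x)) holomorphic_on B"
      using root_norm_local[OF n hol \<open>h z \<noteq> 0\<close>] by blast
    have "(\<lambda>x. \<Prod>\<xi> | \<xi> ^ n = 1. X x + L (\<xi> * u x)) holomorphic_on B"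
      using B(5) by (intro holomorphic_on_prod) auto
    then have "(\<lambda>x. root_norm n L (X x) (h x)) holomorphic_on B"
      by (rule holomorphic_transform) (use B in auto)
    then show ?thesis
      using B by (metis holomorphic_on_imp_differentiable_at)
  qed
  then show "(\<lambda>z. root_norm n L (X z) (h z)) holomorphic_on UNIV - {z. h z = 0}"
    by (auto simp: holomorphic_on_def intro: field_differentiable_at_within)
qed auto

text \<open>Off the zeros of h the order of the norm is the sum of the orders of its n holomorphic
  factors, and distinct solutions w over z make distinct factors vanish. At a zero of h the only
  root is w = 0, so a positive order suffices.\<close>

lemma card_fibre_le_zorder:
  assumes n: "1 \<le> n" and hol: "L holomorphic_on UNIV" "X holomorphic_on UNIV" "h holomorphic_on
      UNIV"
    and fin: "finite {z. h z = 0}"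
    and nz: "eventually (\<lambda>z. root_norm n L (X z) (h z) \<noteq> 0) (at z)"
  shows "int (card {w. w ^ n = h z \<and> X z + L w = 0}) \<le> zorder (\<lambda>z. root_norm n L (X z) (h z)) z"
proof -
  let ?N = "\<lambda>z. root_norm n L (X z) (h z)"
  have holN: "?N holomorphic_on UNIV" by (rule holomorphic_root_norm[OF n hol fin])
  have fr: "frequently (\<lambda>z. f z \<noteq> 0) (at z)" if "eventually (\<lambda>z. f z \<noteq> 0) (at z)" for f :: "complex
      \<Rightarrow> complex"
    using that by (simp add: eventually_frequently)
  show ?thesis
  proof (cases "h z = 0")
    case True
    have ge0: "0 \<le> zorder ?N z"
      using zorder_ge_0[of ?N z] holN fr[OF nz] analytic_on_holomorphic by blast
    have eq: "{w. w ^ n = h z \<and> X z + L w = 0} = (if X z + L 0 = 0 then {0} else {})"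
      using True n by (auto simp: power_0_left)
    show ?thesis
    proof (cases "X z + L 0 = 0")
      case True
      have "?N z = (\<Prod>\<xi> | \<xi> ^ n = 1. X z + L (\<xi> * 0))"
        by (rule root_norm_eq[OF n]) (use \<open>h z = 0\<close> n in auto)
      also have "\<dots> = 0"
      proof (rule prod_zero)
        show "finite {\<xi>::complex. \<xi> ^ n = 1}" using n by (intro finite_nth_roots) auto
        show "\<exists>\<xi>\<in>{\<xi>. \<xi> ^ n = 1}. X z + L (\<xi> * 0) = 0" using True by (auto intro: exI[of _ 1])
      qed
      finally have "zorder ?N z > 0"
        using zorder_pos_iff[OF holN open_UNIV _ fr[OF nz]] by auto
      then show ?thesis unfolding eq using True by simp
    next
      case False
      then show ?thesis unfolding eq using ge0 by simp
    qed
  next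
    case False
    obtain B u where B: "open B" "z \<in> B" "\<forall>x\<in>B. u x ^ n = h x"
      "\<forall>x\<in>B. root_norm n L (X x) (h x) = (\<Prod>\<xi> | \<xi> ^ n = 1. X x + L (\<xi> * u x))"
      "\<forall>\<xi>. (\<lambda>x. X x + L (\<xi> * u x)) holomorphic_on B"
      using root_norm_local[OF n hol False] by blast
    have finr: "finite {\<xi>::complex. \<xi> ^ n = 1}" using n by (intro finite_nth_roots) auto
    have evB: "eventually (\<lambda>x. x \<in> B) (at z)"
      using B by (intro eventually_at_in_open')
    have ev: "eventually (\<lambda>x. (\<Prod>\<xi> | \<xi> ^ n = 1. X x + L (\<xi> * u x)) \<noteq> 0) (at z)"
      using nz evB
    proof eventually_elim
      case (elim x)
      show ?case unfolding B(4)[rule_format, OF elim(2), symmetric] by (rule elim(1))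
    qed
    have "eventually (\<lambda>x. ?N x = (\<Prod>\<xi> | \<xi> ^ n = 1. X x + L (\<xi> * u x))) (at z)"
      using evB by eventually_elim (rule B(4)[rule_format])
    then have "zorder ?N z = zorder (\<lambda>x. \<Prod>\<xi> | \<xi> ^ n = 1. X x + L (\<xi> * u x)) z"
      by (rule zorder_cong) simp
    also have "\<dots> = (\<Sum>\<xi> | \<xi> ^ n = 1. zorder (\<lambda>x. X x + L (\<xi> * u x)) z)"
      by (rule zorder_prod_analytic) (use B ev in \<open>auto simp: analytic_at\<close>)
    also have "\<dots> \<ge> (\<Sum>\<xi> | \<xi> ^ n = 1. if X z + L (\<xi> * u z) = 0 then 1 else 0)"
    proof (rule sum_mono)
      fix \<xi> :: complex assume \<xi>: "\<xi> \<in> {\<xi>. \<xi> ^ n = 1}"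
      have "eventually (\<lambda>x. X x + L (\<xi> * u x) \<noteq> 0) (at z)"
        using ev by eventually_elim (use \<xi> finr in auto)
      note f = fr[OF this]
      have an: "(\<lambda>x. X x + L (\<xi> * u x)) analytic_on {z}"
        using B(1,2,5) analytic_at by blast
      show "(if X z + L (\<xi> * u z) = 0 then 1 else 0) \<le> zorder (\<lambda>x. X x + L (\<xi> * u x)) z"
        using zorder_pos_iff[OF B(5)[rule_format] B(1,2) f] zorder_ge_0[OF an f] by presburger
    qed
    also have "(\<Sum>\<xi> | \<xi> ^ n = 1. if X z + L (\<xi> * u z) = 0 then 1 else 0) = int (card {\<xi>. \<xi> ^ n = 1 \<and>
        X z + L (\<xi> * u z) = 0})"
      using finr by (simp add: sum.If_cases Int_def)
    also have "card {\<xi>. \<xi> ^ n = 1 \<and> X z + L (\<xi> * u z) = 0} = card {w. w ^ n = h z \<and> X z + L w = 0}"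
    proof (rule bij_betw_same_card[of "\<lambda>\<xi>. \<xi> * u z"])
      have "u z \<noteq> 0" using B(3)[rule_format, OF B(2)] False n by (auto simp: power_0_left)
      then show "bij_betw (\<lambda>\<xi>. \<xi> * u z) {\<xi>. \<xi> ^ n = 1 \<and> X z + L (\<xi> * u z) = 0} {w. w ^ n = h z \<and> X z
          + L w = 0}"
        by (intro bij_betwI[of _ _ _ "\<lambda>w. w / u z"])
          (use B(3)[rule_format, OF B(2)] False in \<open>auto simp: power_divide power_mult_distrib\<close>)
    qed
    finally show ?thesis by simp
  qed
qed

section \<open>Counting the solutions of the complexified equations\<close>

text \<open>With u = exp g near 0, z^d u z is the d-th power of f z = z exp (g z / d). By the open
  mapping theorem the image of f contains a disc, and a small b \<noteq> 0 has d distinct d-th roots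
  in it.\<close>

lemma local_power_solutions:
  assumes u: "u holomorphic_on UNIV" "u 0 \<noteq> 0" and d: "1 \<le> d" and eps: "0 < \<epsilon>"
  obtains \<delta> where "0 < \<delta>"
    "\<And>b. 0 < norm b \<Longrightarrow> norm b < \<delta> \<Longrightarrow> \<exists>A. finite A \<and> card A = d \<and> (\<forall>z\<in>A. norm z < \<epsilon> \<and> z ^ d * u z = b)"
proof -
  have "isCont u 0"
    using holomorphic_on_imp_continuous_on[OF u(1)] by (simp add: continuous_on_eq_continuous_at)
  then obtain e where e: "0 < e" "\<And>z. dist z 0 < e \<Longrightarrow> u z \<noteq> 0"
    using continuous_at_avoid[of 0 u 0] u(2) by (auto simp: dist_commute)
  define r where "r = min e \<epsilon>"
  have r: "0 < r" using e eps by (simp add: r_def)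
  have "\<exists>g. g holomorphic_on ball 0 r \<and> (\<forall>z\<in>ball 0 r. u z = exp (g z))"
    using contractible_imp_holomorphic_log[of u "ball 0 r"] e(2) holomorphic_on_subset[OF u(1)]
    by (metis convex_ball convex_imp_contractible dist_commute mem_ball min_less_iff_conj r_def
        top_greatest)
  then obtain g where g: "g holomorphic_on ball 0 r" "\<And>z. z \<in> ball 0 r \<Longrightarrow> u z = exp (g z)"
    by blast
  define f where "f z = z * exp (g z / of_nat d)" for z
  have f: "f holomorphic_on ball 0 r"
    unfolding f_def using g d by (intro holomorphic_intros) auto
  have fd: "f z ^ d = z ^ d * u z" if "z \<in> ball 0 r" for z
    using g(2)[OF that] d by (simp add: f_def power_mult_distrib exp_of_nat_mult[symmetric])
  have "\<not> f constant_on ball 0 r"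
  proof
    assume "f constant_on ball 0 r"
    moreover have "f 0 = 0" by (simp add: f_def)
    moreover have "of_real (r/2) \<in> ball (0::complex) r" "(0::complex) \<in> ball 0 r" using r by auto
    ultimately have "f (of_real (r/2)) = 0" unfolding constant_on_def by metis
    then show False using r by (simp add: f_def)
  qed
  then have "open (f ` ball 0 r)"
    by (intro open_mapping_thm[OF f]) auto
  moreover have "0 \<in> f ` ball 0 r"
    using r by (auto simp: f_def intro!: image_eqI[of _ _ 0])
  ultimately obtain s where s: "0 < s" "ball 0 s \<subseteq> f ` ball 0 r"
    by (meson openE)
  show thesis
  proof
    \<comment> \<open>For |b| < s^d all d-th roots of b lie in the disc of radius s.\<close>
    show "0 < s ^ d" using s by simp
    fix b :: complex assume b: "0 < norm b" "norm b < s ^ d"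
    let ?R = "{w. w ^ d = b}"
    have R: "finite ?R" "card ?R = d"
      using b d by (auto simp: card_nth_roots intro: finite_nth_roots)
    have "?R \<subseteq> f ` ball 0 r"
    proof
      fix w assume "w \<in> ?R"
      then have "norm w ^ d < s ^ d" using b by (auto simp: norm_power[symmetric])
      then have "norm w < s" using s by (meson less_imp_le power_less_imp_less_base)
      then show "w \<in> f ` ball 0 r" using s by auto
    qed
    then obtain A where A: "A \<subseteq> ball 0 r" "?R = f ` A" "inj_on f A"
      by (meson subset_image_inj)
    have "finite A" "card A = d"
      using A R finite_image_iff card_image by metis+
    moreover have "norm z < \<epsilon> \<and> z ^ d * u z = b" if "z \<in> A" for z
    proof -
      have "f z ^ d = b" using that A by auto
      then show ?thesis using that A fd[of z] by (auto simp: r_def)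
    qed
    ultimately show "\<exists>A. finite A \<and> card A = d \<and> (\<forall>z\<in>A. norm z < \<epsilon> \<and> z ^ d * u z = b)" by blast
  qed
qed

text \<open>The two equations are \<open>w ^ n = \<omega> * z ^ n + a\<close> and \<open>K z + L w = b\<close>; \<open>d \<zeta>\<close> is the order of
  contact of the second one with the line \<open>w = \<zeta> * z\<close>.\<close>

locale pencil =
  fixes n :: nat and \<omega> :: complex and K L :: "complex \<Rightarrow> complex"
    and d :: "complex \<Rightarrow> nat" and u :: "complex \<Rightarrow> complex \<Rightarrow> complex"
  assumes n: "1 \<le> n" and om: "\<omega> \<noteq> 0"
    and hol: "K holomorphic_on UNIV" "L holomorphic_on UNIV"
    and fac: "\<zeta> ^ n = \<omega> \<Longrightarrow> K z + L (\<zeta> * z) = z ^ d \<zeta> * u \<zeta> z"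
    and holu: "\<zeta> ^ n = \<omega> \<Longrightarrow> u \<zeta> holomorphic_on UNIV"
    and u0: "\<zeta> ^ n = \<omega> \<Longrightarrow> u \<zeta> 0 \<noteq> 0"
    and d1: "\<zeta> ^ n = \<omega> \<Longrightarrow> 1 \<le> d \<zeta>"
begin

definition sols :: "complex \<Rightarrow> complex \<Rightarrow> (complex \<times> complex) set"
  where "sols a b = {(z, w). w ^ n = \<omega> * z ^ n + a \<and> K z + L w = b}"

text \<open>The local intersection number at the origin of the curve K z + L w = 0 with the n lines
  into which w^n = \<omega> z^n splits.\<close>

definition mult :: nat where "mult = (\<Sum>\<zeta> | \<zeta> ^ n = \<omega>. d \<zeta>)"

lemma finite_roots: "finite {\<zeta>. \<zeta> ^ n = \<omega>}"
  using n by (intro finite_nth_roots) auto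

text \<open>On the line w = \<zeta> z the second equation reads
  \<open>z ^ d \<zeta> * u \<zeta> z = b\<close>, which has \<open>d \<zeta>\<close> small
  solutions.\<close>

lemma many_solutions:
  assumes "0 < \<epsilon>"
  obtains \<delta> where "0 < \<delta>" "\<And>b. 0 < norm b \<Longrightarrow> norm b < \<delta> \<Longrightarrow>
     \<exists>A\<subseteq>sols 0 b. finite A \<and> card A = mult \<and> (\<forall>(z, w)\<in>A. norm z < \<epsilon> \<and> norm w < \<epsilon>)"
proof -
  let ?R = "{\<zeta>. \<zeta> ^ n = \<omega>}"
  \<comment> \<open>M exceeds the modulus of every slope \<zeta>, so that |z| < \<epsilon> / M
    bounds w = \<zeta> z by \<epsilon>.\<close>
  define M where "M = 1 + Max (norm ` ?R)"
  have M: "norm \<zeta> < M" if "\<zeta> ^ n = \<omega>" for \<zeta>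
  proof -
    have "norm \<zeta> \<le> Max (norm ` ?R)" by (rule Max_ge) (use finite_roots that in auto)
    then show ?thesis by (simp add: M_def)
  qed
  obtain \<zeta>0 where "\<zeta>0 ^ n = \<omega>" using some_root[OF n] by blast
  from M[OF this] have "0 < M" using norm_ge_zero[of \<zeta>0] by linarith
  define e where "e = min \<epsilon> (\<epsilon> / M)"
  have e: "0 < e" using assms \<open>0 < M\<close> by (simp add: e_def)
  define P where "P \<zeta> b A \<longleftrightarrow> finite A \<and> card A = d \<zeta> \<and> (\<forall>z\<in>A. norm z < e \<and> z ^ d \<zeta> * u \<zeta> z = b)" for
      \<zeta> b A
  have "\<exists>\<delta>>0. \<forall>b. 0 < norm b \<and> norm b < \<delta> \<longrightarrow> (\<exists>A. P \<zeta> b A)" if "\<zeta> \<in> ?R" for \<zeta>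
  proof -
    have z: "\<zeta> ^ n = \<omega>" using that by simp
    show ?thesis unfolding P_def by (rule local_power_solutions[OF holu[OF z] u0[OF z] d1[OF z] e])
        blast
  qed
  then obtain D where D: "\<And>\<zeta>. \<zeta> \<in> ?R \<Longrightarrow> 0 < D \<zeta>"
    "\<And>\<zeta> b. \<zeta> \<in> ?R \<Longrightarrow> 0 < norm b \<Longrightarrow> norm b < D \<zeta> \<Longrightarrow> \<exists>A. P \<zeta> b A"
    by metis
  define \<delta> where "\<delta> = Min (D ` ?R)"
  have ne: "?R \<noteq> {}" using \<open>\<zeta>0 ^ n = \<omega>\<close> by blast
  show thesis
  proof
    show "0 < \<delta>" unfolding \<delta>_def using finite_roots ne D(1) by (subst Min_gr_iff) auto
    fix b :: complex assume b: "0 < norm b" "norm b < \<delta>"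
    have "norm b < D \<zeta>" if "\<zeta> \<in> ?R" for \<zeta>
    proof -
      have "\<delta> \<le> D \<zeta>" unfolding \<delta>_def by (rule Min_le) (use that finite_roots in auto)
      then show ?thesis using b(2) by simp
    qed
    then have "\<forall>\<zeta>\<in>?R. \<exists>A. P \<zeta> b A"
      using D(2)[OF _ b(1)] by blast
    from bchoice[OF this] obtain A where "\<forall>\<zeta>\<in>?R. P \<zeta> b (A \<zeta>)"
      by blast
    then have A: "finite (A \<zeta>)" "card (A \<zeta>) = d \<zeta>" "\<And>z. z \<in> A \<zeta> \<Longrightarrow> norm z < e"
      "\<And>z. z \<in> A \<zeta> \<Longrightarrow> z ^ d \<zeta> * u \<zeta> z = b" if "\<zeta> \<in> ?R" for \<zeta>
      using that unfolding P_def by blast+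
    \<comment> \<open>The lines meet only at the origin, which b \<noteq> 0 excludes, so solutions
      on different lines are distinct.\<close>
    have Anz: "z \<noteq> 0" if "\<zeta> \<in> ?R" "z \<in> A \<zeta>" for \<zeta> z
      using A(4)[OF that] that(1) d1[of \<zeta>] b(1) by (auto simp: power_0_left)
    define B where "B = (\<lambda>(\<zeta>, z). (z, \<zeta> * z)) ` Sigma ?R A"
    have inj: "inj_on (\<lambda>(\<zeta>, z). (z, \<zeta> * z)) (Sigma ?R A)"
      using Anz by (auto simp: inj_on_def)
    have "card B = mult"
      unfolding B_def mult_def using A finite_roots by (subst card_image[OF inj]) simp
    moreover have "finite B" unfolding B_def using A finite_roots by auto
    moreover have "B \<subseteq> sols 0 b"
      using A by (auto simp: B_def sols_def power_mult_distrib fac)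
    moreover have "norm z < \<epsilon> \<and> norm w < \<epsilon>" if "(z, w) \<in> B" for z w
    proof -
      obtain \<zeta> where z: "\<zeta> \<in> ?R" "z \<in> A \<zeta>" "w = \<zeta> * z"
        using \<open>(z, w) \<in> B\<close> by (auto simp: B_def)
      then have "norm z < e" using A by blast
      have "norm w \<le> M * norm z"
        using M[of \<zeta>] z by (auto simp: norm_mult intro!: mult_right_mono)
      also have "\<dots> < M * e" using \<open>norm z < e\<close> \<open>0 < M\<close> by simp
      also have "\<dots> \<le> M * (\<epsilon> / M)" using \<open>0 < M\<close> by (intro mult_left_mono) (auto simp: e_def)
      also have "\<dots> = \<epsilon>" using \<open>0 < M\<close> by simp
      finally show ?thesis using \<open>norm z < e\<close> by (auto simp: e_def)
    qed
    ultimately show "\<exists>A\<subseteq>sols 0 b. finite A \<and> card A = mult \<and> (\<forall>(z, w)\<in>A. norm z < \<epsilon> \<and> norm w < \<epsilon>)"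
      by blast
  qed
qed

definition N :: "complex \<Rightarrow> complex \<Rightarrow> complex \<Rightarrow> complex"
  where "N a b z = root_norm n L (K z - b) (\<omega> * z ^ n + a)"

lemma finite_h: "finite {z. \<omega> * z ^ n + a = 0}"
proof -
  have "{z. \<omega> * z ^ n + a = 0} = {z. z ^ n = - a / \<omega>}"
    using om by (auto simp: field_simps add_eq_0_iff)
  then show ?thesis using n by (simp add: finite_nth_roots)
qed

lemma holomorphic_N: "N a b holomorphic_on UNIV"
  unfolding N_def
  using n hol finite_h by (intro holomorphic_root_norm holomorphic_intros) auto

text \<open>Joint continuity in z, a and b makes \<open>N a b\<close> uniformly close to
  \<open>N 0 0\<close> on a whole circle once a and b are small.\<close>

lemma continuous_N: "continuous_on UNIV (\<lambda>(z, a, b). N a b z)"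
proof -
  have "continuous_on UNIV K" by (rule holomorphic_on_imp_continuous_on[OF hol(1)])
  then have K: "continuous_on UNIV (\<lambda>x::complex \<times> complex \<times> complex. K (fst x))"
    by (rule continuous_on_compose2) (auto intro: continuous_intros)
  have "continuous_on UNIV (\<lambda>x::complex \<times> complex \<times> complex. (K (fst x) - snd (snd x), \<omega> * fst x ^ n
      + fst (snd x)))"
    by (intro continuous_intros K)
  from continuous_on_compose[OF this continuous_on_subset[OF continuous_on_root_norm[OF n hol(2)]]]
  show ?thesis by (simp add: o_def N_def case_prod_unfold)
qed

text \<open>For a = 0 the root \<zeta>0 z of \<omega> z^n is available for all z, so the norm
  becomes a product over the lines and each factor contributes its order of contact.\<close>

lemma N_00: "\<exists>U. U holomorphic_on UNIV \<and> U 0 \<noteq> 0 \<and> (\<forall>z. N 0 0 z = z ^ mult * U z)"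
proof -
  obtain \<zeta>0 where \<zeta>0: "\<zeta>0 ^ n = \<omega>" using some_root[OF n] by blast
  then have nz: "\<zeta>0 \<noteq> 0" using om n by (auto simp: power_0_left)
  let ?U = "\<lambda>z. \<Prod>\<zeta> | \<zeta> ^ n = \<omega>. u \<zeta> z"
  have "N 0 0 z = z ^ mult * ?U z" for z
  proof -
    have "N 0 0 z = (\<Prod>\<xi> | \<xi> ^ n = 1. K z + L (\<xi> * (\<zeta>0 * z)))"
      unfolding N_def by (subst root_norm_eq[OF n, of "\<zeta>0 * z"]) (auto simp: \<zeta>0 power_mult_distrib)
    also have "\<dots> = (\<Prod>\<zeta> | \<zeta> ^ n = \<omega>. K z + L (\<zeta> * z))"
      by (rule prod.reindex_bij_witness[of _ "\<lambda>\<zeta>. \<zeta> / \<zeta>0" "\<lambda>\<xi>. \<xi> * \<zeta>0"])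
        (use nz \<zeta>0 om in \<open>auto simp: power_divide power_mult_distrib mult.assoc\<close>)
    also have "\<dots> = (\<Prod>\<zeta> | \<zeta> ^ n = \<omega>. z ^ d \<zeta> * u \<zeta> z)"
      by (rule prod.cong) (auto simp: fac)
    also have "\<dots> = z ^ mult * ?U z"
      by (simp add: prod.distrib mult_def power_sum)
    finally show ?thesis .
  qed
  moreover have "?U holomorphic_on UNIV" using holu by (intro holomorphic_on_prod) auto
  moreover have "?U 0 \<noteq> 0" using u0 finite_roots by auto
  ultimately show ?thesis by (intro exI[of _ ?U]) blast
qed

lemma zero_of_N:
  assumes "(z, w) \<in> sols a b"
  shows "N a b z = 0"
proof -
  have w: "w ^ n = \<omega> * z ^ n + a" "K z - b + L (1 * w) = 0" using assms by (auto simp: sols_def)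
  show ?thesis
    unfolding N_def root_norm_eq[OF n w(1)]
  proof (rule prod_zero)
    show "finite {\<xi>::complex. \<xi> ^ n = 1}" using n by (intro finite_nth_roots) auto
  qed (use w in \<open>auto intro!: exI[of _ 1]\<close>)
qed

text \<open>Only z is restricted. The norm sees every w over z, so the zeros of \<open>N a b\<close>
  with |z| < R account for all solutions there, however large w is. Their total order is
  \<open>mult\<close> by Rouche's theorem, and the order at each z bounds the number of w over
  it.\<close>

lemma few_solutions:
  obtains R \<delta> where "0 < R" "0 < \<delta>" "\<And>z w. norm z \<le> R \<Longrightarrow> (z, w) \<in> sols 0 0 \<Longrightarrow> z = 0 \<and> w = 0"
    "\<And>a b. norm a < \<delta> \<Longrightarrow> norm b < \<delta> \<Longrightarrow>
       finite {(z, w) \<in> sols a b. norm z < R} \<and> card {(z, w) \<in> sols a b. norm z < R} \<le> mult"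
proof -
  obtain U where U: "U holomorphic_on UNIV" "U 0 \<noteq> 0" "\<And>z. N 0 0 z = z ^ mult * U z"
    using N_00 by blast
  have "isCont U 0"
    using holomorphic_on_imp_continuous_on[OF U(1)] by (simp add: continuous_on_eq_continuous_at)
  then obtain r where r: "0 < r" "\<And>z. norm z < r \<Longrightarrow> U z \<noteq> 0"
    using continuous_at_avoid[of 0 U 0] U(2) by (auto simp: dist_norm)
  define R where "R = r / 2"
  have R: "0 < R" "\<And>z. norm z \<le> R \<Longrightarrow> U z \<noteq> 0" using r by (auto simp: R_def)
  have N0: "N 0 0 z \<noteq> 0" if "norm z \<le> R" "z \<noteq> 0" for z
    using that R U by auto
  let ?C = "sphere (0::complex) R"
  have "compact ((\<lambda>z. norm (N 0 0 z)) ` ?C)"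
    by (intro compact_continuous_image continuous_intros
        continuous_on_subset[OF holomorphic_on_imp_continuous_on[OF holomorphic_N]]) auto
  moreover have "?C \<noteq> {}" using R by simp
  ultimately obtain z0 where z0: "z0 \<in> ?C" "\<And>z. z \<in> ?C \<Longrightarrow> norm (N 0 0 z0) \<le> norm (N 0 0 z)"
    using compact_attains_inf[of "(\<lambda>z. norm (N 0 0 z)) ` ?C"] by auto
  have c: "0 < norm (N 0 0 z0)" using N0[of z0] z0 R by auto
  have "compact (?C \<times> cball (0::complex) 1 \<times> cball (0::complex) 1)" by (intro compact_Times) auto
  then have "uniformly_continuous_on (?C \<times> cball 0 1 \<times> cball 0 1) (\<lambda>(z, a, b). N a b z)"
    by (intro compact_uniformly_continuous continuous_on_subset[OF continuous_N]) auto
  then obtain \<eta> where \<eta>: "0 < \<eta>" "\<And>x y. \<lbrakk>x \<in> ?C \<times> cball 0 1 \<times> cball 0 1; y \<in> ?C \<times> cball 0 1 \<times> cball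
      0 1; dist x y < \<eta>\<rbrakk>
     \<Longrightarrow> dist ((\<lambda>(z, a, b). N a b z) x) ((\<lambda>(z, a, b). N a b z) y) < norm (N 0 0 z0)"
    using c unfolding uniformly_continuous_on_def by (metis dist_commute)
  define \<delta> where "\<delta> = min 1 (\<eta> / 2)"
  have \<delta>: "0 < \<delta>" using \<eta> by (simp add: \<delta>_def)
  have close: "norm (N a b z - N 0 0 z) < norm (N 0 0 z)" if "norm a < \<delta>" "norm b < \<delta>" "z \<in> ?C" for
      a b z
  proof -
    have "dist (z, a, b) (z, 0, 0) \<le> norm a + norm b"
      by (simp add: dist_norm norm_Pair_le)
    also have "\<dots> < \<eta>" using that by (simp add: \<delta>_def)
    finally have "dist (N a b z) (N 0 0 z) < norm (N 0 0 z0)"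
      using \<eta>(2)[of "(z, a, b)" "(z, 0, 0)"] that by (auto simp: \<delta>_def)
    then show ?thesis using z0(2)[OF that(3)] by (simp add: dist_norm)
  qed
  \<comment> \<open>An open set around the closed disc, as Rouche's theorem requires. Zeros in it
    outside the circle have winding number 0 and drop out in \<open>sum_circle\<close>.\<close>
  let ?s = "ball (0::complex) (R + 1)"
  have nonconst: "finite {z \<in> ?s. N a b z = 0}" if "z1 \<in> ?C" "N a b z1 \<noteq> 0" for a b z1
  proof (cases "N a b constant_on UNIV")
    case True
    then have "{z \<in> ?s. N a b z = 0} = {}" using that by (auto simp: constant_on_def)
    then show ?thesis by (metis finite.emptyI)
  next
    case False
    have "finite {z \<in> cball 0 (R + 1). N a b z = 0}"
      by (rule holomorphic_compact_finite_zeros[OF holomorphic_N _ _ _ _ False]) auto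
    then show ?thesis by (rule rev_finite_subset) auto
  qed
  have sum_circle: "(\<Sum>p \<in> {z \<in> ?s. f z = 0}. winding_number (circlepath 0 R) p * of_int (zorder f
      p)) =
      of_int (\<Sum>p \<in> {z. norm z < R \<and> f z = 0}. zorder f p)"
    if "finite {z \<in> ?s. f z = 0}" "\<And>z. z \<in> ?C \<Longrightarrow> f z \<noteq> 0" for f :: "complex \<Rightarrow> complex"
  proof -
    have "(\<Sum>p \<in> {z. norm z < R \<and> f z = 0}. winding_number (circlepath 0 R) p * of_int (zorder f p))
        =
       (\<Sum>p \<in> {z \<in> ?s. f z = 0}. winding_number (circlepath 0 R) p * of_int (zorder f p))"
    proof (rule sum.mono_neutral_left)
      show "\<forall>i\<in>{z \<in> ?s. f z = 0} - {z. norm z < R \<and> f z = 0}. winding_number (circlepath 0 R) i *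
          of_int (zorder f i) = 0"
      proof
        fix i assume i: "i \<in> {z \<in> ?s. f z = 0} - {z. norm z < R \<and> f z = 0}"
        then have "norm i \<noteq> R" using that(2)[of i] by auto
        then have "norm i > R" using i by auto
        then have "winding_number (circlepath 0 R) i = 0"
          using R by (intro winding_number_zero_outside[where s = "cball 0 R"]) auto
        then show "winding_number (circlepath 0 R) i * of_int (zorder f i) = 0" by simp
      qed
    qed (use that in auto)
    moreover have "(\<Sum>p \<in> {z. norm z < R \<and> f z = 0}. winding_number (circlepath 0 R) p * of_int
        (zorder f p)) =
       (\<Sum>p \<in> {z. norm z < R \<and> f z = 0}. of_int (zorder f p))"
      by (rule sum.cong) (auto simp: winding_number_circlepath)
    ultimately show ?thesis by simp
  qed
  have "zorder (N 0 0) 0 = int mult"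
    by (rule zorder_eqI[OF open_UNIV _ U(1,2)]) (auto simp: U(3))
  moreover have "{z. norm z < R \<and> N 0 0 z = 0} = (if mult = 0 then {} else {0})"
    using R U by (auto simp: power_0_left)
  ultimately have sum0: "(\<Sum>p \<in> {z. norm z < R \<and> N 0 0 z = 0}. zorder (N 0 0) p) = int mult" by simp
  show thesis
  proof
    show "0 < R" "0 < \<delta>" by fact+
    show "z = 0 \<and> w = 0" if "norm z \<le> R" "(z, w) \<in> sols 0 0" for z w
    proof -
      have "z = 0" using zero_of_N[OF that(2)] N0[OF that(1)] by blast
      moreover from this have "w ^ n = 0" using that(2) n by (simp add: sols_def)
      ultimately show ?thesis by simp
    qed
    fix a b :: complex assume ab: "norm a < \<delta>" "norm b < \<delta>"
    have nzC: "N a b z \<noteq> 0" if "z \<in> ?C" for z using close[OF ab that] by auto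
    have nzC0: "N 0 0 z \<noteq> 0" if "z \<in> ?C" for z using N0[of z] that R by auto
    obtain z1 where z1: "z1 \<in> ?C" using \<open>?C \<noteq> {}\<close> by blast
    have fin: "finite {z \<in> ?s. N a b z = 0}" "finite {z \<in> ?s. N 0 0 z = 0}"
      using nonconst[OF z1] nzC[OF z1] nzC0[OF z1] by auto
    have rouche: "(\<Sum>p \<in> {z \<in> ?s. N a b z = 0}. winding_number (circlepath 0 R) p * of_int (zorder (N
        a b) p)) =
      (\<Sum>p \<in> {z \<in> ?s. N 0 0 z = 0}. winding_number (circlepath 0 R) p * of_int (zorder (N 0 0) p))"
    proof -
      have "(\<lambda>z. N a b z - N 0 0 z) holomorphic_on ?s" "N 0 0 holomorphic_on ?s"
        by (intro holomorphic_intros holomorphic_on_subset[OF holomorphic_N]; simp)+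
      note holR = this
      have "(\<Sum>p \<in> {p \<in> ?s. N 0 0 p + (N a b p - N 0 0 p) = 0}. winding_number (circlepath 0 R) p *
            of_int (zorder (\<lambda>p. N 0 0 p + (N a b p - N 0 0 p)) p)) =
          (\<Sum>p \<in> {p \<in> ?s. N 0 0 p = 0}. winding_number (circlepath 0 R) p * of_int (zorder (N 0 0)
              p))"
      proof (rule Rouche_theorem)
        show "\<forall>z. z \<notin> ?s \<longrightarrow> winding_number (circlepath 0 R) z = 0"
          using R by (auto intro!: winding_number_zero_outside[where s = "cball 0 R"])
        show "\<forall>z\<in>path_image (circlepath 0 R). norm (N a b z - N 0 0 z) < norm (N 0 0 z)"
          using close[OF ab] R by auto
      qed (use holR fin R in auto)
      then show ?thesis by simp
    qed
    have sumN: "(\<Sum>p \<in> {z. norm z < R \<and> N a b z = 0}. zorder (N a b) p) = int mult"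
    proof -
      have "(\<Sum>p \<in> {z \<in> ?s. N a b z = 0}. winding_number (circlepath 0 R) p * of_int (zorder (N a b)
          p)) =
          of_int (\<Sum>p \<in> {z. norm z < R \<and> N a b z = 0}. zorder (N a b) p)"
        by (rule sum_circle[OF fin(1)]) (rule nzC)
      moreover have "(\<Sum>p \<in> {z \<in> ?s. N 0 0 z = 0}. winding_number (circlepath 0 R) p * of_int (zorder
          (N 0 0) p)) =
          of_int (\<Sum>p \<in> {z. norm z < R \<and> N 0 0 z = 0}. zorder (N 0 0) p)"
        by (rule sum_circle[OF fin(2)]) (rule nzC0)
      ultimately have "(of_int (\<Sum>p \<in> {z. norm z < R \<and> N a b z = 0}. zorder (N a b) p) :: complex) =
          of_int (int mult)"
        using rouche unfolding sum0 by (rule_tac trans[OF trans[OF sym]])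
      then show ?thesis by (simp only: of_int_eq_iff)
    qed
    have Z: "finite {z. norm z < R \<and> N a b z = 0}"
      by (rule finite_subset[OF _ fin(1)]) (use R in auto)
    have finw: "finite {w. w ^ n = \<omega> * z ^ n + a \<and> K z - b + L w = 0}" for z
      by (rule finite_subset[OF _ finite_nth_roots[of n "\<omega> * z ^ n + a"]]) (use n in auto)
    have eq: "{(z, w) \<in> sols a b. norm z < R} =
      Sigma {z. norm z < R \<and> N a b z = 0} (\<lambda>z. {w. w ^ n = \<omega> * z ^ n + a \<and> K z - b + L w = 0})"
      using zero_of_N[of _ _ a b] eq_iff_diff_eq_0[of "K _ + L _" b]
      by (force simp: sols_def add_diff_eq[symmetric] diff_add_eq)
    \<comment> \<open>If the zeros accumulated anywhere, \<open>N a b\<close> would vanish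
      identically, in particular on the circle.\<close>
    have nz: "eventually (\<lambda>z. N a b z \<noteq> 0) (at z)" for z
    proof (rule ccontr)
      assume "\<not> ?thesis"
      then have "z islimpt {z. N a b z = 0}"
        by (simp add: islimpt_iff_eventually)
      then have "N a b z1 = 0"
        by (rule analytic_continuation[where f = "N a b" and U = "{z. N a b z = 0}" and S = UNIV and
            \<xi> = z,
              OF holomorphic_N open_UNIV connected_UNIV subset_UNIV UNIV_I]) simp_all
      then show False using nzC[OF z1] by simp
    qed
    have "int (card {w. w ^ n = \<omega> * z ^ n + a \<and> K z - b + L w = 0}) \<le> zorder (N a b) z" for z
    proof -
      have "(\<lambda>z. K z - b) holomorphic_on UNIV" "(\<lambda>z. \<omega> * z ^ n + a) holomorphic_on UNIV"
        by (intro holomorphic_intros hol)+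
      from card_fibre_le_zorder[OF n hol(2) this finite_h, of z] nz[of z] show ?thesis
        by (simp add: N_def[abs_def])
    qed
    then have "int (\<Sum>z \<in> {z. norm z < R \<and> N a b z = 0}. card {w. w ^ n = \<omega> * z ^ n + a \<and> K z - b + L
        w = 0}) \<le> int mult"
      unfolding sumN[symmetric] of_nat_sum by (rule sum_mono)
    then have "(\<Sum>z \<in> {z. norm z < R \<and> N a b z = 0}. card {w. w ^ n = \<omega> * z ^ n + a \<and> K z - b + L w =
        0}) \<le> mult"
      by (simp only: of_nat_le_iff)
    moreover have "card {(z, w) \<in> sols a b. norm z < R} =
        (\<Sum>z \<in> {z. norm z < R \<and> N a b z = 0}. card {w. w ^ n = \<omega> * z ^ n + a \<and> K z - b + L w = 0})"
      unfolding eq using Z finw by (subst card_SigmaI) auto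
    ultimately have "card {(z, w) \<in> sols a b. norm z < R} \<le> mult" by simp
    then show "finite {(z, w) \<in> sols a b. norm z < R} \<and> card {(z, w) \<in> sols a b. norm z < R} \<le> mult"
      using Z finw by (simp add: eq)
  qed
qed

end

section \<open>Multiplicity\<close>

lemma has_derivative_linear_form:
  fixes x y c :: complex
  assumes "(G has_field_derivative G') (at (x + c * y))"
  shows "((\<lambda>p. G (fst p + c * snd p)) has_derivative (\<lambda>h. G' * (fst h + c * snd h))) (at (x, y))"
proof -
  have "((\<lambda>p::complex \<times> complex. fst p + c * snd p) has_derivative (\<lambda>h. fst h + c * snd h)) (at (x,
      y))"
    by (auto intro!: derivative_eq_intros)
  moreover have "(G has_derivative (\<lambda>h. G' * h)) (at (fst (x, y) + c * snd (x, y)))"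
    using assms by (simp add: has_field_derivative_def)
  ultimately show ?thesis
    using diff_chain_at by (fastforce simp: o_def)
qed

text \<open>V' and L stand for the reflected functions w \<mapsto> cnj (V (cnj w)) and w \<mapsto>
  cnj (K (cnj w)), not for derivatives. At w = cnj z the two averages are Re V and Re K; letting z
  and w vary independently gives the holomorphic extension.\<close>

definition pair_extension ::
    "(complex \<Rightarrow> complex) \<Rightarrow> (complex \<Rightarrow> complex) \<Rightarrow> (complex \<Rightarrow> complex) \<Rightarrow> (complex \<Rightarrow> complex) \<Rightarrow>
     complex \<times> complex \<Rightarrow> complex \<times> complex" where
  "pair_extension V V' K L p =
     ((V (fst p + \<i> * snd p) + V' (fst p + - \<i> * snd p)) / 2,
      (K (fst p + \<i> * snd p) + L (fst p + - \<i> * snd p)) / 2)"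

lemma holomorphic2_pair_extension:
  assumes hol: "V holomorphic_on UNIV" "V' holomorphic_on UNIV" "K holomorphic_on UNIV" "L
      holomorphic_on UNIV"
  shows "holomorphic2_on (pair_extension V V' K L) UNIV"
  unfolding holomorphic2_on_def
proof
  fix p :: "complex \<times> complex"
  obtain x y where p: "p = (x, y)" by (cases p)
  have D: "(V has_field_derivative deriv V z) (at z)" "(V' has_field_derivative deriv V' z) (at z)"
    "(K has_field_derivative deriv K z) (at z)" "(L has_field_derivative deriv L z) (at z)" for z
    using hol by (auto intro: holomorphic_derivI)
  let ?z = "x + \<i> * y" and ?w = "x + - \<i> * y"
  have "((\<lambda>p. (V (fst p + \<i> * snd p) + V' (fst p + - \<i> * snd p)) / 2) has_derivative
     (\<lambda>h. (deriv V ?z * (fst h + \<i> * snd h) + deriv V' ?w * (fst h + - \<i> * snd h)) / 2)) (at (x,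
         y))"
    by (intro bounded_linear.has_derivative[OF bounded_linear_divide] has_derivative_add
        has_derivative_linear_form D)
  moreover have "((\<lambda>p. (K (fst p + \<i> * snd p) + L (fst p + - \<i> * snd p)) / 2) has_derivative
     (\<lambda>h. (deriv K ?z * (fst h + \<i> * snd h) + deriv L ?w * (fst h + - \<i> * snd h)) / 2)) (at (x, y))"
    by (intro bounded_linear.has_derivative[OF bounded_linear_divide] has_derivative_add
        has_derivative_linear_form D)
  ultimately have "(pair_extension V V' K L has_derivative
     (\<lambda>h. ((deriv V ?z * (fst h + \<i> * snd h) + deriv V' ?w * (fst h + - \<i> * snd h)) / 2,
     (deriv K ?z * (fst h + \<i> * snd h) + deriv L ?w * (fst h + - \<i> * snd h)) / 2))) (at (x, y))"
    unfolding pair_extension_def[abs_def] by (rule has_derivative_Pair)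
  also have "(\<lambda>h. ((deriv V ?z * (fst h + \<i> * snd h) + deriv V' ?w * (fst h + - \<i> * snd h)) / 2,
     (deriv K ?z * (fst h + \<i> * snd h) + deriv L ?w * (fst h + - \<i> * snd h)) / 2)) =
     (\<lambda>(h, k). ((deriv V ?z + deriv V' ?w) / 2 * h + \<i> * (deriv V ?z - deriv V' ?w) / 2 * k,
        (deriv K ?z + deriv L ?w) / 2 * h + \<i> * (deriv K ?z - deriv L ?w) / 2 * k))"
    by (auto simp: fun_eq_iff field_simps)
  finally show "\<exists>A B C D. (pair_extension V V' K L has_derivative (\<lambda>(h, k). (A * h + B * k, C * h +
      D * k))) (at p)"
    unfolding p by blast
qed

lemma pair_extension_complexify:
  assumes "\<And>w. V' w = cnj (V (cnj w))" "\<And>w. L w = cnj (K (cnj w))"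
  shows "pair_extension V V' K L (complexify z) = complexify (re_pair V K z)"
proof -
  have z: "complex_of_real (Re z) + \<i> * complex_of_real (Im z) = z" "complex_of_real (Re z) + - \<i> *
      complex_of_real (Im z) = cnj z"
    by (auto simp: complex_eq_iff)
  have "(a + cnj a) / 2 = complex_of_real (Re a)" for a by (simp add: complex_add_cnj)
  from this[of "V z"] this[of "K z"] show ?thesis
    unfolding pair_extension_def complexify_def fst_conv snd_conv z assms by simp
qed

section \<open>The complexified map and its multiplicity\<close>

context pencil
begin

abbreviation F :: "complex \<Rightarrow> complex \<times> complex \<Rightarrow> complex \<times> complex"
  where "F e \<equiv> pair_extension (\<lambda>z. e * z ^ n) (\<lambda>w. cnj e * w ^ n) K L"

lemma holomorphic2_F: "holomorphic2_on (F e) UNIV"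
  by (intro holomorphic2_pair_extension hol holomorphic_intros)

text \<open>The coordinates z = x + i y and w = x - i y in which the equations of
  \<open>pencil\<close> are stated.\<close>

definition \<phi> :: "complex \<times> complex \<Rightarrow> complex \<times> complex"
  where "\<phi> p = (fst p + \<i> * snd p, fst p + - \<i> * snd p)"

lemma inj_\<phi>: "inj_on \<phi> A"
proof -
  have "fst (\<phi> p) + snd (\<phi> p) = 2 * fst p" "fst (\<phi> p) - snd (\<phi> p) = 2 * \<i> * snd p" for p
    by (auto simp: \<phi>_def)
  then have "\<phi> p = \<phi> q \<Longrightarrow> p = q" for p q
    by (metis mult_cancel_left prod_eqI complex_i_not_zero mult_eq_0_iff zero_neq_numeral)
  then show ?thesis by (auto simp: inj_on_def)
qed

lemma norm_le_\<phi>: "norm (fst p) + norm (snd p) \<le> norm (fst (\<phi> p)) + norm (snd (\<phi> p))"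
proof -
  have "2 * fst p = fst (\<phi> p) + snd (\<phi> p)" "2 * \<i> * snd p = fst (\<phi> p) - snd (\<phi> p)"
    by (auto simp: \<phi>_def)
  then have "norm (2 * fst p) \<le> norm (fst (\<phi> p)) + norm (snd (\<phi> p))"
     "norm (2 * \<i> * snd p) \<le> norm (fst (\<phi> p)) + norm (snd (\<phi> p))"
    by (simp_all add: norm_triangle_ineq norm_triangle_ineq4)
  then show ?thesis by (simp add: norm_mult)
qed

text \<open>Solving e z^n + cnj e w^n = 2 a for w^n; this is where \<omega> = - e / cnj e comes
  from.\<close>

lemma F_eq_iff:
  assumes "e \<noteq> 0" "\<omega> = - e / cnj e"
  shows "F e p = (a, b) \<longleftrightarrow> \<phi> p \<in> sols (2 * a / cnj e) (2 * b)"
proof -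
  have "(e * z ^ n + cnj e * w ^ n) / 2 = a \<longleftrightarrow> w ^ n = \<omega> * z ^ n + 2 * a / cnj e" for z w
  proof -
    have "\<omega> * z ^ n + 2 * a / cnj e = (2 * a - e * z ^ n) / cnj e"
      unfolding assms(2) using assms(1) by (simp add: field_simps)
    then have "w ^ n = \<omega> * z ^ n + 2 * a / cnj e \<longleftrightarrow> w ^ n * cnj e = 2 * a - e * z ^ n"
      using mult_right_cancel[of "cnj e" "w ^ n" "\<omega> * z ^ n + 2 * a / cnj e"] assms(1) by simp
    then show ?thesis by (auto simp: algebra_simps)
  qed
  moreover have "(K z + L w) / 2 = b \<longleftrightarrow> K z + L w = 2 * b" for z w
    by (auto simp: field_simps)
  ultimately show ?thesis
    unfolding pair_extension_def \<phi>_def sols_def by simp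
qed

lemma continuous_\<phi>: "continuous_on A (\<lambda>p. fst (\<phi> p))" "continuous_on A (\<lambda>p. snd (\<phi> p))"
  by (auto simp: \<phi>_def intro!: continuous_intros)

lemma \<phi>_0 [simp]: "\<phi> 0 = (0, 0)" "\<phi> (0, 0) = (0, 0)"
  by (auto simp: \<phi>_def)

lemma K0_L0: "K 0 + L 0 = 0"
proof -
  obtain \<zeta> where "\<zeta> ^ n = \<omega>" using some_root[OF n] by blast
  then show ?thesis using fac[of \<zeta> 0] d1[of \<zeta>] by (simp add: power_0_left)
qed

lemma F_0: "F e 0 = (0, 0)"
  using n K0_L0 by (auto simp: pair_extension_def power_0_left)

lemma hol_multiplicity_le:
  assumes e: "e \<noteq> 0" "\<omega> = - e / cnj e"
  shows "hol_multiplicity (F e) UNIV 0 \<le> enat mult"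
proof -
  obtain R \<delta> where R: "0 < R" "0 < \<delta>" "\<And>z w. norm z \<le> R \<Longrightarrow> (z, w) \<in> sols 0 0 \<Longrightarrow> z = 0 \<and> w = 0"
    "\<And>a b. norm a < \<delta> \<Longrightarrow> norm b < \<delta> \<Longrightarrow>
       finite {(z, w) \<in> sols a b. norm z < R} \<and> card {(z, w) \<in> sols a b. norm z < R} \<le> mult"
    using few_solutions by blast
  \<comment> \<open>A polydisc in the coordinates z and w. The radius for w may be any number, here
    1, since \<open>few_solutions\<close> controls all w over |z| < R.\<close>
  define X where "X = {p. norm (fst (\<phi> p)) < R \<and> norm (snd (\<phi> p)) < 1}"
  define Y where "Y = {p. norm (fst (\<phi> p)) \<le> R \<and> norm (snd (\<phi> p)) \<le> 1}"
  have "open X"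
    unfolding X_def by (intro open_Collect_conj open_Collect_less continuous_intros continuous_\<phi>)
  have "closed Y"
    unfolding Y_def by (intro closed_Collect_conj closed_Collect_le continuous_intros continuous_\<phi>)
  then have cl: "closure X \<subseteq> Y"
    by (intro closure_minimal) (auto simp: X_def Y_def)
  have "bounded Y"
  proof (rule boundedI)
    fix p assume "p \<in> Y"
    then have "norm (fst p) + norm (snd p) \<le> R + 1"
      using norm_le_\<phi>[of p] by (auto simp: Y_def)
    then show "norm p \<le> R + 1"
      using norm_Pair_le[of "fst p" "snd p"] by simp
  qed
  then have "compact (closure X)"
    using cl bounded_subset compact_eq_bounded_closed closed_closure by blast
  moreover have "0 \<in> X" using R by (simp add: X_def)
  moreover have "p = 0" if "p \<in> closure X" "F e p = F e 0" for p
  proof -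
    have "\<phi> p \<in> sols 0 0" using that(2) F_eq_iff[OF e, of p 0 0] by (simp add: F_0)
    moreover have "norm (fst (\<phi> p)) \<le> R" using that(1) cl by (auto simp: Y_def)
    ultimately have "\<phi> p = \<phi> 0" using R(3)[of "fst (\<phi> p)" "snd (\<phi> p)"] by (simp add: prod_eq_iff)
    then show ?thesis using inj_\<phi>[of UNIV] by (rule injD[rotated])
  qed
  ultimately have iso: "isolating_nbhd (F e) UNIV 0 X"
    using \<open>open X\<close> closure_subset[of X] unfolding isolating_nbhd_def by blast
  have "isCont (F e) 0"
    using holomorphic2_F unfolding holomorphic2_on_def by (meson UNIV_I has_derivative_continuous)
  then have "(F e \<longlongrightarrow> (0, 0)) (at 0)" by (simp add: isCont_def F_0)
  then have "((\<lambda>p. 2 * fst (F e p) / cnj e) \<longlongrightarrow> 2 * fst (0::complex, 0::complex) / cnj e) (at 0)"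
    "((\<lambda>p. 2 * snd (F e p)) \<longlongrightarrow> 2 * snd (0::complex, 0::complex)) (at 0)"
    using e by (intro tendsto_intros; simp)+
  then have "eventually (\<lambda>p. norm (2 * fst (F e p) / cnj e) < \<delta>) (at 0)" "eventually (\<lambda>p. norm (2 *
      snd (F e p)) < \<delta>) (at 0)"
    using R(2) by (auto simp: tendsto_iff dist_norm)
  then have "eventually (\<lambda>w. ecard {x \<in> X. F e x = F e w} \<le> enat mult) (at 0)"
  proof eventually_elim
    case (elim w)
    let ?S = "{(z, w') \<in> sols (2 * fst (F e w) / cnj e) (2 * snd (F e w)). norm z < R}"
    have S: "finite ?S" "card ?S \<le> mult" using R(4)[OF elim] by auto
    have "\<phi> ` {x \<in> X. F e x = F e w} \<subseteq> ?S"
    proof (rule image_subsetI)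
      fix x assume "x \<in> {x \<in> X. F e x = F e w}"
      then have "\<phi> x \<in> sols (2 * fst (F e w) / cnj e) (2 * snd (F e w))" "norm (fst (\<phi> x)) < R"
        using F_eq_iff[OF e, of x "fst (F e w)" "snd (F e w)"] by (auto simp: X_def)
      then show "\<phi> x \<in> ?S" by (simp add: case_prod_unfold)
    qed
    then have "finite {x \<in> X. F e x = F e w}" "card {x \<in> X. F e x = F e w} \<le> mult"
      using S inj_\<phi> by (meson finite_imageD finite_subset, meson card_inj_on_le le_trans)
    then show ?case by (simp add: ecard_def)
  qed
  then have "Limsup (at 0) (\<lambda>w. ecard {x \<in> X. F e x = F e w}) \<le> enat mult"
    by (rule Limsup_bounded)
  then show ?thesis
    unfolding hol_multiplicity_def using iso by (intro INF_lower2[of X]) auto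
qed

text \<open>A value (0, b / 2) with small b \<noteq> 0 has \<open>mult\<close> preimages close to 0.
  One of these preimages serves as the point w tending to 0, so the bound holds frequently, which is
  enough for an upper limit.\<close>

lemma hol_multiplicity_ge:
  assumes e: "e \<noteq> 0" "\<omega> = - e / cnj e"
  shows "enat mult \<le> hol_multiplicity (F e) UNIV 0"
  unfolding hol_multiplicity_def
proof (rule INF_greatest)
  fix X assume "X \<in> {X. isolating_nbhd (F e) UNIV 0 X}"
  then have "open X" "0 \<in> X" by (auto simp: isolating_nbhd_def)
  have "frequently (\<lambda>w. enat mult \<le> ecard {x \<in> X. F e x = F e w}) (at 0)"
    unfolding frequently_def eventually_at
  proof safe
    fix \<epsilon> :: real assume \<epsilon>: "0 < \<epsilon>"
      "\<forall>w\<in>UNIV. w \<noteq> 0 \<and> dist w 0 < \<epsilon> \<longrightarrow> \<not> enat mult \<le> ecard {x \<in> X. F e x = F e w}"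
    obtain r where r: "0 < r" "ball 0 r \<subseteq> X" using \<open>open X\<close> \<open>0 \<in> X\<close> by (meson openE)
    define t where "t = min r \<epsilon> / 2"
    have "0 < t" using r \<epsilon> by (simp add: t_def)
    then obtain \<delta> where \<delta>: "0 < \<delta>" "\<And>b. 0 < norm b \<Longrightarrow> norm b < \<delta> \<Longrightarrow>
       \<exists>A\<subseteq>sols 0 b. finite A \<and> card A = mult \<and> (\<forall>(z, w)\<in>A. norm z < t \<and> norm w < t)"
      using many_solutions by blast
    define b :: complex where "b = of_real (\<delta> / 2)"
    have b: "0 < norm b" "norm b < \<delta>" using \<delta>(1) by (auto simp: b_def)
    obtain A where A: "A \<subseteq> sols 0 b" "finite A" "card A = mult" "\<And>z w. (z, w) \<in> A \<Longrightarrow> norm z < t \<and>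
        norm w < t"
      using \<delta>(2)[OF b] by blast
    define g where "g = (\<lambda>(z, w). ((z + w) / 2, (z - w) / (2 * \<i>)))"
    have \<phi>g: "\<phi> (g q) = q" for q
      by (cases q) (auto simp: \<phi>_def g_def field_simps)
    define B where "B = g ` A"
    have "inj_on g A" using \<phi>g by (metis inj_onI)
    then have B: "finite B" "card B = mult" using A by (auto simp: B_def card_image)
    have FB: "F e x = (0, b / 2)" if "x \<in> B" for x
    proof -
      have "\<phi> x \<in> sols 0 b" using that A \<phi>g by (auto simp: B_def)
      then show ?thesis using F_eq_iff[OF e, of x 0 "b / 2"] by simp
    qed
    have nB: "norm x < min r \<epsilon>" if xB: "x \<in> B" for x
    proof -
      obtain q where q: "q \<in> A" "x = g q" using xB unfolding B_def by blast
      have "norm (fst q) < t \<and> norm (snd q) < t" using A(4)[of "fst q" "snd q"] q by simp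
      moreover have "norm x \<le> norm (fst x) + norm (snd x)" using norm_Pair_le[of "fst x" "snd x"] by
          simp
      ultimately show ?thesis using norm_le_\<phi>[of x] q \<phi>g[of q] by (simp add: t_def)
    qed
    have "0 < mult"
    proof -
      obtain \<zeta> where "\<zeta> ^ n = \<omega>" using some_root[OF n] by blast
      then show ?thesis
        unfolding mult_def using d1[of \<zeta>] finite_roots by (intro sum_pos2[of _ \<zeta>]) auto
    qed
    then obtain w where w: "w \<in> B" using B by (metis all_not_in_conv card.empty less_irrefl)
    have "w \<noteq> 0" using FB[OF w] b F_0[of e] by auto
    moreover have "dist w 0 < \<epsilon>" using nB[OF w] by simp
    ultimately have "\<not> enat mult \<le> ecard {x \<in> X. F e x = F e w}" using \<epsilon> by blast
    moreover have "B \<subseteq> {x \<in> X. F e x = F e w}"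
    proof
      fix x assume x: "x \<in> B"
      have "x \<in> ball 0 r" using nB[OF x] by simp
      then show "x \<in> {x \<in> X. F e x = F e w}" using r(2) FB[OF x] FB[OF w] by auto
    qed
    then have "enat mult \<le> ecard {x \<in> X. F e x = F e w}"
      using card_mono[of "{x \<in> X. F e x = F e w}" B] B(2) by (auto simp: ecard_def)
    ultimately show False by blast
  qed
  then have "\<not> eventually (\<lambda>w. ecard {x \<in> X. F e x = F e w} < enat mult) (at 0)"
    by (simp add: frequently_def not_le)
  then show "enat mult \<le> Limsup (at 0) (\<lambda>w. ecard {x \<in> X. F e x = F e w})"
    using Limsup_le_iff[of "at 0" "\<lambda>w. ecard {x \<in> X. F e x = F e w}" "Limsup (at 0) (\<lambda>w. ecard {x \<in>
        X. F e x = F e w})"]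
    by (meson not_le order_refl)
qed

lemma has_multiplicity_re_pair:
  assumes e: "e \<noteq> 0" "\<omega> = - e / cnj e" and L: "\<And>w. L w = cnj (K (cnj w))"
  shows "has_multiplicity (re_pair (\<lambda>z. e * z ^ n) K) 0 (enat mult)"
proof -
  have "hol_multiplicity (F e) UNIV (complexify 0) = enat mult"
    using hol_multiplicity_le[OF e] hol_multiplicity_ge[OF e] by (simp add: complexify_def
        zero_prod_def)
  moreover have "F e (complexify z) = complexify (re_pair (\<lambda>z. e * z ^ n) K z)" for z
    by (rule pair_extension_complexify) (simp_all add: L)
  ultimately show ?thesis
    unfolding has_multiplicity_def using holomorphic2_F
    by (intro exI[of _ UNIV] exI[of _ "F e"]) simp
qed

end

section \<open>Multiplicities of the polynomial examples\<close>

lemma unit_root_relation: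
  assumes "e \<noteq> 0" "\<zeta> ^ n = - e / cnj e"
  shows "cnj e * \<zeta> ^ n = - e"
  using assms by simp

text \<open>\<omega> = 1 puts \<zeta> = 1 among the slopes, and the line w = z is the complexified
  real axis.\<close>

lemma ratio_one_iff: "e \<noteq> 0 \<Longrightarrow> - e / cnj e = 1 \<longleftrightarrow> Re e = 0"
  by (subst divide_eq_1_iff) (auto simp: complex_eq_iff)

lemma sum_roots_split:
  fixes \<omega> :: complex
  assumes "1 \<le> n" "\<omega> \<noteq> 0"
  shows "(\<Sum>\<zeta> | \<zeta> ^ n = \<omega>. if \<zeta> = 1 then a else b) = (if \<omega> = 1 then (n - 1) * b + a else n *
      (b::nat))"
proof -
  have fin: "finite {\<zeta>. \<zeta> ^ n = \<omega>}" and card: "card {\<zeta>. \<zeta> ^ n = \<omega>} = n"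
    using assms by (auto simp: card_nth_roots intro: finite_nth_roots)
  show ?thesis
  proof (cases "\<omega> = 1")
    case True
    then have "1 \<in> {\<zeta>. \<zeta> ^ n = \<omega>}" by simp
    then show ?thesis
      using fin card True by (subst sum.remove[of _ 1]) (auto simp: card_Diff_singleton)
  next
    case False
    then have "(\<Sum>\<zeta> | \<zeta> ^ n = \<omega>. if \<zeta> = 1 then a else b) = (\<Sum>\<zeta> | \<zeta> ^ n = \<omega>. b)"
      by (intro sum.cong) auto
    then show ?thesis using False card by simp
  qed
qed

text \<open>On w = \<zeta> z the second equation has the leading term e \<alpha> (1 - \<zeta>) z^(n
  + 1). It cancels exactly for \<zeta> = 1, where 2 i \<beta> e z^(n + k) remains; so that line has
  contact n + k and the others n + 1.\<close>

lemma has_multiplicity_poly_pair_Suc: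
  assumes n: "1 \<le> n" "2 \<le> k" and e: "e \<noteq> 0" and \<alpha>: "\<alpha> \<noteq> 0" and \<beta>: "Re e = 0 \<Longrightarrow> \<beta> \<noteq> 0"
  shows "has_multiplicity (poly_pair e n \<alpha> (n + 1) \<beta> (n + k)) 0
           (enat (if Re e = 0 then (n - 1) * (n + 1) + (n + k) else n * (n + 1)))"
proof -
  let ?K = "\<lambda>z. e * (of_real \<alpha> * z ^ (n + 1) + \<i> * of_real \<beta> * z ^ (n + k))"
  let ?L = "\<lambda>w. cnj e * (of_real \<alpha> * w ^ (n + 1) - \<i> * of_real \<beta> * w ^ (n + k))"
  let ?d = "\<lambda>\<zeta>::complex. if \<zeta> = 1 then n + k else n + 1"
  let ?u = "\<lambda>\<zeta> z. if \<zeta> = 1 then 2 * \<i> * of_real \<beta> * e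
     else e * (of_real \<alpha> * (1 - \<zeta>) + \<i> * of_real \<beta> * (1 + \<zeta> ^ k) * z ^ (k - 1))"
  interpret pencil n "- e / cnj e" ?K ?L ?d ?u
  proof
    fix \<zeta> z :: complex assume \<zeta>: "\<zeta> ^ n = - e / cnj e"
    have c: "cnj e * \<zeta> ^ n = - e" using unit_root_relation[OF e \<zeta>] .
    have "?L (\<zeta> * z) = cnj e * \<zeta> ^ n * (of_real \<alpha> * \<zeta> * z ^ (n + 1) - \<i> * of_real \<beta> * \<zeta> ^ k * z ^ (n
        + k))"
      by (simp add: power_mult_distrib power_add algebra_simps)
    then have H: "?K z + ?L (\<zeta> * z) = e * (of_real \<alpha> * (1 - \<zeta>) * z ^ (n + 1) + \<i> * of_real \<beta> * (1 +
        \<zeta> ^ k) * z ^ (n + k))"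
      unfolding c by (simp add: algebra_simps)
    have "z ^ (n + k) = z ^ (n + 1) * z ^ (k - 1)"
      unfolding power_add[symmetric] using n by (intro arg_cong[of _ _ "(^) z"]) simp
    then show "?K z + ?L (\<zeta> * z) = z ^ ?d \<zeta> * ?u \<zeta> z"
      unfolding H by (cases "\<zeta> = 1") (simp_all add: algebra_simps)
    show "?u \<zeta> holomorphic_on UNIV" by (cases "\<zeta> = 1") (auto intro!: holomorphic_intros)
    show "?u \<zeta> 0 \<noteq> 0"
    proof (cases "\<zeta> = 1")
      case True
      then have "Re e = 0" using \<zeta> ratio_one_iff[OF e] by simp
      then show ?thesis using \<beta> e True by simp
    next
      case False
      then show ?thesis using \<alpha> e n by (simp add: power_0_left)
    qed
    show "1 \<le> ?d \<zeta>" using n by simp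
  qed (use n e in \<open>auto intro!: holomorphic_intros\<close>)
  have "has_multiplicity (re_pair (\<lambda>z. e * z ^ n) ?K) 0 (enat mult)"
    by (rule has_multiplicity_re_pair[OF e refl]) simp
  moreover have "mult = (if Re e = 0 then (n - 1) * (n + 1) + (n + k) else n * (n + 1))"
    unfolding mult_def using sum_roots_split[of n "- e / cnj e" "n + k" "n + 1"] n e
        ratio_one_iff[OF e] by simp
  ultimately show ?thesis by (simp only: poly_pair_def)
qed

text \<open>The leading term is now e \<alpha> (1 - 1 / \<zeta>) z^(n - 1), and the line w = z
  raises the contact to n.\<close>

lemma has_multiplicity_poly_pair_pred:
  assumes n: "2 \<le> n" and e: "e \<noteq> 0" and \<alpha>: "\<alpha> \<noteq> 0" and \<beta>: "Re e = 0 \<Longrightarrow> \<beta> \<noteq> 0"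
  shows "has_multiplicity (poly_pair e n \<alpha> (n - 1) \<beta> n) 0
           (enat (if Re e = 0 then (n - 1) * (n - 1) + n else n * (n - 1)))"
proof -
  let ?K = "\<lambda>z. e * (of_real \<alpha> * z ^ (n - 1) + \<i> * of_real \<beta> * z ^ n)"
  let ?L = "\<lambda>w. cnj e * (of_real \<alpha> * w ^ (n - 1) - \<i> * of_real \<beta> * w ^ n)"
  let ?d = "\<lambda>\<zeta>::complex. if \<zeta> = 1 then n else n - 1"
  let ?u = "\<lambda>\<zeta> z. if \<zeta> = 1 then 2 * \<i> * of_real \<beta> * e
     else e * (of_real \<alpha> * (1 - 1 / \<zeta>) + 2 * \<i> * of_real \<beta> * z)"
  interpret pencil n "- e / cnj e" ?K ?L ?d ?u
  proof
    fix \<zeta> z :: complex assume \<zeta>: "\<zeta> ^ n = - e / cnj e"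
    have c: "cnj e * \<zeta> ^ n = - e" using unit_root_relation[OF e \<zeta>] .
    have nz: "\<zeta> \<noteq> 0" using \<zeta> e n by (auto simp: power_0_left)
    have zn: "x ^ n = x ^ (n - 1) * x" for x :: complex
      using n by (cases n) auto
    have "?L (\<zeta> * z) = cnj e * \<zeta> ^ n * (of_real \<alpha> * (1 / \<zeta>) * z ^ (n - 1) - \<i> * of_real \<beta> * z ^ n)"
      using nz by (simp add: power_mult_distrib algebra_simps zn[of \<zeta>])
    then have H: "?K z + ?L (\<zeta> * z) = e * (of_real \<alpha> * (1 - 1 / \<zeta>) * z ^ (n - 1) + 2 * \<i> * of_real \<beta>
        * z ^ n)"
      unfolding c by (simp add: algebra_simps)
    then show "?K z + ?L (\<zeta> * z) = z ^ ?d \<zeta> * ?u \<zeta> z"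
      unfolding H by (cases "\<zeta> = 1") (simp_all add: algebra_simps zn[of z])
    show "?u \<zeta> holomorphic_on UNIV" by (cases "\<zeta> = 1") (auto intro!: holomorphic_intros)
    show "?u \<zeta> 0 \<noteq> 0"
    proof (cases "\<zeta> = 1")
      case True
      then have "Re e = 0" using \<zeta> ratio_one_iff[OF e] by simp
      then show ?thesis using \<beta> e True by simp
    next
      case False
      then show ?thesis using \<alpha> e nz by simp
    qed
    show "1 \<le> ?d \<zeta>" using n by (cases "\<zeta> = 1") simp_all
  qed (use n e in \<open>auto intro!: holomorphic_intros\<close>)
  have "has_multiplicity (re_pair (\<lambda>z. e * z ^ n) ?K) 0 (enat mult)"
    by (rule has_multiplicity_re_pair[OF e refl]) simp
  moreover have "mult = (if Re e = 0 then (n - 1) * (n - 1) + n else n * (n - 1))"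
    unfolding mult_def using sum_roots_split[of n "- e / cnj e" n "n - 1"] n e ratio_one_iff[OF e]
        by simp
  ultimately show ?thesis by (simp only: poly_pair_def)
qed

text \<open>The fibre through 0 contains the real axis, so no neighbourhood is isolating and the
  infimum over the empty family is \<infinity>.\<close>

lemma has_multiplicity_infinity:
  assumes hol: "V holomorphic_on UNIV" "V' holomorphic_on UNIV" "K holomorphic_on UNIV" "L
      holomorphic_on UNIV"
    and cnj: "\<And>w. V' w = cnj (V (cnj w))" "\<And>w. L w = cnj (K (cnj w))"
    and line: "\<And>t::real. re_pair V K (of_real t) = re_pair V K 0"
  shows "has_multiplicity (re_pair V K) 0 \<infinity>"
proof -
  let ?G = "pair_extension V V' K L"
  note G = pair_extension_complexify[of V' V L K, OF cnj]
  have "\<not> isolating_nbhd ?G UNIV (complexify 0) X" for X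
  proof
    assume X: "isolating_nbhd ?G UNIV (complexify 0) X"
    have "continuous_on UNIV complexify"
      unfolding complexify_def by (intro continuous_intros)
    then have "open (complexify -` X)"
      using X by (simp add: isolating_nbhd_def open_vimage)
    moreover have "0 \<in> complexify -` X" using X by (simp add: isolating_nbhd_def)
    ultimately obtain r where r: "0 < r" "ball 0 r \<subseteq> complexify -` X" by (meson openE)
    let ?z = "of_real (r / 2) :: complex"
    have "?z \<in> ball 0 r" using r(1) by simp
    then have "complexify ?z \<in> X" using r(2) by blast
    moreover have "?G (complexify ?z) = ?G (complexify 0)"
      by (simp only: G line)
    ultimately have "complexify ?z = complexify 0"
      using X closure_subset[of X] unfolding isolating_nbhd_def by blast
    then show False using r(1) by (simp add: complexify_def)
  qed
  then have "hol_multiplicity ?G UNIV (complexify 0) = \<infinity>"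
    by (simp add: hol_multiplicity_def top_enat_def)
  then show ?thesis
    unfolding has_multiplicity_def using holomorphic2_pair_extension[OF hol] G
    by (intro exI[of _ UNIV] exI[of _ ?G]) simp
qed

lemma has_multiplicity_poly_pair_infinity:
  assumes "Re e = 0" "1 \<le> n" "1 \<le> p" "1 \<le> q"
  shows "has_multiplicity (poly_pair e n \<alpha> p 0 q) 0 \<infinity>"
  unfolding poly_pair_def
proof (rule has_multiplicity_infinity[where V' = "\<lambda>w. cnj e * w ^ n" and L = "\<lambda>w. cnj e * (of_real \<alpha>
    * w ^ p)"])
  show "re_pair (\<lambda>z. e * z ^ n) (\<lambda>z. e * (of_real \<alpha> * z ^ p + \<i> * of_real 0 * z ^ q)) (of_real t) =
      re_pair (\<lambda>z. e * z ^ n) (\<lambda>z. e * (of_real \<alpha> * z ^ p + \<i> * of_real 0 * z ^ q)) 0" for t :: real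
    using assms by (simp add: re_pair_def power_0_left flip: of_real_power of_real_mult)
qed (auto intro!: holomorphic_intros)

section \<open>Order-pairs\<close>

text \<open>This is -\<kappa>: the critical set is where it is real, and near 0 it is a coordinate
  that straightens the critical curve to the real line.\<close>

definition twist :: "real \<Rightarrow> nat \<Rightarrow> complex \<Rightarrow> complex"
  where "twist d k z = z + \<i> * of_real d * z ^ k"

text \<open>The coefficients come from integrating -(z + i d z^k) times the derivative of e
  z^n.\<close>

definition pair_Suc :: "complex \<Rightarrow> nat \<Rightarrow> real \<Rightarrow> nat \<Rightarrow> complex \<Rightarrow> complex" where
  "pair_Suc e n d k =
     poly_pair e n (- real n / real (n + 1)) (n + 1) (- d * real n / real (n + k)) (n + k)"

definition second_Suc :: "complex \<Rightarrow> nat \<Rightarrow> real \<Rightarrow> nat \<Rightarrow> complex \<Rightarrow> complex" where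
  "second_Suc e n d k z = e * (of_real (- real n / real (n + 1)) * z ^ (n + 1) +
     \<i> * of_real (- d * real n / real (n + k)) * z ^ (n + k))"

lemma pair_Suc_eq: "pair_Suc e n d k = re_pair (\<lambda>z. e * z ^ n) (second_Suc e n d k)"
  by (simp add: pair_Suc_def poly_pair_def second_Suc_def[abs_def])

lemma DERIV_monom: "((\<lambda>z. a * z ^ n) has_field_derivative a * (of_nat n * z ^ (n - 1))) (at z)" for
    a z :: complex
  by (auto intro!: derivative_eq_intros)

lemma DERIV_second_Suc:
  assumes "1 \<le> n"
  shows "(second_Suc e n d k has_field_derivative - twist d k z * (e * (of_nat n * z ^ (n - 1))))
      (at z)"
proof -
  have c: "1 + of_nat n \<noteq> (0::complex)" by (metis of_nat_Suc of_nat_neq_0)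
  have c': "of_nat n + of_nat k \<noteq> (0::complex)"
    using assms by (metis of_nat_add of_nat_eq_0_iff add_is_0 not_one_le_zero)
  have "n + k - 1 = k + (n - 1)" using assms by simp
  then have z: "z ^ (n + k - 1) = z ^ k * z ^ (n - 1)" "z ^ n = z * z ^ (n - 1)"
    using assms by (simp_all add: power_add[symmetric] power_Suc[symmetric] add.commute)
  have "(second_Suc e n d k has_field_derivative
     e * (of_real (- real n / real (n + 1)) * (of_nat (n + 1) * z ^ (n + 1 - 1)) +
     \<i> * of_real (- d * real n / real (n + k)) * (of_nat (n + k) * z ^ (n + k - 1)))) (at z)"
    unfolding second_Suc_def[abs_def] by (intro DERIV_cmult DERIV_add DERIV_monom)
  also have "of_real (- real n / real (n + 1)) * (of_nat (n + 1) * z ^ (n + 1 - 1)) = - of_nat n * z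
      ^ n"
    using c by (simp add: field_simps)
  also have "\<i> * of_real (- d * real n / real (n + k)) * (of_nat (n + k) * z ^ (n + k - 1)) =
      - \<i> * of_real d * of_nat n * z ^ (n + k - 1)"
    using c' by (simp add: field_simps)
  also have "e * (- of_nat n * z ^ n + - \<i> * of_real d * of_nat n * z ^ (n + k - 1)) =
      - twist d k z * (e * (of_nat n * z ^ (n - 1)))"
    unfolding z by (simp add: twist_def algebra_simps)
  finally show ?thesis .
qed

lemma holomorphic_second_Suc [holomorphic_intros]: "second_Suc e n d k holomorphic_on A"
  unfolding second_Suc_def[abs_def] by (intro holomorphic_intros)

lemma holomorphic_twist [holomorphic_intros]: "twist d k holomorphic_on A"
  unfolding twist_def[abs_def] by (intro holomorphic_intros)

lemma harmonic_map_pair_Suc: "harmonic_map UNIV (pair_Suc e n d k)"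
  unfolding pair_Suc_eq by (intro harmonic_map_re_pair holomorphic_intros)

lemma DERIV_twist: "(twist d k has_field_derivative 1 + \<i> * of_real d * (of_nat k * z ^ (k - 1)))
    (at z)"
  unfolding twist_def[abs_def] by (intro DERIV_cmult DERIV_add DERIV_ident DERIV_monom)

lemma twist_0 [simp]: "1 \<le> k \<Longrightarrow> twist d k 0 = 0"
  by (simp add: twist_def)

lemma smooth_critical_point_pair_Suc:
  assumes "e \<noteq> 0" "1 \<le> n" "2 \<le> k"
  shows "smooth_critical_point UNIV (pair_Suc e n d k) 0"
proof -
  have J: "jacobian (pair_Suc e n d k) z = (norm (e * (of_nat n * z ^ (n - 1))))\<^sup>2 * Im (twist d k
      z)" for z
  proof -
    define a where "a = e * (of_nat n * z ^ (n - 1))"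
    have "jacobian (pair_Suc e n d k) z = Im (a * cnj (- twist d k z * a))"
      unfolding pair_Suc_eq a_def using assms by (intro jacobian_re_pair DERIV_monom
          DERIV_second_Suc)
    also have "a * cnj (- twist d k z * a) = of_real ((norm a)\<^sup>2) * (- cnj (twist d k z))"
      using complex_norm_square[of a] by simp
    finally show ?thesis by (simp add: a_def)
  qed
  \<comment> \<open>The derivative of e z^n can vanish only at 0, where the twist is 0 as well, so
    the factor in front adds no critical point.\<close>
  have Z: "critical_set UNIV (pair_Suc e n d k) = {z. Im (twist d k z) = 0}"
    using assms by (auto simp: critical_set_def J twist_def)
  define S where "S = {z. deriv (twist d k) z \<noteq> 0}"
  have "deriv (twist d k) 0 = 1"
    using DERIV_imp_deriv[OF DERIV_twist, of d k 0] assms by (simp add: power_0_left)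
  then have "0 \<in> S" by (simp add: S_def)
  have "continuous_on UNIV (deriv (twist d k))"
    by (intro holomorphic_on_imp_continuous_on holomorphic_intros) auto
  then have "open S" unfolding S_def by (intro open_Collect_neq continuous_intros)
  then show ?thesis
    using \<open>0 \<in> S\<close> assms
    by (intro smooth_critical_point_re_pair[of S _ "twist d k"] holomorphic_intros) (auto simp: Z
        S_def)
qed

lemma pair_Suc_has_order:
  assumes "e \<noteq> 0" "1 \<le> n" "2 \<le> k"
  shows "has_order (pair_Suc e n d k) 0 n"
  unfolding pair_Suc_def using assms by (intro has_order_poly_pair) auto

section \<open>Leading orders and coordinates along the critical curve\<close>

lemma has_taylor1_holomorphic:
  assumes h: "h holomorphic_on ball 0 r" "0 < r"
    and u: "\<forall>\<^sub>F t in nhds 0. u t = t ^ j * Re (h (of_real t))"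
  shows "has_taylor1 u (\<lambda>n. if n < j then 0 else Re ((deriv ^^ (n - j)) h 0 / fact (n - j)))"
proof -
  define c where "c n = (deriv ^^ n) h 0 / fact n" for n
  define b where "b n = (if n < j then 0 else Re (c (n - j)))" for n
  have "\<forall>\<^sub>F t in nhds 0. t \<in> ball (0::real) r" using h(2) by (intro eventually_nhds_in_open) auto
  with u have "has_taylor1 u b"
    unfolding has_taylor1_def
  proof eventually_elim
    case (elim t)
    have "(\<lambda>n. c n * (of_real t - 0) ^ n) sums h (of_real t)"
      unfolding c_def by (rule holomorphic_power_series[OF h(1)]) (use elim in auto)
    from sums_Re[OF this] have "(\<lambda>n. Re (c n) * t ^ n) sums Re (h (of_real t))"
      by (simp flip: of_real_power)
    from sums_mult[OF this, of "t ^ j"] have "(\<lambda>n. b (n + j) * t ^ (n + j)) sums u t"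
      by (simp add: b_def elim power_add mult_ac)
    then show ?case
      by (subst (asm) sums_zero_iff_shift) (auto simp: b_def)
  qed
  then show ?thesis unfolding b_def[abs_def] c_def .
qed

text \<open>The factor t^j shifts the power series of Re h by j places, so its first coefficient is
  Re (h 0).\<close>

lemma leading_order_holomorphic:
  assumes "h holomorphic_on ball 0 r" "0 < r" "Re (h 0) \<noteq> 0"
    and "\<forall>\<^sub>F t in nhds 0. u t = t ^ j * Re (h (of_real t))"
  shows "leading_order u (enat j)"
  unfolding leading_order_def
  using has_taylor1_holomorphic[OF assms(1,2,4)] assms(3)
  by (intro exI[of _ "\<lambda>n. if n < j then 0 else Re ((deriv ^^ (n - j)) h 0 / fact (n - j))"]) auto

lemma leading_order_zero: "\<forall>\<^sub>F t in nhds 0. u t = 0 \<Longrightarrow> leading_order u \<infinity>"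
  unfolding leading_order_def has_taylor1_def by (intro exI[of _ "\<lambda>_. 0"]) (auto elim:
      eventually_mono)

text \<open>Makes the substitution in the next lemmas an admissible reparametrization: Arctan is
  holomorphic in the unit disc, and the derivative at 0 is -2.\<close>

lemma has_taylor1_arctan: "\<exists>b. has_taylor1 (\<lambda>s. - 2 * arctan s) b \<and> b 1 \<noteq> 0"
proof -
  let ?h = "\<lambda>z. - 2 * Arctan z"
  have im: "\<bar>Im z\<bar> < 1" if "z \<in> ball 0 1" for z
    using that abs_Im_le_cmod[of z] by auto
  have "?h holomorphic_on ball 0 1"
    by (intro holomorphic_intros holomorphic_on_Arctan) (use im in auto)
  then have "has_taylor1 (\<lambda>s. - 2 * arctan s) (\<lambda>n. if n < 0 then 0 else Re ((deriv ^^ (n - 0)) ?h 0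
      / fact (n - 0)))"
    by (rule has_taylor1_holomorphic) (auto simp: Arctan_of_real)
  moreover have "(?h has_field_derivative - 2) (at 0)"
    by (auto intro!: derivative_eq_intros has_field_derivative_Arctan)
  then have "deriv ?h 0 = - 2" by (rule DERIV_imp_deriv)
  ultimately show ?thesis by (intro exI) auto
qed

text \<open>With \<open>twist d k (\<gamma> t) = - tan (t / 2)\<close> the substitution \<open>t = - 2 * arctan s\<close> makes \<open>s\<close> the
  value of \<open>twist d k\<close> on the critical curve.\<close>

lemma has_order_pairI:
  assumes "1 \<le> j" "j < k \<or> j = \<infinity> \<and> k = \<infinity>" "\<beta> 0 = 0"
    and "leading_order (\<lambda>s. Re (\<beta> (- 2 * arctan s))) j" "leading_order (\<lambda>s. Im (\<beta> (- 2 * arctan s)))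
        k"
  shows "has_order_pair \<beta> j k"
proof -
  obtain b where b: "has_taylor1 (\<lambda>s. - 2 * arctan s) b" "b 1 \<noteq> 0" using has_taylor1_arctan by blast
  have id: "(\<lambda>z. z) = re_pair (\<lambda>z. z) (\<lambda>z. - \<i> * z)"
    by (auto simp: fun_eq_iff complex_eq_iff)
  have "jacobian (\<lambda>z. z) 0 = Im (1 * cnj (- \<i> * 1))"
    by (subst id, rule jacobian_re_pair) (auto intro!: derivative_eq_intros)
  then have J: "jacobian (\<lambda>z. z) 0 \<noteq> 0" by simp
  have "(\<lambda>z. 1 * of_real (Re (1 * z ^ 1)) + \<i> * of_real (Re (- \<i> * z ^ 1))) = (\<lambda>z. z)"
    by (auto simp: fun_eq_iff complex_eq_iff)
  from has_taylor2_add[OF has_taylor2_Re_monom[of 1 1 1] has_taylor2_Re_monom[of \<i> "- \<i>" 1],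
      unfolded this]
  have T: "has_taylor2 (\<lambda>z. z) 0 (\<lambda>i j. monom_coeff 1 1 1 i j + monom_coeff \<i> (- \<i>) 1 i j)" .
  show ?thesis
    unfolding has_order_pair_def assms(3)
    using assms b J T by (intro conjI exI[of _ "\<lambda>s. - 2 * arctan s"] exI[of _ b] exI[of _ "\<lambda>z. z"]
          exI[of _ "\<lambda>i j. monom_coeff 1 1 1 i j + monom_coeff \<i> (- \<i>) 1 i j"]) simp_all
qed

text \<open>The two conditions in S serve later divisions: |twist| < 1 keeps 1 + i twist away from 0
  in the quotient p' / q', and the other makes the quotient of g by the identity
  holomorphic.\<close>

lemma twist_inverse:
  assumes k: "2 \<le> k"
  obtains r s g where "0 < r" "inj_on (twist d k) (ball 0 r)" "\<And>z. z \<in> ball 0 r \<Longrightarrow> norm (twist d k z)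
      < 1"
    "0 < s" "g holomorphic_on ball 0 s" "\<And>w. w \<in> ball 0 s \<Longrightarrow> g w \<in> ball 0 r"
    "\<And>w. w \<in> ball 0 s \<Longrightarrow> twist d k (g w) = w" "g 0 = 0"
    "\<And>w. w \<in> ball 0 s \<Longrightarrow> 1 + \<i> * of_real d * g w ^ (k - 1) \<noteq> 0"
proof -
  define S where "S = {z. norm (twist d k z) < 1 \<and> 1 + \<i> * of_real d * z ^ (k - 1) \<noteq> 0}"
  have "continuous_on UNIV (twist d k)"
    by (intro holomorphic_on_imp_continuous_on holomorphic_intros)
  then have "open S"
    unfolding S_def by (intro open_Collect_conj open_Collect_less open_Collect_neq
        continuous_intros)
  moreover have "0 \<in> S" using k by (auto simp: S_def power_0_left)
  moreover have "deriv (twist d k) 0 \<noteq> 0"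
    using DERIV_imp_deriv[OF DERIV_twist, of d k 0] k by (simp add: power_0_left)
  ultimately obtain r where r: "0 < r" "ball 0 r \<subseteq> S" "open (twist d k ` ball 0 r)" "inj_on (twist d
      k) (ball 0 r)"
    using has_complex_derivative_locally_invertible[OF holomorphic_twist] by metis
  obtain g where g: "g holomorphic_on twist d k ` ball 0 r" "\<And>z. z \<in> ball 0 r \<Longrightarrow> g (twist d k z) = z"
    using holomorphic_has_inverse[OF holomorphic_twist open_ball r(4)] by metis
  have "0 \<in> twist d k ` ball 0 r" using r(1) k by (intro image_eqI[of _ _ 0]) auto
  then obtain s where s: "0 < s" "ball 0 s \<subseteq> twist d k ` ball 0 r" using r(3) by (meson openE)
  show thesis
  proof (rule that[OF r(1,4) _ s(1)])
    show "g holomorphic_on ball 0 s" using g(1) s(2) holomorphic_on_subset by blast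
    show w: "g w \<in> ball 0 r" if w': "w \<in> ball 0 s" for w
    proof -
      obtain z where "w = twist d k z" "z \<in> ball 0 r" using s(2) w' by blast
      then show ?thesis using g(2) by simp
    qed
    show "twist d k (g w) = w" if w': "w \<in> ball 0 s" for w
    proof -
      obtain z where "w = twist d k z" "z \<in> ball 0 r" using s(2) w' by blast
      then show ?thesis using g(2) by simp
    qed
    show "g 0 = 0" using g(2)[of 0] r(1) k by simp
    show "1 + \<i> * of_real d * g w ^ (k - 1) \<noteq> 0" if "w \<in> ball 0 s" for w
      using w[OF that] r(2) unfolding S_def by blast
    show "norm (twist d k z) < 1" if "z \<in> ball 0 r" for z
      using that r(2) unfolding S_def by blast
  qed
qed

text \<open>The Cayley transform in half-angle form. It takes the real line, where the critical
  curve lies in the twist coordinate, to the unit circle.\<close>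

lemma moebius_tan:
  assumes "cos (t / 2) \<noteq> 0"
  shows "(1 - \<i> * of_real (- tan (t / 2))) / (1 + \<i> * of_real (- tan (t / 2))) = cis t"
proof -
  define c where "c = cos (t / 2)"
  define s where "s = sin (t / 2)"
  have "c \<noteq> 0" using assms by (simp add: c_def)
  have "1 - \<i> * of_real (- tan (t / 2)) = cis (t / 2) / of_real c"
    "1 + \<i> * of_real (- tan (t / 2)) = cis (- (t / 2)) / of_real c"
    using \<open>c \<noteq> 0\<close> by (auto simp: complex_eq_iff tan_def c_def)
  then show ?thesis using \<open>c \<noteq> 0\<close> by (simp add: cis_divide)
qed

text \<open>The map is p + cnj q with p = (V + i K) / 2 and q = (V - i K) / 2. As K' = -X V' for the
  twist X, the factor V' cancels in p' / q' and leaves the Cayley transform of X. Hence \<psi> = cis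
  t holds where X = - tan (t / 2), and g finds that point.\<close>

lemma natural_parametrization_pair_Suc:
  assumes e: "e \<noteq> 0" and n: "1 \<le> n" "2 \<le> k"
    and r: "0 < r" "inj_on (twist d k) (ball 0 r)" "\<And>z. z \<in> ball 0 r \<Longrightarrow> norm (twist d k z) < 1"
    and s: "0 < s" and g: "\<And>w. w \<in> ball 0 s \<Longrightarrow> g w \<in> ball 0 r" "\<And>w. w \<in> ball 0 s \<Longrightarrow> twist d k (g w) =
        w"
  shows "natural_parametrization UNIV (pair_Suc e n d k) 0 (\<lambda>t. g (of_real (- tan (t / 2))))"
proof -
  let ?X = "twist d k"
  define V where "V z = e * z ^ n" for z
  define K where "K = second_Suc e n d k"
  define V' where "V' z = e * (of_nat n * z ^ (n - 1))" for z
  define p where "p z = (V z + \<i> * K z) / 2" for z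
  define q where "q z = (V z - \<i> * K z) / 2" for z
  define \<psi> where "\<psi> z = (1 - \<i> * ?X z) / (1 + \<i> * ?X z)" for z
  have dV: "(V has_field_derivative V' z) (at z)" for z unfolding V_def[abs_def] V'_def by (rule
      DERIV_monom)
  have dK: "(K has_field_derivative - ?X z * V' z) (at z)" for z
    unfolding K_def V'_def by (rule DERIV_second_Suc[OF n(1)])
  have dp: "(p has_field_derivative (V' z + \<i> * (- ?X z * V' z)) / 2) (at z)" for z
    unfolding p_def[abs_def] by (intro DERIV_cdivide DERIV_add DERIV_cmult dV dK)
  have dq: "(q has_field_derivative (V' z - \<i> * (- ?X z * V' z)) / 2) (at z)" for z
    unfolding q_def[abs_def] by (intro DERIV_cdivide DERIV_diff DERIV_cmult dV dK)
  have nz: "1 + \<i> * ?X z \<noteq> 0" if "z \<in> ball 0 r" for z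
  proof
    assume "1 + \<i> * ?X z = 0"
    then have "\<i> * ?X z = - 1" by (simp add: add_eq_0_iff)
    then have "norm (?X z) = 1" by (metis norm_minus_cancel norm_mult norm_ii mult_1 norm_one)
    then show False using r(3)[OF that] by simp
  qed
  have "eventually (\<lambda>t::real. of_real (- tan (t / 2)) \<in> ball (0::complex) s \<and> cos (t / 2) \<noteq> 0) (nhds
      0)"
  proof -
    have "isCont (\<lambda>t::real. - tan (t / 2)) 0" "isCont (\<lambda>t::real. cos (t / 2)) 0"
      by (auto intro!: continuous_intros)
    then have "((\<lambda>t::real. - tan (t / 2)) \<longlongrightarrow> 0) (at 0)" "((\<lambda>t::real. cos (t / 2)) \<longlongrightarrow> 1) (at 0)"
      by (auto simp: isCont_def)
    from this(1) this(2)[THEN tendsto_imp_eventually_ne, of 0]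
    have "eventually (\<lambda>t::real. \<bar>- tan (t / 2)\<bar> < s) (at 0)" "eventually (\<lambda>t::real. cos (t / 2) \<noteq> 0)
        (at 0)"
      using s by (auto simp: tendsto_iff dist_real_def)
    then have "eventually (\<lambda>t::real. \<bar>- tan (t / 2)\<bar> < s) (nhds 0)" "eventually (\<lambda>t::real. cos (t /
        2) \<noteq> 0) (nhds 0)"
      using s by (auto simp: eventually_nhds_conv_at)
    then show ?thesis by eventually_elim simp
  qed
  then have ev: "\<forall>\<^sub>F t in nhds 0. g (of_real (- tan (t / 2))) \<in> ball 0 r \<and> \<psi> (g (of_real (- tan (t /
      2)))) = \<psi> 0 * cis t"
  proof eventually_elim
    case (elim t)
    have "\<psi> 0 = 1" using n by (simp add: \<psi>_def)
    then show ?case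
      using g[of "of_real (- tan (t / 2))"] elim moebius_tan[of t] by (simp add: \<psi>_def)
  qed
  show "natural_parametrization UNIV (pair_Suc e n d k) 0 (\<lambda>t. g (of_real (- tan (t / 2))))"
    unfolding natural_parametrization_def
  proof (rule exI[of _ "ball 0 r"], rule exI[of _ p], rule exI[of _ q], rule exI[of _ \<psi>], intro
      conjI ballI)
    show "p holomorphic_on ball 0 r" "q holomorphic_on ball 0 r"
      using dp dq by (auto simp: holomorphic_on_open)
    show "\<psi> holomorphic_on ball 0 r"
      unfolding \<psi>_def[abs_def] using nz by (intro holomorphic_intros) auto
    show "pair_Suc e n d k z = p z + cnj (q z)" for z
    proof -
      have "Complex (Re a) (Re b) = (a + \<i> * b) / 2 + cnj ((a - \<i> * b) / 2)" for a b
        by (simp add: complex_eq_iff add_divide_distrib diff_divide_distrib)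
      then show ?thesis by (simp only: pair_Suc_eq re_pair_def p_def q_def V_def K_def)
    qed
    fix z :: complex assume z: "z \<in> ball 0 r - {0}"
    have D: "deriv q z = V' z * (1 + \<i> * ?X z) / 2" "deriv p z = V' z * (1 - \<i> * ?X z) / 2"
      using DERIV_imp_deriv[OF dp[of z]] DERIV_imp_deriv[OF dq[of z]] by (simp_all add:
          algebra_simps)
    have "V' z \<noteq> 0" "1 + \<i> * ?X z \<noteq> 0" using z e n nz[of z] by (auto simp: V'_def)
    then show "deriv q z \<noteq> 0" "\<psi> z = deriv p z / deriv q z"
      unfolding D \<psi>_def by simp_all
  next
    show "inj_on \<psi> (ball 0 r)"
    proof (rule inj_onI)
      fix x y assume xy: "x \<in> ball 0 r" "y \<in> ball 0 r" "\<psi> x = \<psi> y"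
      then have "(1 - \<i> * ?X x) * (1 + \<i> * ?X y) = (1 - \<i> * ?X y) * (1 + \<i> * ?X x)"
        using nz[OF xy(1)] nz[OF xy(2)] by (simp add: \<psi>_def frac_eq_eq)
      then have "?X x = ?X y" by (simp add: algebra_simps)
      then show "x = y" using r(2) xy by (auto dest: inj_onD)
    qed
  qed (use r ev in auto)
qed


text \<open>Since \<open>w = g w * (1 + \<i> * of_real d * g w ^ (k - 1))\<close>, the quotient
  \<open>v\<close> of \<open>g\<close> by the identity is the inverse of the second factor.\<close>

lemma pair_Suc_along_inverse:
  assumes n: "1 \<le> n" "2 \<le> k" and s: "0 < s" and g: "g holomorphic_on ball 0 s"
    "\<And>w. w \<in> ball 0 s \<Longrightarrow> twist d k (g w) = w" "g 0 = 0"
    "\<And>w. w \<in> ball 0 s \<Longrightarrow> 1 + \<i> * of_real d * g w ^ (k - 1) \<noteq> 0"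
  obtains v R where "v holomorphic_on ball 0 s" "\<And>w. w \<in> ball 0 s \<Longrightarrow> g w = w * v w" "v 0 = 1"
    "\<And>l. R l holomorphic_on ball 0 s" "\<And>l. R l 0 = of_nat l"
    "\<And>l w. w \<in> ball 0 s \<Longrightarrow> g w ^ l = w ^ l * (1 - \<i> * of_real d * w ^ (k - 1) * R l w)"
proof -
  define v where "v w = 1 / (1 + \<i> * of_real d * g w ^ (k - 1))" for w
  define R where "R l w = v w ^ k * (\<Sum>i<l. v w ^ i)" for l w
  have v: "v holomorphic_on ball 0 s"
    unfolding v_def[abs_def] using g by (intro holomorphic_intros) auto
  have gv: "g w = w * v w" if "w \<in> ball 0 s" for w
  proof -
    have "g w * (1 + \<i> * of_real d * g w ^ (k - 1)) = twist d k (g w)"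
      using n by (simp add: twist_def algebra_simps power_Suc[symmetric])
    then show ?thesis using g(2,4)[OF that] by (simp add: v_def eq_divide_eq)
  qed
  have v1: "v w - 1 = - \<i> * of_real d * w ^ (k - 1) * v w ^ k" if "w \<in> ball 0 s" for w
  proof -
    have "v w * (1 + \<i> * of_real d * g w ^ (k - 1)) = 1"
      using g(4)[OF that] by (simp add: v_def)
    moreover have "v w * g w ^ (k - 1) = w ^ (k - 1) * v w ^ k"
      using n power_Suc[of "v w" "k - 1"] by (simp add: gv[OF that] power_mult_distrib)
    ultimately show ?thesis by (simp add: algebra_simps)
  qed
  show thesis
  proof
    show "v holomorphic_on ball 0 s" by fact
    show "g w = w * v w" if "w \<in> ball 0 s" for w using gv that .
    show v0: "v 0 = 1" using g(3) n by (simp add: v_def power_0_left)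
    show "R l holomorphic_on ball 0 s" for l
      unfolding R_def[abs_def] using v by (intro holomorphic_intros)
    show "R l 0 = of_nat l" for l by (simp add: R_def v0)
    show "g w ^ l = w ^ l * (1 - \<i> * of_real d * w ^ (k - 1) * R l w)" if "w \<in> ball 0 s" for l w
    proof -
      have "v w ^ l - 1 = (v w - 1) * (\<Sum>i<l. v w ^ i)"
        by (rule power_diff_1_eq)
      also have "\<dots> = - (\<i> * of_real d * w ^ (k - 1) * R l w)"
        by (simp only: v1[OF that]) (simp add: R_def algebra_simps)
      finally have "v w ^ l = 1 - \<i> * of_real d * w ^ (k - 1) * R l w" by (simp add: algebra_simps)
      then show ?thesis by (simp add: gv[OF that] power_mult_distrib)
    qed
  qed
qed

text \<open>Reduces the order-pair to two leading-order computations along the inverse g of the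
  twist on the real line; \<open>lead\<close> is where the examples differ.\<close>

lemma order_pair_exists:
  assumes e: "e \<noteq> 0" and n: "1 \<le> n" "2 \<le> k" and j: "1 \<le> j" "j < l \<or> j = \<infinity> \<and> l = \<infinity>"
    and lead: "\<And>s v R g. 0 < s \<Longrightarrow> v holomorphic_on ball 0 s \<Longrightarrow> v 0 = 1 \<Longrightarrow>
      (\<And>l. R l holomorphic_on ball 0 s) \<Longrightarrow> (\<And>l. R l 0 = of_nat l) \<Longrightarrow>
      (\<And>w. w \<in> ball 0 s \<Longrightarrow> g w = w * v w) \<Longrightarrow>
      (\<And>l w. w \<in> ball 0 s \<Longrightarrow> g w ^ l = w ^ l * (1 - \<i> * of_real d * w ^ (k - 1) * R l w)) \<Longrightarrow>
      (\<And>w. w \<in> ball 0 s \<Longrightarrow> twist d k (g w) = w) \<Longrightarrow>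
      leading_order (\<lambda>t. Re (e * g (of_real t) ^ n)) j \<and>
      leading_order (\<lambda>t. Re (second_Suc e n d k (g (of_real t)))) l"
  shows "\<exists>\<gamma>. natural_parametrization UNIV (pair_Suc e n d k) 0 \<gamma> \<and> has_order_pair (pair_Suc e n d k
      \<circ> \<gamma>) j l"
proof -
  obtain r s g where r: "0 < r" "inj_on (twist d k) (ball 0 r)" "\<And>z. z \<in> ball 0 r \<Longrightarrow> norm (twist d k
      z) < 1"
    and s: "0 < s" and g: "g holomorphic_on ball 0 s" "\<And>w. w \<in> ball 0 s \<Longrightarrow> g w \<in> ball 0 r"
    "\<And>w. w \<in> ball 0 s \<Longrightarrow> twist d k (g w) = w" "g 0 = 0"
    "\<And>w. w \<in> ball 0 s \<Longrightarrow> 1 + \<i> * of_real d * g w ^ (k - 1) \<noteq> 0"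
    using twist_inverse[OF n(2), of d] by blast
  obtain v R where vR: "v holomorphic_on ball 0 s" "\<And>w. w \<in> ball 0 s \<Longrightarrow> g w = w * v w" "v 0 = 1"
    "\<And>l. R l holomorphic_on ball 0 s" "\<And>l. R l 0 = of_nat l"
    "\<And>l w. w \<in> ball 0 s \<Longrightarrow> g w ^ l = w ^ l * (1 - \<i> * of_real d * w ^ (k - 1) * R l w)"
    using pair_Suc_along_inverse[OF n s g(1,3,4,5)] by blast
  let ?\<gamma> = "\<lambda>t. g (of_real (- tan (t / 2)))"
  have "leading_order (\<lambda>t. Re (e * g (of_real t) ^ n)) j \<and>
      leading_order (\<lambda>t. Re (second_Suc e n d k (g (of_real t)))) l"
    by (rule lead[OF s vR(1,3,4,5,2,6) g(3)])
  moreover have "?\<gamma> (- 2 * arctan t) = g (of_real t)" for t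
    by (simp add: tan_arctan)
  then have "Re ((pair_Suc e n d k \<circ> ?\<gamma>) (- 2 * arctan t)) = Re (e * g (of_real t) ^ n)"
    "Im ((pair_Suc e n d k \<circ> ?\<gamma>) (- 2 * arctan t)) = Re (second_Suc e n d k (g (of_real t)))" for t
    by (simp_all only: pair_Suc_eq re_pair_simps o_apply)
  moreover have "(pair_Suc e n d k \<circ> ?\<gamma>) 0 = 0"
    using g(4) n by (simp add: pair_Suc_def)
  ultimately have "has_order_pair (pair_Suc e n d k \<circ> ?\<gamma>) j l"
    using j by (intro has_order_pairI) (simp_all only:)
  then show ?thesis
    using natural_parametrization_pair_Suc[OF e n r s g(2,3)] by blast
qed

lemma eventually_ball_real: "0 < s \<Longrightarrow> \<forall>\<^sub>F t in nhds 0. complex_of_real t \<in> ball 0 s"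
  using eventually_nhds_in_open[of "ball (0::real) s" 0] by simp

text \<open>For d = 0 the twist is the identity, and the critical value curve is (t^n, -n / (n + 1)
  t^(n + 1)) up to the reparametrization.\<close>

lemma order_pair_generic:
  assumes n: "1 \<le> n"
  shows "\<exists>\<gamma>. natural_parametrization UNIV (pair_Suc 1 n 0 2) 0 \<gamma> \<and>
     has_order_pair (pair_Suc 1 n 0 2 \<circ> \<gamma>) (enat n) (enat (n + 1))"
proof (rule order_pair_exists)
  fix s :: real and v g R
  assume s: "0 < s" and g: "\<And>w. w \<in> ball 0 s \<Longrightarrow> twist 0 2 (g w) = w"
  have ev: "\<forall>\<^sub>F t in nhds 0. g (complex_of_real t) = of_real t"
    using eventually_ball_real[OF s] by eventually_elim (use g in \<open>simp add: twist_def\<close>)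
  have "leading_order (\<lambda>t. Re (1 * g (of_real t) ^ n)) (enat n)"
    by (rule leading_order_holomorphic[of "\<lambda>_. 1" 1])
      (use ev in \<open>auto elim!: eventually_mono simp flip: of_real_power\<close>)
  moreover have "leading_order (\<lambda>t. Re (second_Suc 1 n 0 2 (g (of_real t)))) (enat (n + 1))"
    by (rule leading_order_holomorphic[of "\<lambda>_. of_real (- real n / real (n + 1))" 1])
      (use ev n in \<open>auto elim!: eventually_mono simp: second_Suc_def simp flip: of_real_power
          of_real_mult\<close>)
  ultimately show "leading_order (\<lambda>t. Re (1 * g (of_real t) ^ n)) (enat n) \<and>
     leading_order (\<lambda>t. Re (second_Suc 1 n 0 2 (g (of_real t)))) (enat (n + 1))" ..
qed (use n in \<open>auto simp: one_enat_def\<close>)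

text \<open>For e = i and d = 0 the critical curve is the real axis, on which both components
  vanish.\<close>

lemma order_pair_infinity:
  assumes n: "1 \<le> n"
  shows "\<exists>\<gamma>. natural_parametrization UNIV (pair_Suc \<i> n 0 2) 0 \<gamma> \<and>
     has_order_pair (pair_Suc \<i> n 0 2 \<circ> \<gamma>) \<infinity> \<infinity>"
proof (rule order_pair_exists)
  fix s :: real and v g R
  assume s: "0 < s" and g: "\<And>w. w \<in> ball 0 s \<Longrightarrow> twist 0 2 (g w) = w"
  have ev: "\<forall>\<^sub>F t in nhds 0. g (complex_of_real t) = of_real t"
    using eventually_ball_real[OF s] by eventually_elim (use g in \<open>simp add: twist_def\<close>)
  have "leading_order (\<lambda>t. Re (\<i> * g (of_real t) ^ n)) \<infinity>"
    by (rule leading_order_zero)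
      (use ev in \<open>auto elim!: eventually_mono simp flip: of_real_power\<close>)
  moreover have "leading_order (\<lambda>t. Re (second_Suc \<i> n 0 2 (g (of_real t)))) \<infinity>"
    by (rule leading_order_zero)
      (use ev n in \<open>auto elim!: eventually_mono simp: second_Suc_def simp flip: of_real_power
          of_real_mult\<close>)
  ultimately show "leading_order (\<lambda>t. Re (\<i> * g (of_real t) ^ n)) \<infinity> \<and>
     leading_order (\<lambda>t. Re (second_Suc \<i> n 0 2 (g (of_real t)))) \<infinity>" ..
qed (use n in auto)

text \<open>For real w the real part of i w^l is 0, so the order is decided by the correction in g^l
  = w^l (1 - i w^(k - 1) R), which raises it by k - 1.\<close>

lemma order_pair_tangent:
  assumes n: "1 \<le> n" "2 \<le> k"
  shows "\<exists>\<gamma>. natural_parametrization UNIV (pair_Suc \<i> n 1 k) 0 \<gamma> \<and>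
     has_order_pair (pair_Suc \<i> n 1 k \<circ> \<gamma>) (enat (n + k - 1)) (enat (n + k))"
proof (rule order_pair_exists)
  fix s :: real and v g R
  assume s: "0 < s" and v: "v holomorphic_on ball 0 s" "v 0 = 1"
    and R: "\<And>l. R l holomorphic_on ball 0 s" "\<And>l::nat. R l 0 = of_nat l"
    and gv: "\<And>w. w \<in> ball 0 s \<Longrightarrow> g w = w * v w"
    and g: "\<And>l w. w \<in> ball 0 s \<Longrightarrow> g w ^ l = w ^ l * (1 - \<i> * of_real 1 * w ^ (k - 1) * R l w)"
  have re: "Re (\<i> * g (of_real t) ^ l) = t ^ (l + k - 1) * Re (R l (of_real t))"
    if "complex_of_real t \<in> ball 0 s" "1 \<le> l" for t l
  proof -
    have "l + k - 1 = l + (k - 1)" using n by simp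
    then have "\<i> * g (of_real t) ^ l = \<i> * of_real (t ^ l) + of_real (t ^ (l + k - 1)) * R l
        (of_real t)"
      unfolding g[OF that(1)] by (simp add: algebra_simps power_add)
    then show ?thesis by (simp only: plus_complex.simps) simp
  qed
  have "leading_order (\<lambda>t. Re (\<i> * g (of_real t) ^ n)) (enat (n + k - 1))"
  proof (rule leading_order_holomorphic[OF R(1) s])
    show "\<forall>\<^sub>F t in nhds 0. Re (\<i> * g (of_real t) ^ n) = t ^ (n + k - 1) * Re (R n (of_real t))"
      using eventually_ball_real[OF s] by eventually_elim (rule re[OF _ n(1)])
  qed (use R n in simp)
  moreover have "leading_order (\<lambda>t. Re (second_Suc \<i> n 1 k (g (of_real t)))) (enat (n + k))"
  proof (rule leading_order_holomorphic[of "\<lambda>w. of_real (- real n / real (n + 1)) * R (n + 1) w +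
      of_real (real n / real (n + k)) * v w ^ (n + k)" s])
    \<comment> \<open>The coefficient of t^(n + k) is -n from the first term, since R (n + 1) 0 = n
      + 1, plus n / (n + k) from the second; the sum is negative.\<close>
    have "real n / real (n + k) < real n / 1"
      using n by (intro divide_strict_left_mono) auto
    then have "- real n + real n / real (n + k) < 0" by simp
    then show "Re (of_real (- real n / real (n + 1)) * R (n + 1) 0 + of_real (real n / real (n + k))
        * v 0 ^ (n + k)) \<noteq> 0"
      using n by (simp add: R v)
    show "\<forall>\<^sub>F t in nhds 0. Re (second_Suc \<i> n 1 k (g (of_real t))) = t ^ (n + k) *
       Re (of_real (- real n / real (n + 1)) * R (n + 1) (of_real t) + of_real (real n / real (n +
           k)) * v (of_real t) ^ (n + k))"
      using eventually_ball_real[OF s]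
    proof eventually_elim
      case (elim t)
      have S: "second_Suc \<i> n 1 k (g (of_real t)) = of_real (- real n / real (n + 1)) * (\<i> * g
          (of_real t) ^ (n + 1)) +
          of_real (real n / real (n + k)) * g (of_real t) ^ (n + k)"
        unfolding second_Suc_def by (simp add: algebra_simps)
      have lin: "Re (of_real a * X + of_real b * Y) = a * Re X + b * Re Y" for a b X Y
        by simp
      have "g (of_real t) ^ (n + k) = of_real (t ^ (n + k)) * v (of_real t) ^ (n + k)"
        by (simp add: gv[OF elim] power_mult_distrib)
      then have B: "Re (g (of_real t) ^ (n + k)) = t ^ (n + k) * Re (v (of_real t) ^ (n + k))" by
          simp
      have A: "Re (\<i> * g (of_real t) ^ (n + 1)) = t ^ (n + k) * Re (R (n + 1) (of_real t))"
        using re[OF elim, of "n + 1"] by simp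
      show ?case
        unfolding S lin A B by (simp only: distrib_left mult_ac)
    qed
  qed (use R v s in \<open>auto intro!: holomorphic_intros\<close>)
  ultimately show "leading_order (\<lambda>t. Re (\<i> * g (of_real t) ^ n)) (enat (n + k - 1)) \<and>
     leading_order (\<lambda>t. Re (second_Suc \<i> n 1 k (g (of_real t)))) (enat (n + k))" ..
qed (use n in \<open>auto simp: one_enat_def\<close>)

text \<open>j = \<infinity> is the collapsed axis and j = m the generic direction e = 1; every other
  j is reached with e = i, d = 1 and k = j - m + 1.\<close>

lemma realizes_order_pair:
  assumes "1 \<le> m" "enat m \<le> j" "j + enat (m ^ 2) = \<mu>"
  shows "\<exists>U g z0 \<gamma>. harmonic_map U g \<and> smooth_critical_point U g z0 \<and>
     has_order g z0 m \<and> has_multiplicity g z0 \<mu> \<and>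
     natural_parametrization U g z0 \<gamma> \<and> has_order_pair (g \<circ> \<gamma>) j (j + 1)"
proof -
  have H: ?thesis if "e \<noteq> 0" "2 \<le> k" "has_multiplicity (pair_Suc e m d k) 0 \<mu>"
    "\<exists>\<gamma>. natural_parametrization UNIV (pair_Suc e m d k) 0 \<gamma> \<and> has_order_pair (pair_Suc e m d k \<circ> \<gamma>)
        j (j + 1)" for e d k
    using that harmonic_map_pair_Suc smooth_critical_point_pair_Suc[OF that(1) assms(1) that(2)]
      pair_Suc_has_order[OF that(1) assms(1) that(2)] by blast
  show ?thesis
  proof (cases j)
    case infinity
    show ?thesis
    proof (rule H)
      show "has_multiplicity (pair_Suc \<i> m 0 2) 0 \<mu>"
        using has_multiplicity_poly_pair_infinity[of \<i> m "m + 1" "m + 2"] assms infinity by (auto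
            simp: pair_Suc_def)
      show "\<exists>\<gamma>. natural_parametrization UNIV (pair_Suc \<i> m 0 2) 0 \<gamma> \<and> has_order_pair (pair_Suc \<i> m 0
          2 \<circ> \<gamma>) j (j + 1)"
        using order_pair_infinity[OF assms(1)] infinity by simp
    qed auto
  next
    case (enat i)
    show ?thesis
    proof (cases "i = m")
      case True
      show ?thesis
      proof (rule H)
        show "has_multiplicity (pair_Suc 1 m 0 2) 0 \<mu>"
          using has_multiplicity_poly_pair_Suc[of m 2 1 "- real m / real (m + 1)" 0] assms enat True
          by (auto simp: pair_Suc_def power2_eq_square algebra_simps)
        show "\<exists>\<gamma>. natural_parametrization UNIV (pair_Suc 1 m 0 2) 0 \<gamma> \<and> has_order_pair (pair_Suc 1 m
            0 2 \<circ> \<gamma>) j (j + 1)"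
          using order_pair_generic[OF assms(1)] enat True by (simp add: one_enat_def)
      qed auto
    next
      case False
      define k where "k = i - m + 1"
      have k: "2 \<le> k" "i = m + k - 1" "m + k = i + 1" using False assms(2) enat by (auto simp:
          k_def)
      \<comment> \<open>m - 1 lines of contact m + 1 and one line of contact m + k.\<close>
      have "(m - 1) * (m + 1) + (m + k) = i + m ^ 2"
        using k assms(1) by (cases m) (auto simp: power2_eq_square algebra_simps)
      then have "enat ((m - 1) * (m + 1) + (m + k)) = \<mu>" using assms(3) enat by simp
      moreover have "has_multiplicity (pair_Suc \<i> m 1 k) 0 (enat ((m - 1) * (m + 1) + (m + k)))"
      proof -
        have "- real m / real (m + 1) \<noteq> 0" "- 1 * real m / real (m + k) \<noteq> 0" using assms(1) by auto
        from has_multiplicity_poly_pair_Suc[OF assms(1) k(1) complex_i_not_zero this(1) this(2)]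
        show ?thesis by (simp only: pair_Suc_def imaginary_unit.simps if_True refl)
      qed
      ultimately have M: "has_multiplicity (pair_Suc \<i> m 1 k) 0 \<mu>" by simp
      have "j = enat (m + k - 1)" "j + 1 = enat (m + k)"
        using k(2,3) enat by (simp_all add: one_enat_def)
      then show ?thesis
        using order_pair_tangent[OF assms(1) k(1)] by (intro H[OF _ k(1) M]) (simp_all only:
            complex_i_not_zero not_False_eq_True)
    qed
  qed
qed

section \<open>Orientation preserving homeomorphisms\<close>

text \<open>Centre and radius move linearly. Injectivity of h keeps the image of the circle away
  from the image of its centre, so their difference is a homotopy of loops in the punctured
  plane.\<close>

lemma winding_number_circle_homotopy:
  assumes h: "continuous_on S h" "inj_on h S"
    and r: "0 < r0" "0 < r1"
    and sub: "\<And>s. s \<in> {0..1} \<Longrightarrow> cball ((1 - s) *\<^sub>R z0 + s *\<^sub>R z1) ((1 - s) * r0 + s * r1) \<subseteq> S"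
  shows "winding_number (h \<circ> circlepath z0 r0) (h z0) = winding_number (h \<circ> circlepath z1 r1) (h
      z1)"
proof -
  define c where "c s = (1 - s) *\<^sub>R z0 + s *\<^sub>R z1" for s :: real
  define \<rho> where "\<rho> s = (1 - s) * r0 + s * r1" for s :: real
  define H where "H p = h (circlepath (c (fst p)) (\<rho> (fst p)) (snd p)) - h (c (fst p))" for p ::
      "real \<times> real"
  have rho: "0 < \<rho> s" if "s \<in> {0..1}" for s
    using that r unfolding \<rho>_def
    by (cases "s = 0") (auto intro: add_nonneg_pos)
  have cS: "c s \<in> S" "circlepath (c s) (\<rho> s) t \<in> S" "circlepath (c s) (\<rho> s) t \<noteq> c s" if "s \<in> {0..1}"
      for s t
  proof -
    have B: "cball (c s) (\<rho> s) \<subseteq> S" using sub[OF that] by (simp add: c_def \<rho>_def)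
    show "c s \<in> S" using B rho[OF that] by auto
    have "dist (c s) (circlepath (c s) (\<rho> s) t) = \<rho> s"
      using rho[OF that] by (simp add: circlepath dist_norm norm_mult)
    then show "circlepath (c s) (\<rho> s) t \<in> S" "circlepath (c s) (\<rho> s) t \<noteq> c s"
      using B rho[OF that] by auto
  qed
  have "homotopic_loops (- {0}) (\<lambda>t. H (0, t)) (\<lambda>t. H (1, t))"
    unfolding homotopic_loops
  proof (intro exI[of _ H] conjI ballI)
    have "continuous_on ({0..1} \<times> {0..1}) (\<lambda>p. circlepath (c (fst p)) (\<rho> (fst p)) (snd p))"
      "continuous_on ({0..1} \<times> {0..1::real}) (\<lambda>p. c (fst p))"
      unfolding circlepath c_def \<rho>_def by (intro continuous_intros)+
    then show "continuous_on ({0..1} \<times> {0..1}) H"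
      unfolding H_def[abs_def] using cS
      by (intro continuous_on_diff continuous_on_compose2[OF h(1)]) auto
    have "H (s, t) \<noteq> 0" if "s \<in> {0..1}" for s t
      using inj_on_eq_iff[OF h(2) cS(2,1)[OF that]] cS(3)[OF that] by (simp add: H_def)
    then show "H \<in> {0..1} \<times> {0..1} \<rightarrow> - {0}" by auto
    show "pathfinish (H \<circ> Pair t) = pathstart (H \<circ> Pair t)" for t
      by (simp add: H_def pathfinish_def pathstart_def circlepath)
  qed auto
  then have "winding_number (\<lambda>t. H (0, t)) 0 = winding_number (\<lambda>t. H (1, t)) 0"
    by (rule winding_number_homotopic_loops)
  then show ?thesis
    unfolding winding_number_offset[of "h \<circ> circlepath z0 r0"] winding_number_offset[of "h \<circ>
        circlepath z1 r1"]
    by (simp add: H_def c_def \<rho>_def o_def)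
qed

text \<open>The local degree is locally constant in the centre, so on a connected set a single
  circle decides the orientation.\<close>

lemma winding_number_all_circles:
  assumes S: "open S" "connected S" and h: "continuous_on S h" "inj_on h S"
    and z0: "0 < r0" "cball z0 r0 \<subseteq> S" "winding_number (h \<circ> circlepath z0 r0) (h z0) = 1"
    and z: "0 < r" "cball z r \<subseteq> S"
  shows "winding_number (h \<circ> circlepath z r) (h z) = 1"
proof -
  define P where "P z \<longleftrightarrow> (\<forall>r. 0 < r \<and> cball z r \<subseteq> S \<longrightarrow> winding_number (h \<circ> circlepath z r) (h z) = 1)"
      for z
  have radius: "winding_number (h \<circ> circlepath x a) (h x) = winding_number (h \<circ> circlepath x b) (h
      x)"
    if "0 < a" "0 < b" "cball x a \<subseteq> S" "cball x b \<subseteq> S" for x a b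
  proof (rule winding_number_circle_homotopy[OF h that(1,2)])
    fix s :: real assume s: "s \<in> {0..1}"
    have x: "(1 - s) *\<^sub>R x + s *\<^sub>R x = x" by (simp add: scaleR_left_distrib[symmetric])
    have "(1 - s) * a + s * b \<le> max a b"
      using s by (intro convex_bound_le) auto
    then have "cball x ((1 - s) * a + s * b) \<subseteq> cball x (max a b)" by (rule subset_cball)
    then show "cball ((1 - s) *\<^sub>R x + s *\<^sub>R x) ((1 - s) * a + s * b) \<subseteq> S"
      unfolding x using that(3,4) by (auto simp: max_def split: if_splits)
  qed
  have "P z0"
    unfolding P_def using radius[OF z0(1) _ z0(2)] z0(3) by metis
  have "P z"
  proof (rule connected_induction_simple[OF S(2), where P = P and a = z0])
    show "z0 \<in> S" "z \<in> S" using z0 z by auto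
    show "P z0" by fact
    fix a assume "a \<in> S"
    then obtain \<rho> where \<rho>: "0 < \<rho>" "ball a \<rho> \<subseteq> S" using S(1) by (meson openE)
    define e where "e = \<rho> / 3"
    have e: "0 < e" using \<rho> by (simp add: e_def)
    have sub: "cball x e \<subseteq> S" if "dist a x < e" for x
    proof -
      have "cball x e \<subseteq> ball a \<rho>"
      proof
        fix y assume "y \<in> cball x e"
        then show "y \<in> ball a \<rho>" using dist_triangle[of a y x] that \<rho> by (simp add: e_def)
      qed
      then show ?thesis using \<rho>(2) by blast
    qed
    have "P y" if xy: "x \<in> ball a e" "y \<in> ball a e" "P x" for x y
      unfolding P_def
    proof (intro allI impI)
      fix r :: real assume r: "0 < r \<and> cball y r \<subseteq> S"
      have "winding_number (h \<circ> circlepath x e) (h x) = winding_number (h \<circ> circlepath y e) (h y)"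
      proof (rule winding_number_circle_homotopy[OF h e e])
        fix s :: real assume s: "s \<in> {0..1}"
        have "(1 - s) *\<^sub>R x + s *\<^sub>R y \<in> ball a e"
          using convexD[OF convex_ball xy(1,2), of "1 - s" s] s by simp
        moreover have "(1 - s) * e + s * e = e" by (simp add: algebra_simps)
        ultimately show "cball ((1 - s) *\<^sub>R x + s *\<^sub>R y) ((1 - s) * e + s * e) \<subseteq> S"
          using sub by simp
      qed
      moreover have "winding_number (h \<circ> circlepath x e) (h x) = 1"
        using xy sub[of x] e unfolding P_def by simp
      ultimately show "winding_number (h \<circ> circlepath y r) (h y) = 1"
        using radius[of e r y] e r sub[of y] xy by simp
    qed
    moreover have "ball a e \<subseteq> S" using \<rho> by (auto simp: e_def)
    then have "openin (top_of_set S) (ball a e)" using openin_open_eq[OF S(1)] by blast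
    moreover have "a \<in> ball a e" using e by simp
    ultimately show "\<exists>T. openin (top_of_set S) T \<and> a \<in> T \<and> (\<forall>x\<in>T. \<forall>y\<in>T. P x \<longrightarrow> P y)"
      by blast
  qed
  then show ?thesis using z by (simp add: P_def)
qed

text \<open>By hypothesis h z - h z0 never points opposite to z - z0, so the segment between the two
  avoids 0 and h winds around a small circle as the identity does. This form of the criterion can be
  tested on maps given by modulus and argument.\<close>

lemma op_homeomorphismI:
  assumes "open S" "connected S" "open T" and hom: "homeomorphism S T h g" and z0: "z0 \<in> S"
    and neg: "\<And>z c. z \<in> S \<Longrightarrow> z \<noteq> z0 \<Longrightarrow> 0 \<le> c \<Longrightarrow> h z - h z0 \<noteq> - (of_real c * (z - z0))"
  shows "op_homeomorphism S T h g"
proof -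
  have h: "continuous_on S h" "inj_on h S"
    using hom by (auto simp: homeomorphism_def inj_on_def) metis
  obtain r where r: "0 < r" "cball z0 r \<subseteq> S" using assms(1) z0 by (meson open_contains_cball)
  have sph: "circlepath z0 r t \<in> S" "circlepath z0 r t \<noteq> z0" for t
  proof -
    have "dist z0 (circlepath z0 r t) = r" using r(1) by (simp add: circlepath dist_norm norm_mult)
    then show "circlepath z0 r t \<in> S" "circlepath z0 r t \<noteq> z0" using r by auto
  qed
  let ?p = "\<lambda>t. (h \<circ> circlepath z0 r) t - h z0" and ?q = "\<lambda>t. circlepath z0 r t - z0"
  have "winding_number ?p 0 = winding_number ?q 0"
  proof (rule winding_number_loops_linear_eq)
    have c: "continuous_on {0..1} (circlepath z0 r)" unfolding circlepath by (intro
        continuous_intros)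
    show "path ?q" unfolding path_def by (intro continuous_intros c)
    have "continuous_on {0..1} (h \<circ> circlepath z0 r)"
      by (rule continuous_on_compose[OF c continuous_on_subset[OF h(1)]]) (use sph in auto)
    from continuous_on_diff[OF this continuous_on_const] show "path ?p" unfolding path_def .
    show "pathfinish ?p = pathstart ?p" "pathfinish ?q = pathstart ?q"
      by (simp_all add: pathfinish_def pathstart_def circlepath)
    fix t :: real
    show "0 \<notin> closed_segment (?q t) (?p t)"
    proof
      assume "0 \<in> closed_segment (?q t) (?p t)"
      then obtain u where u: "0 \<le> u" "u \<le> 1" "(1 - u) *\<^sub>R ?q t + u *\<^sub>R ?p t = 0"
        by (auto simp: closed_segment_def)
      then have "u \<noteq> 0" using sph[of t] by auto
      then have "?p t = - (of_real ((1 - u) / u) * ?q t)"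
        using u(3) by (simp add: scaleR_conv_of_real field_simps add_eq_0_iff)
      then show False using neg[OF sph(1)[of t] sph(2)[of t], of "(1 - u) / u"] u \<open>u \<noteq> 0\<close> by simp
    qed
  qed
  also have "winding_number ?q 0 = winding_number (circlepath z0 r) z0"
    by (rule winding_number_offset[symmetric])
  also have "\<dots> = 1" using r(1) by (rule winding_number_circlepath_centre)
  finally have "winding_number (h \<circ> circlepath z0 r) (h z0) = 1"
    by (simp add: winding_number_offset[of "h \<circ> circlepath z0 r"])
  then show ?thesis
    unfolding op_homeomorphism_def
    using assms(1,3) hom winding_number_all_circles[OF assms(1,2) h r] by blast
qed

section \<open>Shears and the reduction to modulus and argument\<close>

definition shear :: "(real \<Rightarrow> real) \<Rightarrow> complex \<Rightarrow> complex"
  where "shear b p = Complex (Re p) (Im p - b (Re p))"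

lemma shear_simps [simp]: "Re (shear b p) = Re p" "Im (shear b p) = Im p - b (Re p)"
  by (simp_all add: shear_def)

lemma continuous_shear:
  assumes "continuous_on UNIV b"
  shows "continuous_on A (shear b)"
proof -
  have "continuous_on A (\<lambda>p. b (Re p))"
    by (rule continuous_on_compose2[OF assms]) (auto intro: continuous_intros)
  then show ?thesis
    unfolding shear_def[abs_def] Complex_eq by (intro continuous_intros)
qed

text \<open>The first coordinate is only scaled by 1 / \<delta>, which excludes opposite directions
  unless Re z = 0; on that line the shear subtracts the constant b 0.\<close>

lemma op_homeomorphism_shear:
  assumes b: "continuous_on UNIV b" and \<delta>: "0 < \<delta>"
  shows "op_homeomorphism UNIV UNIV (\<lambda>p. shear b p / of_real \<delta>) (\<lambda>p. shear (\<lambda>x. - b x) (of_real \<delta> *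
      p))"
proof (rule op_homeomorphismI[of _ _ _ _ 0])
  have b': "continuous_on UNIV (\<lambda>x. - b x)" using b by (intro continuous_intros)
  have c: "continuous_on UNIV (\<lambda>p. shear (\<lambda>x. - b x) (of_real \<delta> * p))"
    by (rule continuous_on_compose2[OF continuous_shear[OF b']]) (auto intro: continuous_intros)
  show "homeomorphism UNIV UNIV (\<lambda>p. shear b p / of_real \<delta>) (\<lambda>p. shear (\<lambda>x. - b x) (of_real \<delta> * p))"
  proof (rule homeomorphismI)
    show "continuous_on UNIV (\<lambda>p. shear b p / of_real \<delta>)"
      using \<delta> by (intro continuous_intros continuous_shear b) auto
    show "shear (\<lambda>x. - b x) (of_real \<delta> * (shear b x / of_real \<delta>)) = x" for x
      using \<delta> by (simp add: complex_eq_iff)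
    show "shear b (shear (\<lambda>x. - b x) (of_real \<delta> * y)) / of_real \<delta> = y" for y
    proof -
      have "shear b (shear (\<lambda>x. - b x) (of_real \<delta> * y)) = of_real \<delta> * y" by (simp add:
          complex_eq_iff)
      then show ?thesis using \<delta> by simp
    qed
  qed (use c in auto)
  fix z :: complex and c :: real assume z: "z \<noteq> 0" "0 \<le> c"
  show "shear b z / of_real \<delta> - shear b 0 / of_real \<delta> \<noteq> - (of_real c * (z - 0))"
  proof
    assume eq: "shear b z / of_real \<delta> - shear b 0 / of_real \<delta> = - (of_real c * (z - 0))"
    have "Re z / \<delta> = - (c * Re z)" using arg_cong[OF eq, of Re] by simp
    then have "Re z * (1 / \<delta> + c) = 0" by (simp add: algebra_simps)
    moreover have "1 / \<delta> + c > 0" using \<delta> z by (intro add_pos_nonneg) auto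
    ultimately have re: "Re z = 0" by simp
    have "(Im z - b (Re z)) / \<delta> - (- b 0) / \<delta> = - (c * Im z)" using arg_cong[OF eq, of Im] by simp
    then have "Im z * (1 / \<delta> + c) = 0" by (simp add: re algebra_simps diff_divide_distrib)
    then show False using \<open>1 / \<delta> + c > 0\<close> re z by (simp add: complex_eq_iff)
  qed
qed auto

text \<open>The model is homogeneous in r, so a disc of radius \<delta> inside the image of h1 can
  be scaled to the unit disc with the same factor in source and target. Its preimage is
  \<Delta>.\<close>

lemma topological_model_exists:
  fixes f :: "complex \<Rightarrow> complex" and a a' :: real
  assumes \<epsilon>: "0 < \<epsilon>" and h1: "continuous_on (ball 0 \<epsilon>) h1" "inj_on h1 (ball 0 \<epsilon>)" "h1 0 = 0"
    and neg: "\<And>z c. z \<in> ball 0 \<epsilon> \<Longrightarrow> z \<noteq> 0 \<Longrightarrow> 0 \<le> c \<Longrightarrow> h1 z \<noteq> - (of_real c * z)"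
    and b: "continuous_on UNIV b" "shear b (f 0) = 0"
    and up: "\<And>z r \<theta>. z \<in> ball 0 \<epsilon> \<Longrightarrow> 0 \<le> r \<Longrightarrow> 0 \<le> \<theta> \<Longrightarrow> \<theta> \<le> pi \<Longrightarrow> h1 z = of_real r * cis \<theta> \<Longrightarrow>
        shear b (f z) = of_real r * cis (a * \<theta>)"
    and down: "\<And>z r \<theta>. z \<in> ball 0 \<epsilon> \<Longrightarrow> 0 \<le> r \<Longrightarrow> pi \<le> \<theta> \<Longrightarrow> \<theta> \<le> 2 * pi \<Longrightarrow> h1 z = of_real r * cis \<theta> \<Longrightarrow>
        shear b (f z) = of_real r * cis (a' * \<theta>)"
  shows "\<exists>\<Delta> h1 g1 h2 g2. 0 \<in> \<Delta> \<and> \<Delta> \<subseteq> UNIV \<and>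
        op_homeomorphism \<Delta> (ball 0 1) h1 g1 \<and> h1 0 = 0 \<and>
        op_homeomorphism UNIV UNIV h2 g2 \<and> h2 (f 0) = 0 \<and>
        (\<forall>r \<theta>. 0 \<le> r \<and> r < 1 \<and> 0 \<le> \<theta> \<and> \<theta> \<le> pi \<longrightarrow>
           h2 (f (g1 (of_real r * cis \<theta>))) = of_real r * cis (a * \<theta>)) \<and>
        (\<forall>r \<theta>. 0 \<le> r \<and> r < 1 \<and> pi \<le> \<theta> \<and> \<theta> \<le> 2 * pi \<longrightarrow>
           h2 (f (g1 (of_real r * cis \<theta>))) = of_real r * cis (a' * \<theta>))"
proof -
  obtain g where g: "homeomorphism (ball 0 \<epsilon>) (h1 ` ball 0 \<epsilon>) h1 g"
    using invariance_of_domain_homeomorphism[OF open_ball h1(1) _ h1(2)] by auto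
  have "open (h1 ` ball 0 \<epsilon>)" by (rule invariance_of_domain[OF h1(1) open_ball h1(2)])
  moreover have "0 \<in> h1 ` ball 0 \<epsilon>" using \<epsilon> h1(3) by (intro image_eqI[of _ _ 0]) auto
  ultimately obtain \<delta> where \<delta>: "0 < \<delta>" "ball 0 \<delta> \<subseteq> h1 ` ball 0 \<epsilon>" by (meson openE)
  have hg: "h1 (g w) = w" "g w \<in> ball 0 \<epsilon>" if "w \<in> ball 0 \<delta>" for w
    using g \<delta> that by (auto simp: homeomorphism_def)
  have gh: "g (h1 z) = z" if "z \<in> ball 0 \<epsilon>" for z using g that by (auto simp: homeomorphism_def)
  define \<Delta> where "\<Delta> = g ` ball 0 \<delta>"
  have \<Delta>: "\<Delta> \<subseteq> ball 0 \<epsilon>" "\<And>z. z \<in> \<Delta> \<Longrightarrow> h1 z \<in> ball 0 \<delta>" using hg by (auto simp: \<Delta>_def)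
  have cg: "continuous_on (ball 0 \<delta>) g"
    using g \<delta>(2) continuous_on_subset by (auto simp: homeomorphism_def)
  have "open \<Delta>"
  proof -
    have "\<Delta> = ball 0 \<epsilon> \<inter> h1 -` ball 0 \<delta>"
    proof (intro equalityI subsetI)
      fix z assume "z \<in> ball 0 \<epsilon> \<inter> h1 -` ball 0 \<delta>"
      then have "z = g (h1 z)" "h1 z \<in> ball 0 \<delta>" using gh by auto
      then show "z \<in> \<Delta>" unfolding \<Delta>_def by (rule image_eqI)
    qed (use \<Delta> in auto)
    then show ?thesis using continuous_open_preimage[OF h1(1)] by simp
  qed
  have "connected \<Delta>" unfolding \<Delta>_def by (intro connected_continuous_image cg) simp
  have z0: "0 \<in> \<Delta>" using gh[of 0] h1(3) \<delta>(1) \<epsilon> by (auto simp: \<Delta>_def intro: image_eqI[of _ _ 0])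
  let ?h = "\<lambda>z. h1 z / of_real \<delta>" and ?g = "\<lambda>w. g (of_real \<delta> * w)"
  have scale: "of_real \<delta> * w \<in> ball 0 \<delta>" if "w \<in> ball 0 1" for w :: complex
    using that \<delta>(1) by (simp add: norm_mult)
  have hom: "homeomorphism \<Delta> (ball 0 1) ?h ?g"
  proof (rule homeomorphismI)
    show "continuous_on \<Delta> ?h"
      using \<delta>(1) by (intro continuous_intros continuous_on_subset[OF h1(1) \<Delta>(1)]) auto
    show "continuous_on (ball 0 1) ?g"
      by (rule continuous_on_compose2[OF cg]) (use scale in \<open>auto intro!: continuous_intros\<close>)
    show "?h ` \<Delta> \<subseteq> ball 0 1"
      using \<Delta>(2) \<delta>(1) by (auto simp: norm_divide)
    show "?g ` ball 0 1 \<subseteq> \<Delta>" using scale by (auto simp: \<Delta>_def)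
    show "?g (?h z) = z" if "z \<in> \<Delta>" for z using gh \<Delta>(1) that \<delta>(1) by auto
    show "?h (?g w) = w" if "w \<in> ball 0 1" for w using hg(1)[OF scale[OF that]] \<delta>(1) by simp
  qed
  have op1: "op_homeomorphism \<Delta> (ball 0 1) ?h ?g"
  proof (rule op_homeomorphismI[OF \<open>open \<Delta>\<close> \<open>connected \<Delta>\<close> open_ball hom z0])
    fix z :: complex and c :: real assume z: "z \<in> \<Delta>" "z \<noteq> 0" "0 \<le> c"
    show "?h z - ?h 0 \<noteq> - (of_real c * (z - 0))"
    proof
      assume "?h z - ?h 0 = - (of_real c * (z - 0))"
      then have "h1 z = - (of_real (c * \<delta>) * z)" using \<delta>(1) h1(3) by (simp add: field_simps)
      then show False using neg[of z "c * \<delta>"] z \<Delta>(1) \<delta>(1) by auto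
    qed
  qed
  have model: "shear b (f (?g (of_real r * cis \<theta>))) / of_real \<delta> = of_real r * cis (c * \<theta>)"
    if r: "0 \<le> r" "r < 1" and *: "\<And>z r. z \<in> ball 0 \<epsilon> \<Longrightarrow> 0 \<le> r \<Longrightarrow> h1 z = of_real r * cis \<theta> \<Longrightarrow>
        shear b (f z) = of_real r * cis (c * \<theta>)" for r \<theta> c
  proof -
    have w: "of_real \<delta> * (of_real r * cis \<theta>) \<in> ball 0 \<delta>"
      using r by (intro scale) (simp add: norm_mult)
    have "shear b (f (?g (of_real r * cis \<theta>))) = of_real (\<delta> * r) * cis (c * \<theta>)"
      using hg[OF w] r \<delta>(1) by (intro *) simp_all
    then show ?thesis using \<delta>(1) by simp
  qed
  show ?thesis
    using op1 z0 op_homeomorphism_shear[OF b(1) \<delta>(1)] b(2) h1(3) up down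
    by (intro exI[of _ \<Delta>] exI[of _ ?h] exI[of _ ?g] exI[of _ "\<lambda>p. shear b p / of_real \<delta>"]
        exI[of _ "\<lambda>p. shear (\<lambda>x. - b x) (of_real \<delta> * p)"] conjI allI impI model) simp_all
qed

section \<open>One side of the critical curve\<close>

lemma sin_ge_margin:
  assumes "0 < m" "m \<le> pi / 2" "m \<le> t" "t \<le> pi - m"
  shows "sin m \<le> sin t"
proof (cases "t \<le> pi / 2")
  case True
  then show ?thesis using assms by (intro sin_monotone_2pi_le) auto
next
  case False
  then have "sin m \<le> sin (pi - t)" using assms by (intro sin_monotone_2pi_le) auto
  then show ?thesis by simp
qed

lemma cos_nonpos_window:
  assumes "pi / 2 \<le> u" "u \<le> 3 * pi / 2"
  shows "cos u \<le> 0"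
proof -
  have "0 \<le> cos (u - pi)" using assms by (intro cos_ge_zero) auto
  then show ?thesis by (simp add: cos_diff)
qed

lemma abs_less_half_pi:
  assumes "0 < cos u" "\<bar>u\<bar> \<le> 3 * pi / 2"
  shows "\<bar>u\<bar> < pi / 2"
  using cos_nonpos_window[of "\<bar>u\<bar>"] assms by (auto simp: not_le[symmetric] cos_abs_real)

lemma DERIV_Re_vertical:
  assumes "(F has_field_derivative F') (at (of_real p + \<i> * of_real c))"
  shows "((\<lambda>c. Re (F (of_real p + \<i> * of_real c))) has_real_derivative - Im F') (at c)"
proof -
  have "((\<lambda>c::real. of_real p + \<i> * of_real c) has_derivative (\<lambda>h. \<i> * of_real h)) (at c)"
    by (auto intro!: derivative_eq_intros)
  from has_derivative_compose[OF this assms[unfolded has_field_derivative_def]]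
  have "((\<lambda>c. Re (F (of_real p + \<i> * of_real c))) has_derivative (\<lambda>h. Re (F' * (\<i> * of_real h))))
      (at c)"
    by (rule bounded_linear.has_derivative[OF bounded_linear_Re])
  then show ?thesis
    unfolding has_field_derivative_def by (rule has_derivative_eq_rhs) (auto simp: fun_eq_iff)
qed

lemma DERIV_Re_radial:
  assumes "(F has_field_derivative F') (at (of_real r * w))"
  shows "((\<lambda>r. Re (F (of_real r * w))) has_real_derivative Re (F' * w)) (at r)"
proof -
  have "((\<lambda>r::real. of_real r * w) has_derivative (\<lambda>h. of_real h * w)) (at r)"
    by (auto intro!: derivative_eq_intros)
  from has_derivative_compose[OF this assms[unfolded has_field_derivative_def]]
  have "((\<lambda>r. Re (F (of_real r * w))) has_derivative (\<lambda>h. Re (F' * (of_real h * w)))) (at r)"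
    by (rule bounded_linear.has_derivative[OF bounded_linear_Re])
  then show ?thesis
    unfolding has_field_derivative_def by (rule has_derivative_eq_rhs) (auto simp: fun_eq_iff
        algebra_simps)
qed

text \<open>The locale describes the side $\mathrm{Im}\,\kappa<0$ of the critical curve, which in
  polar coordinates is \<open>sin t > - \<delta> * \<eta> r\<close>. The other side is the instance
  for \<open>- \<delta>\<close> after complex conjugation. The function \<open>b\<close> is the
  second component along the critical curve as a function of the first one.\<close>

locale half_model =
  fixes n a :: nat and \<delta> \<epsilon> \<epsilon>' :: real and K \<kappa> :: "complex \<Rightarrow> complex" and \<eta> b :: "real \<Rightarrow> real"
  assumes n1: "1 \<le> n" and dcases: "\<delta> = -1 \<or> \<delta> = 0 \<or> \<delta> = 1" and n2: "\<delta> \<noteq> 0 \<Longrightarrow> 2 \<le> n"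
    and a: "real a = real n + \<delta>" "odd a"
    and eps: "0 < \<epsilon>'" "\<epsilon>' \<le> \<epsilon>"
    and eta_mono: "\<And>r s. 0 < r \<Longrightarrow> r \<le> s \<Longrightarrow> s < \<epsilon> \<Longrightarrow> \<eta> r \<le> \<eta> s"
    and eta_pos: "\<And>r. 0 < r \<Longrightarrow> r < \<epsilon> \<Longrightarrow> 0 < \<eta> r"
    and eta_small: "\<And>r. 0 < r \<Longrightarrow> r < \<epsilon> \<Longrightarrow> \<eta> r < sin (pi / (2 * real n))"
    and holK: "K holomorphic_on UNIV" and K0: "K 0 = 0"
    and dK: "\<And>z. z \<noteq> 0 \<Longrightarrow> (K has_field_derivative \<kappa> z * (of_nat n * cis (\<delta> * pi / 2) * z ^ (n - 1)))
        (at z)"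
    and sgn_kappa: "\<And>r t. 0 < r \<Longrightarrow> r < \<epsilon> \<Longrightarrow> - \<delta> * \<eta> r < sin t \<Longrightarrow> Im (\<kappa> (of_real r * cis t)) < 0"
    and sym: "\<And>z. Re (K (- cnj z)) = Re (K z)"
    and b_cont: "continuous_on UNIV b" and b0: "b 0 = 0" and b_even: "\<And>p. b (- p) = b p"
    and b_fold: "\<And>p. 0 < p \<Longrightarrow> p < \<epsilon>' ^ n \<Longrightarrow> \<exists>r. 0 < r \<and> r < \<epsilon> \<and>
        r ^ n * cos (real n * (- \<delta> * arcsin (\<eta> r)) + \<delta> * pi / 2) = p \<and>
        b p = Re (K (of_real r * cis (- \<delta> * arcsin (\<eta> r))))"
begin

text \<open>The argument of cis (\<delta> pi / 2) z^n on the ray of angle t. The sector of index k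
  is where it differs from k pi by at most pi / 2.\<close>

definition phase :: "real \<Rightarrow> real" where "phase t = real n * t + \<delta> * pi / 2"
text \<open>The window of angles is (-pi / 2, 3 pi / 2) because for \<delta> = 1 the side reaches
  below the real axis at both ends.\<close>

definition in_half :: "real \<Rightarrow> real \<Rightarrow> bool" where
  "in_half r t \<longleftrightarrow> 0 < r \<and> r < \<epsilon> \<and> - pi / 2 < t \<and> t < 3 * pi / 2 \<and> - \<delta> * \<eta> r \<le> sin t"
definition Q :: "real \<Rightarrow> real \<Rightarrow> real" where "Q r t = Re (K (of_real r * cis t))"
text \<open>Half the angle between neighbouring rays on which the first component vanishes.\<close>

definition margin :: real where "margin = pi / (2 * real n)"

section \<open>Position of the critical curve among the sectors\<close>

lemma n0: "0 < real n" using n1 by simp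
lemma a1: "1 \<le> a" using a(2) by (cases a) auto
lemma margin: "0 < margin" "margin \<le> pi / 2" "real n * margin = pi / 2"
  using n1 by (auto simp: margin_def field_simps)
lemma eta_margin: "0 < r \<Longrightarrow> r < \<epsilon> \<Longrightarrow> \<eta> r < sin margin"
  using eta_small by (simp add: margin_def)
lemma eta_lt1: "0 < r \<Longrightarrow> r < \<epsilon> \<Longrightarrow> \<eta> r < 1"
  using eta_margin[of r] sin_le_one[of margin] by linarith

text \<open>The reflection z \<mapsto> - cnj z exchanges the sectors of index 0 and a, the two that
  contain the critical curve; a = n + \<delta> is what centres the phase for it. It reduces the last
  sector to the first.\<close>

lemma phase_reflect: "phase (pi - t) = real a * pi - phase t"
  by (simp add: phase_def a(1) algebra_simps)

lemma in_half_reflect: "in_half r t \<Longrightarrow> in_half r (pi - t)"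
  by (auto simp: in_half_def)

lemma Q_reflect: "Q r (pi - t) = Q r t"
proof -
  have "of_real r * cis (pi - t) = - cnj (of_real r * cis t)"
    by (simp add: complex_eq_iff cos_diff sin_diff)
  then show ?thesis using sym[of "of_real r * cis t"] by (simp only: Q_def)
qed

text \<open>The bounds on t are the outermost rays, of phase pi / 2 and a pi - pi / 2. Since \<eta>
  r < sin margin, the critical curve stays outside them.\<close>

lemma strict_interior:
  assumes "(1 - \<delta>) * margin \<le> t" "t \<le> pi - (1 - \<delta>) * margin" "0 < r" "r < \<epsilon>"
  shows "- \<delta> * \<eta> r < sin t"
proof -
  have "\<delta> = 1 \<or> \<delta> = 0 \<or> \<delta> = -1" using dcases by blast
  then show ?thesis
  proof (elim disjE)
    assume "\<delta> = 1"
    then have "0 \<le> sin t" using assms by (intro sin_ge_zero) auto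
    then show ?thesis using \<open>\<delta> = 1\<close> eta_pos[OF assms(3,4)] by simp
  next
    assume d: "\<delta> = 0"
    then have "0 < sin t" using assms margin by (intro sin_gt_zero) auto
    then show ?thesis using d by simp
  next
    assume d: "\<delta> = -1"
    then have "sin margin \<le> sin t" using assms margin by (intro sin_ge_margin) auto
    then show ?thesis using d eta_margin[OF assms(3,4)] by simp
  qed
qed

lemma sector_lower_iff:
  "of_int k * pi - pi / 2 \<le> phase t \<longleftrightarrow> (2 * of_int k - 1 - \<delta>) * margin \<le> t"
proof -
  have "real n * ((2 * of_int k - 1 - \<delta>) * margin) = (2 * of_int k - 1 - \<delta>) * (pi / 2)"
    using margin(3) by (simp add: mult.left_commute)
  then have "(2 * of_int k - 1 - \<delta>) * margin \<le> t \<longleftrightarrow> (2 * of_int k - 1 - \<delta>) * (pi / 2) \<le> real n * t"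
    using n0 by (metis mult_le_cancel_left_pos)
  then show ?thesis by (simp add: phase_def algebra_simps add_divide_distrib)
qed

lemma sector_upper_iff:
  "phase t \<le> of_int k * pi + pi / 2 \<longleftrightarrow> t \<le> (2 * of_int k + 1 - \<delta>) * margin"
proof -
  have "real n * ((2 * of_int k + 1 - \<delta>) * margin) = (2 * of_int k + 1 - \<delta>) * (pi / 2)"
    using margin(3) by (simp add: mult.left_commute)
  then have "t \<le> (2 * of_int k + 1 - \<delta>) * margin \<longleftrightarrow> real n * t \<le> (2 * of_int k + 1 - \<delta>) * (pi / 2)"
    using n0 by (metis mult_le_cancel_left_pos)
  then show ?thesis by (simp add: phase_def algebra_simps add_divide_distrib)
qed

text \<open>In a sector of negative index t is at most -(1 + \<delta>) margin, which is strictly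
  below the critical curve because 0 < \<eta> r < sin margin.\<close>

lemma sector_ge_0:
  assumes "in_half r t" "phase t \<le> of_int k * pi + pi / 2"
  shows "0 \<le> k"
proof (rule ccontr)
  assume "\<not> 0 \<le> k"
  then have k: "real_of_int k \<le> -1" by simp
  have r: "0 < r" "r < \<epsilon>" "- pi / 2 < t" "- \<delta> * \<eta> r \<le> sin t" using assms(1) by (auto simp:
      in_half_def)
  have "t \<le> (2 * of_int k + 1 - \<delta>) * margin" using assms(2) sector_upper_iff by blast
  also have "\<dots> \<le> (- 1 - \<delta>) * margin" using k margin(1) by (intro mult_right_mono) auto
  finally have t: "t \<le> - (1 + \<delta>) * margin" by simp
  have s: "\<delta> \<noteq> -1 \<Longrightarrow> sin t \<le> - sin margin"
  proof -
    assume "\<delta> \<noteq> -1"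
    then have "1 \<le> 1 + \<delta>" using dcases by auto
    then have "1 * margin \<le> (1 + \<delta>) * margin" using margin(1) by (intro mult_right_mono) auto
    then have "t \<le> - margin" using t by (simp add: algebra_simps)
    then have "sin margin \<le> sin (- t)" using r margin by (intro sin_monotone_2pi_le) auto
    then show ?thesis by simp
  qed
  from dcases show False
  proof (elim disjE)
    assume d: "\<delta> = -1"
    then have "0 \<le> sin (- t)" using t r by (intro sin_ge_zero) (auto simp: field_simps)
    then show False using d r eta_pos[OF r(1,2)] by simp
  next
    assume d: "\<delta> = 0"
    then show False using s r eta_margin[OF r(1,2)] eta_pos[OF r(1,2)] by simp
  next
    assume d: "\<delta> = 1"
    then show False using s r eta_margin[OF r(1,2)] by simp
  qed
qed

lemma sector_le_a:
  assumes "in_half r t" "of_int k * pi - pi / 2 \<le> phase t"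
  shows "k \<le> int a"
proof -
  have "phase (pi - t) \<le> of_int (int a - k) * pi + pi / 2"
    using assms(2) by (simp add: phase_reflect algebra_simps)
  from sector_ge_0[OF in_half_reflect[OF assms(1)] this] show ?thesis by simp
qed

text \<open>Sectors other than 0 and a lie between the outermost rays and so avoid the critical
  curve.\<close>

lemma strict_middle:
  assumes "0 < k" "k < int a" "\<bar>phase t - of_int k * pi\<bar> \<le> pi / 2" "0 < r" "r < \<epsilon>"
  shows "- \<delta> * \<eta> r < sin t"
proof (rule strict_interior[OF _ _ assms(4,5)])
  have "of_int 1 * pi - pi / 2 \<le> phase t"
  proof -
    have "1 * pi \<le> of_int k * pi" using assms(1) by (intro mult_right_mono) auto
    then show ?thesis using assms(3) unfolding abs_le_iff by (simp only: of_int_1) linarith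
  qed
  then show "(1 - \<delta>) * margin \<le> t" using sector_lower_iff[of 1 t] by simp
  have "of_int 1 * pi - pi / 2 \<le> phase (pi - t)"
  proof -
    have "1 * pi \<le> (real a - of_int k) * pi" using assms(2) by (intro mult_right_mono) auto
    then show ?thesis using assms(3) unfolding phase_reflect abs_le_iff
      by (simp only: of_int_1 left_diff_distrib) linarith
  qed
  then show "t \<le> pi - (1 - \<delta>) * margin" using sector_lower_iff[of 1 "pi - t"] by simp
qed

lemma sector_exists:
  obtains k :: int where "\<bar>phase t - of_int k * pi\<bar> \<le> pi / 2"
proof -
  have "\<bar>of_int (round (phase t / pi)) - phase t / pi\<bar> \<le> 1 / 2" by (rule of_int_round_abs_le)
  then have "\<bar>of_int (round (phase t / pi)) - phase t / pi\<bar> * pi \<le> 1 / 2 * pi" by (intro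
      mult_right_mono) auto
  moreover have "(of_int (round (phase t / pi)) - phase t / pi) * pi = of_int (round (phase t / pi))
      * pi - phase t"
    by (simp add: algebra_simps)
  then have "\<bar>phase t - of_int (round (phase t / pi)) * pi\<bar> = \<bar>of_int (round (phase t / pi)) - phase
      t / pi\<bar> * pi"
    by (metis abs_minus_commute abs_mult abs_of_pos pi_gt_zero)
  ultimately show ?thesis by (intro that[of "round (phase t / pi)"]) linarith
qed

lemma cos_sector: "cos x = cos (x - of_int k * pi) * cos (of_int k * pi)"
  "sin x = sin (x - of_int k * pi) * cos (of_int k * pi)" "(cos (of_int k * pi))\<^sup>2 = (1::real)" for
      x :: real
proof -
  have s: "sin (of_int k * pi) = 0" by (simp add: sin_zero_iff_int2)
  show "cos x = cos (x - of_int k * pi) * cos (of_int k * pi)" "sin x = sin (x - of_int k * pi) *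
      cos (of_int k * pi)"
    using cos_add[of "x - of_int k * pi" "of_int k * pi"] sin_add[of "x - of_int k * pi" "of_int k *
        pi"] s by simp_all
  show "(cos (of_int k * pi))\<^sup>2 = (1::real)" using sin_cos_squared_add[of "of_int k * pi"] s by simp
qed

lemma sector_strict:
  assumes "\<bar>x - of_int k * pi\<bar> \<le> pi / 2" "cos x \<noteq> 0"
  shows "\<bar>x - of_int k * pi\<bar> < pi / 2"
proof (rule ccontr)
  assume "\<not> ?thesis"
  then have "\<bar>x - of_int k * pi\<bar> = pi / 2" using assms by simp
  then have "cos (x - of_int k * pi) = 0" by (metis cos_abs_real cos_pi_half)
  then show False using cos_sector(1)[of x k] assms(2) by simp
qed

lemma ray_interior:
  assumes "in_half r t" "cos (phase t) = 0"
  shows "(1 - \<delta>) * margin \<le> t" "t \<le> pi - (1 - \<delta>) * margin"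
proof -
  have ge: "of_int 1 * pi - pi / 2 \<le> phase s" if o: "in_half r s" and c: "cos (phase s) = 0" for s
  proof -
    obtain k where k: "\<bar>phase s - of_int k * pi\<bar> \<le> pi / 2" using sector_exists by blast
    have "phase s \<le> of_int k * pi + pi / 2" using k by linarith
    then have "0 \<le> k" by (rule sector_ge_0[OF o])
    have "\<bar>phase s - of_int k * pi\<bar> = pi / 2"
    proof (rule ccontr)
      assume "\<bar>phase s - of_int k * pi\<bar> \<noteq> pi / 2"
      then have "0 < cos (phase s - of_int k * pi)" using k by (intro cos_gt_zero_pi) linarith+
      then show False using cos_sector(1)[of "phase s" k] cos_sector(3)[of k] c by auto
    qed
    then consider "phase s = of_int k * pi + pi / 2" | "phase s = of_int k * pi - pi / 2" by (auto
        simp: abs_if split: if_splits)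
    then show ?thesis
    proof cases
      case 1
      have "0 * pi \<le> of_int k * pi" using \<open>0 \<le> k\<close> by (intro mult_right_mono) auto
      then show ?thesis using 1 by simp
    next
      case 2
      then have "phase s = of_int (k - 1) * pi + pi / 2" by (simp add: algebra_simps)
      then have "0 \<le> k - 1" using sector_ge_0[OF o, of "k - 1"] by simp
      then have "1 * pi \<le> of_int k * pi" by (intro mult_right_mono) auto
      then show ?thesis using 2 unfolding of_int_1 by linarith
    qed
  qed
  show "(1 - \<delta>) * margin \<le> t" using ge[OF assms] sector_lower_iff[of 1 t] by simp
  have "cos (phase (pi - t)) = 0" using assms(2) by (simp add: phase_reflect cos_diff sin_npi)
  then show "t \<le> pi - (1 - \<delta>) * margin"
    using ge[OF in_half_reflect[OF assms(1)]] sector_lower_iff[of 1 "pi - t"] by simp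
qed

text \<open>On a ray with cos (phase t) = 0 the differential of cis (\<delta> pi / 2) z^n is i sin
  (phase t) n r^(n - 1) dr. So Re K changes at the rate -Im \<kappa> times a factor with the sign of
  sin (phase t).\<close>

lemma ray_increasing:
  assumes "in_half r t" "cos (phase t) = 0" "0 \<le> r1" "r1 < r2" "r2 < \<epsilon>"
  shows "sin (phase t) * Q r1 t < sin (phase t) * Q r2 t"
proof (rule DERIV_pos_imp_increasing_open[OF assms(4)])
  have "continuous_on UNIV K" by (rule holomorphic_on_imp_continuous_on[OF holK])
  then have "continuous_on {r1..r2} (\<lambda>r. K (of_real r * cis t))"
    by (rule continuous_on_compose2) (auto intro!: continuous_intros)
  then show "continuous_on {r1..r2} (\<lambda>r. sin (phase t) * Q r t)"
    unfolding Q_def by (intro continuous_intros)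
  fix s assume s: "r1 < s" "s < r2"
  then have s': "0 < s" "s < \<epsilon>" using assms by auto
  have z: "of_real s * cis t \<noteq> 0" using s' by simp
  define F' where "F' = \<kappa> (of_real s * cis t) * (of_nat n * cis (\<delta> * pi / 2) * (of_real s * cis t) ^
      (n - 1))"
  have "((\<lambda>s. sin (phase t) * Q s t) has_real_derivative sin (phase t) * Re (F' * cis t)) (at s)"
    unfolding Q_def F'_def by (intro DERIV_cmult DERIV_Re_radial dK z)
  moreover have "F' * cis t = \<kappa> (of_real s * cis t) * (\<i> * of_real (real n * s ^ (n - 1) * sin
      (phase t)))"
  proof -
    have "cis (\<delta> * pi / 2) * (cis t ^ (n - 1) * cis t) = cis (phase t)"
      using n1 unfolding Complex.DeMoivre cis_mult by (intro arg_cong[of _ _ cis]) (simp add: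
          phase_def of_nat_diff algebra_simps)
    also have "\<dots> = \<i> * of_real (sin (phase t))" using assms(2) by (simp add: complex_eq_iff)
    finally show ?thesis
      unfolding F'_def power_mult_distrib by (simp add: mult_ac)
  qed
  then have "Re (F' * cis t) = - (Im (\<kappa> (of_real s * cis t)) * (real n * s ^ (n - 1) * sin (phase
      t)))"
    by simp
  moreover have "(sin (phase t))\<^sup>2 = 1" using sin_cos_squared_add[of "phase t"] assms(2) by simp
  ultimately have "((\<lambda>s. sin (phase t) * Q s t) has_real_derivative - (Im (\<kappa> (of_real s * cis t)) *
      (real n * s ^ (n - 1)))) (at s)"
    by (simp add: power2_eq_square mult_ac) (metis mult.left_commute mult.right_neutral)
  moreover have "Im (\<kappa> (of_real s * cis t)) < 0"
    using strict_interior[OF ray_interior[OF assms(1,2)] s'] sgn_kappa[OF s'] by blast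
  then have "0 < - (Im (\<kappa> (of_real s * cis t)) * (real n * s ^ (n - 1)))"
    using n0 s' by (simp add: mult_neg_pos)
  ultimately show "\<exists>y. ((\<lambda>s. sin (phase t) * Q s t) has_real_derivative y) (at s) \<and> 0 < y" by blast
qed

text \<open>Comparison with r = 0, where K vanishes. On these rays the sheared map thus points in
  the direction of its phase, which anchors the lifted argument.\<close>

lemma ray_sign:
  assumes "in_half r t" "cos (phase t) = 0"
  shows "0 < sin (phase t) * Q r t"
  using ray_increasing[OF assms order_refl, of r] assms(1) K0 by (simp add: in_half_def Q_def)

end

section \<open>Monotonicity along level curves, and the lifted argument\<close>

context half_model
begin

text \<open>The branch of the inverse of $z\mapsto\mathrm{cis}(\delta\pi/2)z^n$ in the sector of
  index \<open>k\<close>.\<close>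

definition sector_sign :: "int \<Rightarrow> real" where "sector_sign k = cos (of_int k * pi)"
definition sector_root :: "int \<Rightarrow> complex \<Rightarrow> complex" where
  "sector_root k v = exp ((Ln (of_real (sector_sign k) * v) + \<i> * of_real (of_int k * pi - \<delta> * pi /
      2)) / of_nat n)"

lemma sector_sign_sq: "sector_sign k * sector_sign k = 1"
  using cos_sector(3)[of k] by (simp add: sector_sign_def power2_eq_square)

lemma cis_int_pi: "cis (of_int k * pi) = of_real (sector_sign k)"
proof -
  have "sin (of_int k * pi) = 0" by (simp add: sin_zero_iff_int2)
  then show ?thesis by (simp add: complex_eq_iff sector_sign_def)
qed

lemma sector_sign_cis: "of_real (sector_sign k) * cis x = cis (x - of_int k * pi)"
proof -
  have "cis (- (of_int k * pi)) = of_real (sector_sign k)"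
    using arg_cong[OF cis_int_pi[of k], of cnj] by (simp add: cis_cnj)
  then show ?thesis using cis_mult[of "- (of_int k * pi)" x] by (simp add: algebra_simps)
qed

lemma sector_root_polar:
  assumes "0 < r" "\<bar>phase t - of_int k * pi\<bar> < pi"
  shows "sector_root k (of_real (r ^ n) * cis (phase t)) = of_real r * cis t"
proof -
  have "of_real (sector_sign k) * (of_real (r ^ n) * cis (phase t)) = of_real (r ^ n) * cis (phase t
      - of_int k * pi)"
    using sector_sign_cis[of k "phase t"] by (simp add: mult.left_commute)
  also have "\<dots> = exp (of_real (real n * ln r) + \<i> * of_real (phase t - of_int k * pi))"
  proof -
    have "exp (real n * ln r) = r ^ n" using assms(1) by (simp add: exp_of_nat_mult)
    then have "of_real (r ^ n) = exp (complex_of_real (real n * ln r))" by (metis exp_of_real)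
    then show ?thesis by (simp add: exp_add cis_conv_exp)
  qed
  finally have "Ln (of_real (sector_sign k) * (of_real (r ^ n) * cis (phase t))) = of_real (real n *
      ln r) + \<i> * of_real (phase t - of_int k * pi)"
    using assms(2) by (simp add: Ln_exp abs_less_iff)
  then have "sector_root k (of_real (r ^ n) * cis (phase t)) = exp ((of_real (real n * ln r) + \<i> *
      of_real (phase t - of_int k * pi) + \<i> * of_real (of_int k * pi - \<delta> * pi / 2)) / of_nat n)"
    by (simp add: sector_root_def)
  also have "of_real (real n * ln r) + \<i> * of_real (phase t - of_int k * pi) + \<i> * of_real (of_int k
      * pi - \<delta> * pi / 2) =
      of_nat n * (of_real (ln r) + \<i> * of_real t)"
    by (simp add: phase_def complex_eq_iff)
  also have "\<dots> / of_nat n = of_real (ln r) + \<i> * of_real t" using n1 by simp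
  also have "exp (of_real (ln r) + \<i> * of_real t) = of_real r * cis t"
  proof -
    have "exp (complex_of_real (ln r)) = of_real r" by (metis exp_of_real exp_ln assms(1))
    then show ?thesis by (simp add: exp_add cis_conv_exp)
  qed
  finally show ?thesis .
qed

text \<open>In the coordinate v = cis (\<delta> pi / 2) z^n the assumption on the derivative of K
  becomes dK = \<kappa> dv.\<close>

lemma DERIV_K_sector_root:
  assumes "0 < Re (of_real (sector_sign k) * v)"
  shows "((\<lambda>v. K (sector_root k v)) has_field_derivative \<kappa> (sector_root k v)) (at v)"
proof -
  have v: "v \<noteq> 0" "of_real (sector_sign k) * v \<notin> \<real>\<^sub>\<le>\<^sub>0" using assms by (auto simp:
      complex_nonpos_Reals_iff)
  have s0: "complex_of_real (sector_sign k) \<noteq> 0" using sector_sign_sq[of k] by auto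
  have D: "(sector_root k has_field_derivative sector_root k v * ((inverse (of_real (sector_sign k)
      * v) * of_real (sector_sign k)) / of_nat n)) (at v)"
  proof -
    have "((\<lambda>v. (Ln (of_real (sector_sign k) * v) + \<i> * of_real (of_int k * pi - \<delta> * pi / 2)) /
        of_nat n) has_field_derivative
        (inverse (of_real (sector_sign k) * v) * of_real (sector_sign k)) / of_nat n) (at v)"
      by (rule derivative_eq_intros refl v(2))+ (use n1 in simp_all)
    from DERIV_chain2[OF DERIV_exp this] show ?thesis by (simp only: sector_root_def[abs_def])
  qed
  have nz: "sector_root k v \<noteq> 0" by (simp add: sector_root_def)
  have "cis (\<delta> * pi / 2) * sector_root k v ^ n = v"
  proof -
    have "sector_root k v ^ n = exp (Ln (of_real (sector_sign k) * v) + \<i> * of_real (of_int k * pi -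
        \<delta> * pi / 2))"
      unfolding sector_root_def using n1 by (simp add: exp_of_nat_mult[symmetric])
    also have "\<dots> = of_real (sector_sign k) * v * cis (of_int k * pi - \<delta> * pi / 2)"
      using v s0 by (simp add: exp_add cis_conv_exp)
    finally have "cis (\<delta> * pi / 2) * sector_root k v ^ n = of_real (sector_sign k) * v * (cis (\<delta> *
        pi / 2) * cis (of_int k * pi - \<delta> * pi / 2))"
      by simp
    also have "cis (\<delta> * pi / 2) * cis (of_int k * pi - \<delta> * pi / 2) = of_real (sector_sign k)"
      unfolding cis_mult using cis_int_pi by simp
    also have "of_real (sector_sign k) * v * of_real (sector_sign k) = v"
      using sector_sign_sq[of k] by (simp add: mult_ac flip: of_real_mult mult.assoc)
    finally show ?thesis .
  qed
  moreover have "sector_root k v ^ (n - 1) * sector_root k v = sector_root k v ^ n"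
    using n1 by (metis mult.commute power_eq_if not_one_le_zero)
  moreover have "(\<kappa> (sector_root k v) * (of_nat n * cis (\<delta> * pi / 2) * sector_root k v ^ (n - 1))) *
      (sector_root k v * ((inverse (of_real (sector_sign k) * v) * of_real (sector_sign k)) / of_nat
      n))
     = \<kappa> (sector_root k v) * (cis (\<delta> * pi / 2) * (sector_root k v ^ (n - 1) * sector_root k v)) / v"
    using n1 v s0 by (simp add: field_simps)
  ultimately have "(\<kappa> (sector_root k v) * (of_nat n * cis (\<delta> * pi / 2) * sector_root k v ^ (n - 1)))
      * (sector_root k v * ((inverse (of_real (sector_sign k) * v) * of_real (sector_sign k)) /
      of_nat n))
     = \<kappa> (sector_root k v)" using v by simp
  then show ?thesis using DERIV_chain2[OF dK[OF nz] D] by simp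
qed

text \<open>A level curve of the first component is a vertical line in the v-plane, and upward along
  it Re K has the derivative -Im \<kappa>.\<close>

lemma level_core:
  assumes "0 < sector_sign k * p" "c1 < c2"
    and "\<And>c. c1 < c \<Longrightarrow> c < c2 \<Longrightarrow> Im (\<kappa> (sector_root k (of_real p + \<i> * of_real c))) < 0"
  shows "Re (K (sector_root k (of_real p + \<i> * of_real c1))) < Re (K (sector_root k (of_real p + \<i> *
      of_real c2)))"
proof -
  have D: "((\<lambda>c. Re (K (sector_root k (of_real p + \<i> * of_real c)))) has_real_derivative - Im (\<kappa>
      (sector_root k (of_real p + \<i> * of_real c)))) (at c)" for c
    using assms(1) by (intro DERIV_Re_vertical[where F = "\<lambda>v. K (sector_root k v)"]
        DERIV_K_sector_root) simp
  show ?thesis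
  proof (rule DERIV_pos_imp_increasing_open[OF assms(2)])
    show "\<exists>y. ((\<lambda>c. Re (K (sector_root k (of_real p + \<i> * of_real c)))) has_real_derivative y) (at
        c) \<and> 0 < y"
      if "c1 < c" "c < c2" for c using D[of c] assms(3)[OF that] by (intro exI) auto
    show "continuous_on {c1..c2} (\<lambda>c. Re (K (sector_root k (of_real p + \<i> * of_real c))))"
      using D by (intro continuous_at_imp_continuous_on ballI DERIV_isCont)
  qed
qed

text \<open>Along the vertical segment the real part p is fixed, and its sign keeps v in the
  half-plane of the sector. Moreover |v|^2 = p^2 + c^2 does not exceed its larger value at the two
  ends, so the segment also stays inside radius \<epsilon>.\<close>

lemma segment_point:
  assumes k: "\<bar>phase t1 - of_int k * pi\<bar> < pi / 2" "\<bar>phase t2 - of_int k * pi\<bar> < pi / 2"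
    and r: "0 < r1" "r1 < \<epsilon>" "0 < r2" "r2 < \<epsilon>"
    and p: "r1 ^ n * cos (phase t1) = p" "r2 ^ n * cos (phase t2) = p"
    and c: "r1 ^ n * sin (phase t1) < c" "c < r2 ^ n * sin (phase t2)"
  obtains r t where "0 < r" "r < \<epsilon>" "\<bar>phase t - of_int k * pi\<bar> < pi / 2" "r ^ n * cos (phase t) = p"
      "r ^ n * sin (phase t) = c"
    "sector_root k (of_real p + \<i> * of_real c) = of_real r * cis t"
proof -
  define v where "v = of_real p + \<i> * of_real c"
  have "0 < cos (phase t1 - of_int k * pi)" using k(1) by (intro cos_gt_zero_pi) linarith+
  then have "0 < sector_sign k * cos (phase t1)"
    using cos_sector(1)[of "phase t1" k] sector_sign_sq[of k] by (simp add: sector_sign_def mult_ac)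
  then have sp: "0 < sector_sign k * p" using r(1) unfolding p(1)[symmetric] by (metis
      mult.left_commute zero_less_mult_iff zero_less_power)
  then have v0: "v \<noteq> 0" "of_real (sector_sign k) * v \<noteq> 0" "0 < Re (of_real (sector_sign k) * v)" by
      (auto simp: v_def complex_eq_iff)
  define x where "x = Arg (of_real (sector_sign k) * v) + of_int k * pi"
  define t where "t = (x - \<delta> * pi / 2) / real n"
  define r where "r = root n (norm v)"
  have xt: "phase t = x" using n0 by (simp add: t_def phase_def)
  have rn: "r ^ n = norm v" "0 < r" using n1 v0 by (simp_all add: r_def)
  have A: "\<bar>Arg (of_real (sector_sign k) * v)\<bar> < pi / 2" using v0(3) Arg_Re_pos by blast
  have "norm (of_real (sector_sign k) * v) = norm v"
    using sector_sign_sq[of k] by (metis abs_mult_self_eq abs_of_nonneg norm_mult norm_of_real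
        mult_cancel_right1 abs_ge_zero real_sqrt_abs2 real_sqrt_one)
  then have "of_real (sector_sign k) * v = of_real (norm v) * cis (Arg (of_real (sector_sign k) *
      v))"
    using rcis_cmod_Arg[of "of_real (sector_sign k) * v"] by (simp add: rcis_def)
  then have "of_real (sector_sign k) * (of_real (sector_sign k) * v) = of_real (norm v) * (of_real
      (sector_sign k) * cis (Arg (of_real (sector_sign k) * v)))"
    by (simp add: mult.left_commute)
  also have "of_real (sector_sign k) * (of_real (sector_sign k) * v) = v"
    using sector_sign_sq[of k] by (simp flip: mult.assoc of_real_mult)
  also have "of_real (sector_sign k) * cis (Arg (of_real (sector_sign k) * v)) = cis x"
    using cis_int_pi[of k] by (simp add: x_def flip: cis_mult)
  finally have v: "v = of_real (r ^ n) * cis (phase t)" by (simp add: rn xt)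
  have re: "r ^ n * cos (phase t) = p" "r ^ n * sin (phase t) = c"
    using arg_cong[OF v, of Re] arg_cong[OF v, of Im] by (simp_all add: v_def)
  have sec: "\<bar>phase t - of_int k * pi\<bar> < pi / 2" using A by (simp add: xt x_def)
  have "r < \<epsilon>"
  proof -
    have sq: "(s ^ n)\<^sup>2 = (s ^ n * cos y)\<^sup>2 + (s ^ n * sin y)\<^sup>2" for s y :: real
      by (simp add: power_mult_distrib flip: distrib_left)
    have "c\<^sup>2 \<le> (r1 ^ n * sin (phase t1))\<^sup>2 \<or> c\<^sup>2 \<le> (r2 ^ n * sin (phase t2))\<^sup>2"
      using c by (cases "0 \<le> c") (auto simp: abs_le_square_iff[symmetric])
    then have "(r ^ n)\<^sup>2 \<le> (r1 ^ n)\<^sup>2 \<or> (r ^ n)\<^sup>2 \<le> (r2 ^ n)\<^sup>2"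
      unfolding sq[of r "phase t"] sq[of r1 "phase t1"] sq[of r2 "phase t2"] re p by simp
    then have "r ^ n \<le> r1 ^ n \<or> r ^ n \<le> r2 ^ n" using r rn by (auto simp: power2_le_iff_abs_le)
    moreover have "r \<le> s" if "r ^ n \<le> s ^ n" "0 < s" for s
      using power_mono_iff[of r s n] that rn(2) n1 by simp
    ultimately have "r \<le> r1 \<or> r \<le> r2" using r by blast
    then show ?thesis using r by auto
  qed
  moreover have "sector_root k (of_real p + \<i> * of_real c) = of_real r * cis t"
  proof -
    have "\<bar>phase t - of_int k * pi\<bar> < pi" using sec pi_gt_zero by linarith
    from sector_root_polar[OF rn(2) this] v show ?thesis by (simp only: v_def)
  qed
  ultimately show thesis using that rn(2) sec re by blast
qed

text \<open>In the first sector a level curve of the first component meets the critical curve at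
  most once.\<close>

lemma crossing_0:
  assumes om1: "in_half r1 t1" and k: "\<bar>phase t1\<bar> < pi / 2" "\<bar>phase t\<bar> < pi / 2" and r: "0 < r" "r <
      \<epsilon>"
    and p: "r1 ^ n * cos (phase t1) = r ^ n * cos (phase t)" and c: "r1 ^ n * sin (phase t1) < r ^ n
        * sin (phase t)"
  shows "- \<delta> * \<eta> r < sin t"
proof -
  have r1: "0 < r1" "r1 < \<epsilon>" "- pi / 2 < t1" "- \<delta> * \<eta> r1 \<le> sin t1" using om1 by (auto simp:
      in_half_def)
  have cp: "0 < cos (phase t1)" "0 < cos (phase t)" using k by (auto intro!: cos_gt_zero_pi)
  have "tan (phase t1) = (r1 ^ n * sin (phase t1)) / (r1 ^ n * cos (phase t1))" using r1 by (simp
      add: tan_def)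
  also have "\<dots> < (r ^ n * sin (phase t)) / (r1 ^ n * cos (phase t1))"
    using c r1 cp by (intro divide_strict_right_mono mult_pos_pos) auto
  also have "\<dots> = tan (phase t)" unfolding p using r by (simp add: tan_def)
  finally have "phase t1 < phase t" using k by (subst tan_monotone') auto
  then have t: "t1 < t" using n0 by (simp add: phase_def)
  from dcases show ?thesis
  proof (elim disjE)
    assume d: "\<delta> = 0"
    have "\<not> t1 < 0" using r1 d sin_gt_zero[of "- t1"] by auto
    moreover have "phase t = real n * t" unfolding phase_def by (simp add: d)
    then have "real n * t < real n * margin" unfolding margin(3) using k(2) by linarith
    then have "t < margin" using n0 by simp
    then have "t < pi" using margin(2) pi_gt_zero by linarith
    ultimately show ?thesis using t d by (auto intro!: sin_gt_zero)
  next
    assume d: "\<delta> = 1"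
    have "\<not> t1 \<le> - margin"
    proof
      assume "t1 \<le> - margin"
      then have "sin margin \<le> sin (- t1)" using r1 margin by (intro sin_monotone_2pi_le) auto
      then show False using r1 d eta_margin[OF r1(1,2)] by simp
    qed
    have xd: "phase s = real n * s + pi / 2" for s unfolding phase_def by (simp add: d)
    have "real n * t < 0" using k(2) unfolding xd by linarith
    then have tneg: "t < 0" using n0 by (simp add: mult_less_0_iff)
    have "real n * (- t) < real n * (- t1)" "real n * (- t1) < real n * margin"
      using t \<open>\<not> t1 \<le> - margin\<close> n0 by (intro mult_strict_left_mono; simp)+
    then have lt: "sin (real n * (- t)) < sin (real n * (- t1))"
      unfolding margin(3) using \<open>real n * t < 0\<close> pi_gt_zero by (intro sin_monotone_2pi) linarith+
    have cs: "cos (phase s) = sin (real n * (- s))" for s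
      unfolding xd by (simp add: cos_add)
    have pos: "0 < sin (real n * (- t))" using cp(2) cs by simp
    \<comment> \<open>The level r^n sin (- n t) is fixed, and the sine falls as t rises towards 0;
      so r, and with it \<eta> r, grows along the level curve, and so does sin t.\<close>
    have "r1 ^ n < r ^ n"
    proof (rule ccontr)
      assume "\<not> ?thesis"
      then have "r ^ n * sin (real n * (- t)) \<le> r1 ^ n * sin (real n * (- t))" using pos by (intro
          mult_right_mono) auto
      also have "\<dots> < r1 ^ n * sin (real n * (- t1))" using lt r1 by simp
      finally show False using p cs by simp
    qed
    then have "r1 < r" using r by (meson less_imp_le power_less_imp_less_base)
    then have "\<eta> r1 \<le> \<eta> r" using eta_mono r1 r by simp
    moreover have "sin t1 < sin t" using t tneg r1 by (intro sin_monotone_2pi) auto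
    ultimately show ?thesis using r1 d by simp
  next
    assume d: "\<delta> = -1"
    have xd: "phase s = real n * s - pi / 2" for s unfolding phase_def by (simp add: d)
    have "real n * t < 2 * (real n * margin)" using k(2) unfolding xd margin(3) by linarith
    then have "real n * t < real n * (2 * margin)" by simp
    then have "t < 2 * margin" using n0 by simp
    moreover have "2 * margin \<le> pi / 2"
      using n2 d n1 by (simp add: margin_def field_simps)
    ultimately have t2: "t < pi / 2" by simp
    \<comment> \<open>From the margin on, sin t exceeds \<eta> r anyway. Before it, r^n sin (n t) is
      fixed with increasing sine, so r and \<eta> r shrink while sin t grows.\<close>
    show ?thesis
    proof (cases "margin \<le> t")
      case True
      then have "sin margin \<le> sin t" using margin t2 by (intro sin_monotone_2pi_le) auto
      then show ?thesis using d eta_margin[OF r] by simp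
    next
      case False
      have t1pos: "0 < real n * t1" using k(1) unfolding xd by linarith
      have "real n * t1 < real n * t" "real n * t < real n * margin"
        using t False n0 by (intro mult_strict_left_mono; simp)+
      then have lt: "sin (real n * t1) < sin (real n * t)"
        using t1pos unfolding margin(3) by (intro sin_monotone_2pi) auto
      have cs: "cos (phase s) = sin (real n * s)" for s
        unfolding xd by (simp add: cos_diff)
      have pos: "0 < sin (real n * t1)" using cp(1) cs by simp
      have "r ^ n < r1 ^ n"
      proof (rule ccontr)
        assume "\<not> ?thesis"
        then have "r1 ^ n * sin (real n * t1) \<le> r ^ n * sin (real n * t1)" using pos by (intro
            mult_right_mono) auto
        also have "\<dots> < r ^ n * sin (real n * t)" using lt r by simp
        finally show False using p cs by simp
      qed
      then have "r < r1" using r1 by (meson less_imp_le power_less_imp_less_base)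
      then have "\<eta> r \<le> \<eta> r1" using eta_mono r1 r by simp
      moreover have "sin t1 < sin t" using t t2 r1 by (intro sin_monotone_2pi) auto
      ultimately show ?thesis using r1 d by simp
    qed
  qed
qed

text \<open>The lower end may lie on the critical curve; \<open>strict\<close> is demanded only
  above it, which is enough for the sign of the derivative inside the segment.\<close>

lemma level_increasing:
  assumes k: "\<bar>phase t1 - of_int k * pi\<bar> < pi / 2" "\<bar>phase t2 - of_int k * pi\<bar> < pi / 2"
    and r: "0 < r1" "r1 < \<epsilon>" "0 < r2" "r2 < \<epsilon>"
    and p: "r1 ^ n * cos (phase t1) = r2 ^ n * cos (phase t2)"
    and c: "r1 ^ n * sin (phase t1) < r2 ^ n * sin (phase t2)"
    and strict: "\<And>r t. \<lbrakk>0 < r; r < \<epsilon>; \<bar>phase t - of_int k * pi\<bar> < pi / 2; r1 ^ n * cos (phase t1) =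
        r ^ n * cos (phase t);
       r1 ^ n * sin (phase t1) < r ^ n * sin (phase t)\<rbrakk> \<Longrightarrow> - \<delta> * \<eta> r < sin t"
  shows "Q r1 t1 < Q r2 t2"
proof -
  define p where "p = r1 ^ n * cos (phase t1)"
  have v: "of_real p + \<i> * of_real (s ^ n * sin (phase t)) = of_real (s ^ n) * cis (phase t)" if "s
      ^ n * cos (phase t) = p" for s t
    using that by (simp add: complex_eq_iff)
  have "0 < cos (phase t1 - of_int k * pi)" using k(1) by (intro cos_gt_zero_pi) linarith+
  then have "0 < sector_sign k * cos (phase t1)"
    using cos_sector(1)[of "phase t1" k] sector_sign_sq[of k] by (simp add: sector_sign_def mult_ac)
  then have sp: "0 < sector_sign k * p" using r(1) unfolding p_def by (metis mult.left_commute
      zero_less_mult_iff zero_less_power)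
  have "Re (K (sector_root k (of_real p + \<i> * of_real (r1 ^ n * sin (phase t1))))) < Re (K
      (sector_root k (of_real p + \<i> * of_real (r2 ^ n * sin (phase t2)))))"
  proof (rule level_core[OF sp c])
    fix c assume c: "r1 ^ n * sin (phase t1) < c" "c < r2 ^ n * sin (phase t2)"
    obtain s t where s: "0 < s" "s < \<epsilon>" "\<bar>phase t - of_int k * pi\<bar> < pi / 2" "s ^ n * cos (phase t)
        = p" "s ^ n * sin (phase t) = c"
      "sector_root k (of_real p + \<i> * of_real c) = of_real s * cis t"
      using segment_point[OF k r p_def[symmetric] _ c] p by (auto simp: p_def)
    have "- \<delta> * \<eta> s < sin t" using s c by (intro strict) (auto simp: p_def)
    then show "Im (\<kappa> (sector_root k (of_real p + \<i> * of_real c))) < 0"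
      unfolding s(6) by (rule sgn_kappa[OF s(1,2)])
  qed
  moreover have "\<bar>phase t1 - of_int k * pi\<bar> < pi" "\<bar>phase t2 - of_int k * pi\<bar> < pi"
    using k pi_gt_zero by linarith+
  then have "sector_root k (of_real p + \<i> * of_real (r1 ^ n * sin (phase t1))) = of_real r1 * cis
      t1"
    "sector_root k (of_real p + \<i> * of_real (r2 ^ n * sin (phase t2))) = of_real r2 * cis t2"
    unfolding v[of r1 t1, OF p_def[symmetric]] v[of r2 t2, OF p[symmetric, folded p_def]]
    by (simp_all only: sector_root_polar[OF r(1)] sector_root_polar[OF r(3)])
  ultimately show ?thesis by (simp only: Q_def)
qed

lemma level_increasing_0:
  assumes "in_half r1 t1" "\<bar>phase t1\<bar> < pi / 2" "\<bar>phase t2\<bar> < pi / 2" "0 < r2" "r2 < \<epsilon>"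
    and "r1 ^ n * cos (phase t1) = r2 ^ n * cos (phase t2)" "r1 ^ n * sin (phase t1) < r2 ^ n * sin
        (phase t2)"
  shows "Q r1 t1 < Q r2 t2" "- \<delta> * \<eta> r2 < sin t2"
proof -
  show "Q r1 t1 < Q r2 t2"
    using assms crossing_0[OF assms(1,2)] by (intro level_increasing[of t1 0]) (auto simp:
        in_half_def)
  show "- \<delta> * \<eta> r2 < sin t2" using crossing_0[OF assms] .
qed

text \<open>In sector 0 a level curve that starts in the half does not cross back by
  \<open>crossing_0\<close>, middle sectors do not meet the critical curve, and sector a is the
  reflection of sector 0.\<close>

lemma level_increasing_in_half:
  assumes "in_half r1 t1" "in_half r2 t2"
    and k: "\<bar>phase t1 - of_int k * pi\<bar> < pi / 2" "\<bar>phase t2 - of_int k * pi\<bar> < pi / 2"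
    and p: "r1 ^ n * cos (phase t1) = r2 ^ n * cos (phase t2)"
    and c: "r1 ^ n * sin (phase t1) < r2 ^ n * sin (phase t2)"
  shows "Q r1 t1 < Q r2 t2"
proof -
  have r: "0 < r1" "r1 < \<epsilon>" "0 < r2" "r2 < \<epsilon>" using assms(1,2) by (auto simp: in_half_def)
  have "phase t1 \<le> of_int k * pi + pi / 2" "of_int k * pi - pi / 2 \<le> phase t1" using k(1) by
      linarith+
  then have "0 \<le> k" "k \<le> int a" using sector_ge_0[OF assms(1)] sector_le_a[OF assms(1)] by blast+
  then consider "k = 0" | "0 < k" "k < int a" | "k = int a" by linarith
  then show ?thesis
  proof cases
    case 1
    then show ?thesis using level_increasing_0[OF assms(1) _ _ r(3,4) p c] k by simp
  next
    case 2
    show ?thesis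
      by (rule level_increasing[OF k r p c]) (use strict_middle[OF 2] in auto)
  next
    case 3
    have C: "cos (phase (pi - t)) = - cos (phase t)" "sin (phase (pi - t)) = sin (phase t)" for t
      using a(2) by (simp_all add: phase_reflect cos_diff sin_diff)
    have "Q r1 (pi - t1) < Q r2 (pi - t2)"
    proof (rule level_increasing_0(1)[OF in_half_reflect[OF assms(1)] _ _ r(3,4)])
      show "\<bar>phase (pi - t1)\<bar> < pi / 2" "\<bar>phase (pi - t2)\<bar> < pi / 2"
        using k 3 by (simp_all add: phase_reflect abs_minus_commute)
    qed (simp_all add: C p c)
    then show ?thesis by (simp add: Q_reflect)
  qed
qed

text \<open>\<open>b_fold\<close> supplies the critical point with the same first component. If it
  lies lower on the level curve, Q exceeds the value b there; it cannot lie higher, since by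
  \<open>crossing_0\<close> it would then be off the critical curve.\<close>

lemma fold_0:
  assumes o: "in_half r t" "r < \<epsilon>'" and x: "\<bar>phase t\<bar> \<le> pi / 2"
  shows "0 \<le> Q r t - b (r ^ n * cos (phase t))" "Q r t - b (r ^ n * cos (phase t)) = 0 \<longleftrightarrow> sin t = - \<delta>
      * \<eta> r"
proof -
  have r: "0 < r" "r < \<epsilon>" "- \<delta> * \<eta> r \<le> sin t" "- pi / 2 < t" using o(1) by (auto simp: in_half_def)
  have "0 \<le> Q r t - b (r ^ n * cos (phase t)) \<and> (Q r t - b (r ^ n * cos (phase t)) = 0 \<longleftrightarrow> sin t = - \<delta>
      * \<eta> r)"
  proof (cases "cos (phase t) = 0")
    case True
    have "phase t \<noteq> - (pi / 2)" using sector_ge_0[OF o(1), of "-1"] by auto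
    moreover have "\<bar>phase t\<bar> = pi / 2" using sector_strict[of "phase t" 0] x True by (metis
        cos_gt_zero_pi abs_less_iff less_irrefl minus_less_iff order_le_less)
    ultimately have "phase t = pi / 2" by linarith
    then have "sin (phase t) = sin (pi / 2)" by (rule arg_cong)
    then have "sin (phase t) = 1" by simp
    then have "0 < Q r t" using ray_sign[OF o(1) True] by simp
    moreover have "- \<delta> * \<eta> r < sin t" using strict_interior[OF ray_interior[OF o(1) True] r(1,2)] .
    ultimately show ?thesis using True b0 by simp
  next
    case False
    then have xs: "\<bar>phase t\<bar> < pi / 2" using sector_strict[of "phase t" 0] x by simp
    then have cp: "0 < cos (phase t)" by (intro cos_gt_zero_pi) linarith+
    have "r ^ n * cos (phase t) < \<epsilon>' ^ n"
    proof -
      have "r ^ n * cos (phase t) \<le> r ^ n * 1" using r by (intro mult_left_mono) auto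
      also have "\<dots> < \<epsilon>' ^ n" using o(2) r n1 by (simp add: power_strict_mono)
      finally show ?thesis .
    qed
    moreover have "0 < r ^ n * cos (phase t)" using r cp by simp
    ultimately obtain r0 where r0: "0 < r0" "r0 < \<epsilon>"
      "r0 ^ n * cos (real n * (- \<delta> * arcsin (\<eta> r0)) + \<delta> * pi / 2) = r ^ n * cos (phase t)"
      "b (r ^ n * cos (phase t)) = Re (K (of_real r0 * cis (- \<delta> * arcsin (\<eta> r0))))"
      using b_fold by blast
    define \<alpha> where "\<alpha> = arcsin (\<eta> r0)"
    define t0 where "t0 = - \<delta> * \<alpha>"
    have e: "0 < \<eta> r0" "\<eta> r0 < 1" "\<eta> r0 < sin margin" using eta_pos eta_lt1 eta_margin r0 by auto
    have \<alpha>: "sin \<alpha> = \<eta> r0" "0 < \<alpha>" "\<alpha> < margin"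
    proof -
      show s: "sin \<alpha> = \<eta> r0" unfolding \<alpha>_def using e by simp
      show "0 < \<alpha>" unfolding \<alpha>_def using e arcsin_less_mono[of 0 "\<eta> r0"] by simp
      have "\<alpha> \<le> pi / 2" "- (pi / 2) \<le> \<alpha>" unfolding \<alpha>_def using arcsin_bounded[of "\<eta> r0"] e by auto
      show "\<alpha> < margin"
      proof (rule ccontr)
        assume "\<not> \<alpha> < margin"
        then have "sin margin \<le> sin \<alpha>" using \<open>\<alpha> \<le> pi / 2\<close> margin by (intro sin_monotone_2pi_le) auto
        then show False using e(3) s by simp
      qed
    qed
    have st0: "sin t0 = - \<delta> * \<eta> r0" using dcases \<alpha>(1) by (auto simp: t0_def)
    have P0: "r0 ^ n * cos (phase t0) = r ^ n * cos (phase t)" "b (r ^ n * cos (phase t)) = Q r0 t0"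
      using r0 by (simp_all add: phase_def t0_def \<alpha>_def Q_def)
    have "0 < real n * \<alpha>" "real n * \<alpha> < real n * margin" using \<alpha> n0 by simp_all
    then have x0: "\<bar>phase t0\<bar> < pi / 2"
      unfolding margin(3) using dcases by (auto simp: phase_def t0_def)
    have om0: "in_half r0 t0" unfolding in_half_def using r0 st0 \<alpha> margin(2) dcases pi_gt_zero by
        (auto simp: t0_def)
    consider "r0 ^ n * sin (phase t0) < r ^ n * sin (phase t)" | "r ^ n * sin (phase t) < r0 ^ n *
        sin (phase t0)" | "r ^ n * sin (phase t) = r0 ^ n * sin (phase t0)" by linarith
    then show ?thesis
    proof cases
      case 1
      from level_increasing_0[OF om0 x0 xs r(1,2) P0(1) 1] show ?thesis using P0(2) by simp
    next
      case 2
      from level_increasing_0(2)[OF o(1) xs x0 r0(1,2) P0(1)[symmetric] 2] show ?thesis using st0 by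
          simp
    next
      case 3
      have "of_real (r ^ n) * cis (phase t) = of_real (r0 ^ n) * cis (phase t0)"
        using 3 P0(1) by (simp add: complex_eq_iff)
      then have "complex_of_real r * cis t = of_real r0 * cis t0"
        using sector_root_polar[OF r(1), of t 0] sector_root_polar[OF r0(1), of t0 0] xs x0 by simp
      then have z: "complex_of_real r * cis t = of_real r0 * cis t0" .
      have "r = r0" using arg_cong[OF z, of norm] r r0 by (simp add: norm_mult)
      then have "sin t = sin t0" using arg_cong[OF z, of Im] r by simp
      moreover have "Q r t = Q r0 t0" unfolding Q_def z ..
      ultimately show ?thesis using \<open>r = r0\<close> st0 P0(2) by simp
    qed
  qed
  then show "0 \<le> Q r t - b (r ^ n * cos (phase t))" "Q r t - b (r ^ n * cos (phase t)) = 0 \<longleftrightarrow> sin t =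
      - \<delta> * \<eta> r"
    by blast+
qed

text \<open>The angle is cut along the negative imaginary axis, which misses
  \<open>half_region\<close>. The real part of \<open>T z\<close> has the sign of \<open>cos (phase
  (polar_angle z))\<close>, so \<open>T z * cis (- phase (polar_angle z))\<close> is never a
  negative real number and the principal argument lifts the argument of \<open>T z\<close>
  continuously.\<close>

definition polar_angle :: "complex \<Rightarrow> real" where "polar_angle z = Arg (- \<i> * z) + pi / 2"
definition T :: "complex \<Rightarrow> complex" where
  "T z = shear b (Complex (Re (cis (\<delta> * pi / 2) * z ^ n)) (Re (K z)))"
definition \<phi> :: "complex \<Rightarrow> real" where
  "\<phi> z = phase (polar_angle z) + Arg (T z * cis (- phase (polar_angle z)))"
definition half_region :: "complex set" where
  "half_region = {z. 0 < norm z \<and> norm z < \<epsilon>' \<and> - \<delta> * \<eta> (norm z) * norm z \<le> Im z}"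

lemma polar_eq: "z = of_real (norm z) * cis (polar_angle z)"
proof -
  have "- \<i> * z = of_real (norm z) * cis (Arg (- \<i> * z))"
    using rcis_cmod_Arg[of "- \<i> * z"] by (simp add: rcis_def norm_mult)
  then have "\<i> * (- \<i> * z) = of_real (norm z) * (\<i> * cis (Arg (- \<i> * z)))"
    by (metis mult.left_commute)
  moreover have "\<i> * cis (Arg (- \<i> * z)) = cis (polar_angle z)"
    using cis_mult[of "pi / 2" "Arg (- \<i> * z)"] by (simp add: polar_angle_def add.commute)
  ultimately show ?thesis by simp
qed

lemma sin_polar_angle: "z \<noteq> 0 \<Longrightarrow> sin (polar_angle z) = Im z / norm z"
  using arg_cong[OF polar_eq[of z], of Im] by (simp add: field_simps)

lemma cos_polar_angle: "z \<noteq> 0 \<Longrightarrow> cos (polar_angle z) = Re z / norm z"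
  using arg_cong[OF polar_eq[of z], of Re] by (simp add: field_simps)

lemma half_region_in_half:
  assumes "z \<in> half_region"
  shows "in_half (norm z) (polar_angle z)" "norm z < \<epsilon>'" "z \<noteq> 0"
proof -
  have z: "0 < norm z" "norm z < \<epsilon>'" "- \<delta> * \<eta> (norm z) * norm z \<le> Im z" using assms by (auto simp:
      half_region_def)
  then show "norm z < \<epsilon>'" "z \<noteq> 0" by auto
  then have r: "norm z < \<epsilon>" using eps by simp
  have s: "- \<delta> * \<eta> (norm z) \<le> sin (polar_angle z)"
    unfolding sin_polar_angle[OF \<open>z \<noteq> 0\<close>] using z by (simp add: pos_le_divide_eq)
  have "-1 < - \<delta> * \<eta> (norm z)"
    using dcases eta_pos[OF z(1) r] eta_lt1[OF z(1) r] by auto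
  then have "sin (polar_angle z) \<noteq> -1" using s by linarith
  then have "polar_angle z \<noteq> 3 * pi / 2" by (metis sin_3over2_pi mult.commute times_divide_eq_left)
  moreover have "- pi < Arg (- \<i> * z)" "Arg (- \<i> * z) \<le> pi" using Arg_bounded by auto
  ultimately show "in_half (norm z) (polar_angle z)" unfolding in_half_def using z r s by (auto
      simp: polar_angle_def)
qed

lemma T_polar:
  assumes "0 < r"
  shows "T (of_real r * cis t) = Complex (r ^ n * cos (phase t)) (Q r t - b (r ^ n * cos (phase
      t)))"
proof -
  have "cis (\<delta> * pi / 2) * (of_real r * cis t) ^ n = of_real (r ^ n) * cis (phase t)"
    by (simp add: power_mult_distrib Complex.DeMoivre phase_def mult.left_commute cis_mult
        add.commute)
  then have "Re (cis (\<delta> * pi / 2) * (of_real r * cis t) ^ n) = r ^ n * cos (phase t)" by simp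
  then show ?thesis unfolding T_def shear_def by (simp add: Q_def)
qed

lemma T_half_region:
  assumes "z \<in> half_region"
  shows "Re (T z) = norm z ^ n * cos (phase (polar_angle z))"
    "Im (T z) = Q (norm z) (polar_angle z) - b (norm z ^ n * cos (phase (polar_angle z)))"
  using T_polar[of "norm z" "polar_angle z"] polar_eq[of z] half_region_in_half(3)[OF assms] by
      simp_all

lemma T_not_opposite:
  assumes "z \<in> half_region"
  shows "T z * cis (- phase (polar_angle z)) \<notin> \<real>\<^sub>\<le>\<^sub>0"
    and "cos (phase (polar_angle z)) = 0 \<Longrightarrow> \<phi> z = phase (polar_angle z)"
proof -
  let ?x = "phase (polar_angle z)"
  note o = half_region_in_half[OF assms]
  have c0: "cos ?x = 0 \<Longrightarrow> \<exists>s>0. T z * cis (- ?x) = of_real s"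
  proof -
    assume c: "cos ?x = 0"
    have "T z * cis (- ?x) = of_real (sin ?x * Q (norm z) (polar_angle z))"
      using T_half_region[OF assms] c b0 by (simp add: complex_eq_iff)
    then show ?thesis using ray_sign[OF o(1) c] by blast
  qed
  show "T z * cis (- ?x) \<notin> \<real>\<^sub>\<le>\<^sub>0"
  proof (cases "cos ?x = 0")
    case True
    then obtain s where "0 < s" "T z * cis (- ?x) = of_real s" using c0 by blast
    then show ?thesis by (simp only: complex_nonpos_Reals_iff) simp
  next
    case False
    show ?thesis
    proof
      assume "T z * cis (- ?x) \<in> \<real>\<^sub>\<le>\<^sub>0"
      then obtain s where s: "s \<le> 0" "T z * cis (- ?x) = of_real s" by (auto elim:
          nonpos_Reals_cases)
      have "T z = T z * cis (- ?x) * cis ?x" by (simp add: mult.assoc cis_mult)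
      then have "Re (T z) = s * cos ?x" using s(2) by simp
      then have "norm z ^ n * cos ?x = s * cos ?x" using T_half_region(1)[OF assms] by simp
      then have "norm z ^ n = s" using False by simp
      then show False using s(1) o(3) by (metis norm_eq_zero norm_ge_zero zero_le_power antisym
          power_eq_0_iff)
    qed
  qed
  show "\<phi> z = ?x" if "cos ?x = 0"
    using c0[OF that] by (auto simp: \<phi>_def)
qed

lemma T_nonzero: "z \<in> half_region \<Longrightarrow> T z \<noteq> 0"
  using T_not_opposite(1)[of z] by auto

lemma T_cis_\<phi>:
  assumes "z \<in> half_region"
  shows "T z = of_real (norm (T z)) * cis (\<phi> z)"
proof -
  let ?w = "T z * cis (- phase (polar_angle z))"
  have "?w = of_real (norm (T z)) * cis (Arg ?w)"
    using rcis_cmod_Arg[of ?w] by (simp add: rcis_def norm_mult)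
  then have "?w * cis (phase (polar_angle z)) = of_real (norm (T z)) * (cis (Arg ?w) * cis (phase
      (polar_angle z)))"
    by (metis mult.assoc)
  then show ?thesis by (simp add: mult.assoc cis_mult \<phi>_def add.commute)
qed

text \<open>Re (T z) has the sign of the cosine of the phase, so cos (\<phi> z - k pi) is positive
  when the phase is inside sector k. As \<phi> differs from the phase by at most pi, only the same
  sector is possible.\<close>

lemma \<phi>_sector:
  assumes "z \<in> half_region" "\<bar>phase (polar_angle z) - of_int k * pi\<bar> \<le> pi / 2"
  shows "\<bar>\<phi> z - of_int k * pi\<bar> \<le> pi / 2"
    and "cos (phase (polar_angle z)) \<noteq> 0 \<Longrightarrow> \<bar>\<phi> z - of_int k * pi\<bar> < pi / 2"
proof -
  let ?x = "phase (polar_angle z)"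
  show st: "\<bar>\<phi> z - of_int k * pi\<bar> < pi / 2" if c: "cos ?x \<noteq> 0"
  proof -
    have x: "\<bar>?x - of_int k * pi\<bar> < pi / 2" using sector_strict[OF assms(2) c] .
    then have "0 < cos (?x - of_int k * pi)" by (intro cos_gt_zero_pi) linarith+
    moreover have "norm z ^ n * cos ?x = norm (T z) * cos (\<phi> z)"
      using T_half_region(1)[OF assms(1)] arg_cong[OF T_cis_\<phi>[OF assms(1)], of Re] by simp
    moreover have "cos ?x = cos (?x - of_int k * pi) * sector_sign k" "cos (\<phi> z) = cos (\<phi> z - of_int
        k * pi) * sector_sign k"
      unfolding sector_sign_def by (rule cos_sector(1))+
    moreover have "sector_sign k \<noteq> 0" using sector_sign_sq[of k] by auto
    ultimately have "norm z ^ n * cos (?x - of_int k * pi) = norm (T z) * cos (\<phi> z - of_int k * pi)"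
      by (metis mult.assoc mult_right_cancel)
    moreover have "0 < norm z ^ n * cos (?x - of_int k * pi)"
      using half_region_in_half(3)[OF assms(1)] \<open>0 < cos (?x - of_int k * pi)\<close> by simp
    ultimately have "0 < cos (\<phi> z - of_int k * pi)"
      by (metis norm_ge_zero mult_nonneg_nonpos not_less)
    moreover have "\<bar>Arg (T z * cis (- ?x))\<bar> \<le> pi" using Arg_bounded[of "T z * cis (- ?x)"] by (auto
        simp: abs_le_iff)
    then have "\<bar>\<phi> z - of_int k * pi\<bar> \<le> 3 * pi / 2" using x unfolding \<phi>_def by linarith
    ultimately show ?thesis by (rule abs_less_half_pi)
  qed
  show "\<bar>\<phi> z - of_int k * pi\<bar> \<le> pi / 2"
    using st assms(2) T_not_opposite(2)[OF assms(1)] by (cases "cos ?x = 0") auto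
qed

text \<open>By \<open>fold_0\<close> the imaginary part of T z is nonnegative and vanishes exactly
  on the critical curve; for an argument of modulus at most pi / 2 this settles the sign.\<close>

lemma \<phi>_first_sector:
  assumes "z \<in> half_region" "\<bar>phase (polar_angle z)\<bar> \<le> pi / 2"
  shows "0 \<le> \<phi> z" "\<phi> z \<le> pi / 2" "\<phi> z = 0 \<longleftrightarrow> Im z = - \<delta> * \<eta> (norm z) * norm z"
proof -
  note o = half_region_in_half[OF assms(1)]
  note f = fold_0[OF o(1,2) assms(2)]
  have ph: "\<bar>\<phi> z\<bar> \<le> pi / 2" using \<phi>_sector(1)[OF assms(1), of 0] assms(2) by simp
  then show "\<phi> z \<le> pi / 2" by simp
  have im: "norm (T z) * sin (\<phi> z) = Im (T z)" using arg_cong[OF T_cis_\<phi>[OF assms(1)], of Im] by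
      simp
  have T0: "0 < norm (T z)" using T_nonzero[OF assms(1)] by simp
  have "0 \<le> norm (T z) * sin (\<phi> z)" unfolding im T_half_region(2)[OF assms(1)] by (rule f(1))
  then have "0 \<le> sin (\<phi> z)" using T0 by (simp add: zero_le_mult_iff)
  then show ge: "0 \<le> \<phi> z"
    using sin_gt_zero[of "- \<phi> z"] ph by (cases "\<phi> z < 0") auto
  have "\<phi> z = 0 \<longleftrightarrow> sin (\<phi> z) = 0"
    using sin_gt_zero[of "\<phi> z"] ge ph pi_gt_zero by (cases "\<phi> z = 0") auto
  also have "\<dots> \<longleftrightarrow> Im (T z) = 0" using im T0 by auto
  also have "\<dots> \<longleftrightarrow> sin (polar_angle z) = - \<delta> * \<eta> (norm z)" unfolding T_half_region(2)[OF assms(1)] by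
      (rule f(2))
  also have "\<dots> \<longleftrightarrow> Im z = - \<delta> * \<eta> (norm z) * norm z"
    unfolding sin_polar_angle[OF o(3)] using o(3) by (simp add: divide_eq_eq)
  finally show "\<phi> z = 0 \<longleftrightarrow> Im z = - \<delta> * \<eta> (norm z) * norm z" .
qed

lemma half_region_reflect: "z \<in> half_region \<Longrightarrow> - cnj z \<in> half_region"
  by (simp add: half_region_def)

lemma polar_inject:
  assumes "0 < r" "0 < s" "of_real r * cis t = of_real s * cis u" "- pi / 2 < t" "t < 3 * pi / 2" "-
      pi / 2 < u" "u < 3 * pi / 2"
  shows "r = s" "t = u"
proof -
  show "r = s" using arg_cong[OF assms(3), of norm] assms(1,2) by (simp add: norm_mult)
  then have "cis t = cis u" using assms(1,3) by simp
  then have "cis (t - pi / 2) = cis (u - pi / 2)" by (simp only: cis_divide[symmetric])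
  moreover have "Arg (cis (t - pi / 2)) = t - pi / 2" "Arg (cis (u - pi / 2)) = u - pi / 2"
    using assms by (intro cis_Arg_unique; simp)+
  ultimately have "t - pi / 2 = u - pi / 2" by metis
  then show "t = u" by linarith
qed

lemma polar_angle_reflect:
  assumes "z \<in> half_region"
  shows "polar_angle (- cnj z) = pi - polar_angle z"
proof -
  have "of_real (norm z) * cis (pi - polar_angle z) = - cnj (of_real (norm z) * cis (polar_angle
      z))"
    by (simp add: complex_eq_iff cos_diff sin_diff)
  also have "\<dots> = - cnj z" by (simp only: polar_eq[of z, symmetric])
  also have "\<dots> = of_real (norm (- cnj z)) * cis (polar_angle (- cnj z))" by (rule polar_eq)
  also have "norm (- cnj z) = norm z" by simp
  finally show ?thesis
    using half_region_in_half[OF assms] half_region_in_half[OF half_region_reflect[OF assms]]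
    by (intro polar_inject(2)[of "norm z" "norm z", symmetric]) (auto simp: in_half_def)
qed

text \<open>Since a is odd, reflection changes the sign of the first component; \<open>sym\<close>
  and the evenness of b preserve the second.\<close>

lemma T_reflect: "T (- cnj z) = - cnj (T z)"
proof -
  have an: "cis (real a * pi) = -1" using a(2) by (simp add: complex_eq_iff)
  define A where "A = cis (\<delta> * pi / 2) * z ^ n"
  have "cis (\<delta> * pi / 2) * (- cnj z) ^ n = - cnj A"
  proof -
    have "(- cnj z) ^ n = (-1) ^ n * cnj z ^ n" by (rule power_minus)
    moreover have "(-1 :: complex) ^ n = cis (real n * pi)"
      using Complex.DeMoivre[of pi n] by (simp add: cis_pi)
    moreover have "cis (\<delta> * pi / 2) * cis (real n * pi) = cis (real a * pi) * cis (- (\<delta> * pi / 2))"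
      unfolding cis_mult by (rule arg_cong[of _ _ cis]) (simp add: a(1) algebra_simps)
    ultimately show ?thesis unfolding an A_def by (simp add: cis_cnj mult.assoc[symmetric])
  qed
  then have "Re (cis (\<delta> * pi / 2) * (- cnj z) ^ n) = - Re A" by simp
  then show ?thesis
    unfolding T_def sym[of z] A_def[symmetric] by (simp add: complex_eq_iff b_even)
qed

text \<open>Conjugation negates the principal argument only off the negative reals, which
  \<open>T_not_opposite\<close> ensures.\<close>

lemma \<phi>_reflect:
  assumes "z \<in> half_region"
  shows "\<phi> (- cnj z) = real a * pi - \<phi> z"
proof -
  have an: "cis (- (real a * pi)) = -1" using a(2) by (simp add: complex_eq_iff)
  have x: "phase (polar_angle (- cnj z)) = real a * pi - phase (polar_angle z)" by (simp add:
      polar_angle_reflect[OF assms] phase_reflect)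
  have "T (- cnj z) * cis (- phase (polar_angle (- cnj z))) = cnj (T z * cis (- phase (polar_angle
      z)))"
  proof -
    have "- (real a * pi - phase (polar_angle z)) = - (real a * pi) + phase (polar_angle z)" by simp
    then have "cis (- (real a * pi - phase (polar_angle z))) = - cis (phase (polar_angle z))"
      by (simp only: cis_mult[symmetric] an) simp
    then show ?thesis unfolding x T_reflect by (simp add: cis_cnj)
  qed
  moreover have "Arg (cnj w) = - Arg w" if "w \<notin> \<real>\<^sub>\<le>\<^sub>0" for w
  proof (cases "w \<in> \<real>")
    case True
    then obtain s where "w = of_real s" by (auto elim: Reals_cases)
    then have "0 < s" using that by (auto simp: complex_nonpos_Reals_iff)
    then show ?thesis using \<open>w = of_real s\<close> by simp
  qed (simp add: Arg_cnj)
  from this[OF T_not_opposite(1)[OF assms]]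
  have "Arg (cnj (T z * cis (- phase (polar_angle z)))) = - Arg (T z * cis (- phase (polar_angle
      z)))" .
  ultimately show ?thesis by (simp add: \<phi>_def x)
qed

end

section \<open>Range and injectivity of the lifted argument\<close>

context half_model
begin

definition bdry :: "complex \<Rightarrow> bool" where "bdry z \<longleftrightarrow> Im z = - \<delta> * \<eta> (norm z) * norm z"

text \<open>|\<delta>| \<eta> < 1 keeps the critical curve off the imaginary axis. It splits into a
  right and a left branch, on which \<phi> takes its two extreme values.\<close>

lemma bdry_Re:
  assumes "z \<in> half_region" "bdry z"
  shows "Re z \<noteq> 0"
proof
  assume "Re z = 0"
  then have "norm z = \<bar>Im z\<bar>" by (simp add: cmod_eq_Im)
  moreover have "0 < norm z" "norm z < \<epsilon>" using half_region_in_half[OF assms(1)] by (auto simp: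
      in_half_def)
  then have e: "0 < \<eta> (norm z)" "\<eta> (norm z) < 1" using eta_pos eta_lt1 by auto
  have "\<bar>Im z\<bar> = \<bar>\<delta>\<bar> * \<eta> (norm z) * norm z" using assms(2) e by (simp add: bdry_def abs_mult)
  moreover have "\<bar>\<delta>\<bar> * \<eta> (norm z) < 1" using dcases e by auto
  then have "\<bar>\<delta>\<bar> * \<eta> (norm z) * norm z < 1 * norm z" using \<open>0 < norm z\<close> by (intro
      mult_strict_right_mono)
  ultimately show False by linarith
qed

lemma first_sector_Re:
  assumes "z \<in> half_region" "\<bar>phase (polar_angle z)\<bar> \<le> pi / 2"
  shows "0 \<le> Re z"
proof -
  note o = half_region_in_half[OF assms(1)]
  have "phase (polar_angle z) \<le> of_int 0 * pi + pi / 2" using assms(2) by simp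
  then have "polar_angle z \<le> (2 * of_int 0 + 1 - \<delta>) * margin" by (simp only: sector_upper_iff)
  also have "\<dots> \<le> pi / 2"
  proof -
    have "\<delta> = 1 \<or> \<delta> = 0 \<or> \<delta> = -1" using dcases by blast
    then show ?thesis
    proof (elim disjE)
      assume d: "\<delta> = -1"
      then show ?thesis using n2 n1 by (simp add: margin_def field_simps)
    qed (use margin in auto)
  qed
  finally have "0 \<le> cos (polar_angle z)" using o(1) by (intro cos_ge_zero) (auto simp: in_half_def)
  then show ?thesis using cos_polar_angle[OF o(3)] o(3) by (simp add: zero_le_divide_iff)
qed

text \<open>Sector 0 is \<open>\<phi>_first_sector\<close>, sector a its reflection; in the sectors
  between, \<phi> keeps a distance of at least pi / 2 from both ends.\<close>

lemma \<phi>_range: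
  assumes z: "z \<in> half_region"
  shows "0 \<le> \<phi> z" "\<phi> z \<le> real a * pi" "\<phi> z = 0 \<longleftrightarrow> bdry z \<and> 0 < Re z" "\<phi> z = real a * pi \<longleftrightarrow> bdry z \<and> Re
      z < 0"
proof -
  have api: "pi \<le> real a * pi" using a1 by simp
  have first: "0 \<le> \<phi> z \<and> \<phi> z \<le> real a * pi \<and> (\<phi> z = 0 \<longleftrightarrow> bdry z \<and> 0 < Re z) \<and> (\<phi> z = real a * pi \<longleftrightarrow>
      bdry z \<and> Re z < 0)"
    if "z \<in> half_region" "\<bar>phase (polar_angle z)\<bar> \<le> pi / 2" for z
  proof -
    have "\<phi> z < real a * pi" using \<phi>_first_sector(2)[OF that] api pi_gt_zero by linarith
    then show ?thesis
      using \<phi>_first_sector[OF that] first_sector_Re[OF that] bdry_Re[OF that(1)] by (auto simp: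
          bdry_def)
  qed
  note o = half_region_in_half[OF z]
  obtain k where k: "\<bar>phase (polar_angle z) - of_int k * pi\<bar> \<le> pi / 2" using sector_exists by blast
  then have "phase (polar_angle z) \<le> of_int k * pi + pi / 2" "of_int k * pi - pi / 2 \<le> phase
      (polar_angle z)" by linarith+
  then have "0 \<le> k" "k \<le> int a" using sector_ge_0[OF o(1)] sector_le_a[OF o(1)] by blast+
  then consider "k = 0" | "0 < k" "k < int a" | "k = int a" by linarith
  then have "0 \<le> \<phi> z \<and> \<phi> z \<le> real a * pi \<and> (\<phi> z = 0 \<longleftrightarrow> bdry z \<and> 0 < Re z) \<and> (\<phi> z = real a * pi \<longleftrightarrow> bdry
      z \<and> Re z < 0)"
  proof cases
    case 1
    then show ?thesis using first[OF z] k by simp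
  next
    case 2
    have "1 * pi \<le> of_int k * pi" "of_int k * pi \<le> (real a - 1) * pi" using 2 by (intro
        mult_right_mono; simp)+
    then have "0 < \<phi> z" "\<phi> z < real a * pi"
      using \<phi>_sector(1)[OF z k] pi_gt_zero unfolding left_diff_distrib mult_1 by linarith+
    moreover have "- \<delta> * \<eta> (norm z) < sin (polar_angle z)"
      using strict_middle[OF 2 k] o(1) by (simp add: in_half_def)
    then have "\<not> bdry z" using sin_polar_angle[OF o(3)] o(3) by (auto simp: bdry_def)
    ultimately show ?thesis by simp
  next
    case 3
    let ?z = "- cnj z"
    have "\<bar>phase (polar_angle ?z)\<bar> \<le> pi / 2" using k 3 by (simp add: polar_angle_reflect[OF z]
        phase_reflect abs_minus_commute)
    from first[OF half_region_reflect[OF z] this] show ?thesis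
      unfolding \<phi>_reflect[OF z] by (auto simp: bdry_def)
  qed
  then show "0 \<le> \<phi> z" "\<phi> z \<le> real a * pi" "\<phi> z = 0 \<longleftrightarrow> bdry z \<and> 0 < Re z" "\<phi> z = real a * pi \<longleftrightarrow> bdry z
      \<and> Re z < 0"
    by blast+
qed

text \<open>Equal T means equal first components and equal Q. The lifted argument then singles out
  the ray, if the first component is 0, or else the sector, and Q is strictly monotone on the ray or
  on the level curve within the sector.\<close>

lemma \<phi>_inj:
  assumes z: "z1 \<in> half_region" "z2 \<in> half_region" and T: "T z1 = T z2" and ph: "\<phi> z1 = \<phi> z2"
  shows "z1 = z2"
proof -
  note o1 = half_region_in_half[OF z(1)] and o2 = half_region_in_half[OF z(2)]
  let ?r1 = "norm z1" and ?r2 = "norm z2" and ?t1 = "polar_angle z1" and ?t2 = "polar_angle z2"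
  have p: "?r1 ^ n * cos (phase ?t1) = ?r2 ^ n * cos (phase ?t2)" using T T_half_region(1)[OF z(1)]
      T_half_region(1)[OF z(2)] by simp
  have q: "Q ?r1 ?t1 = Q ?r2 ?t2" using T T_half_region(2)[OF z(1)] T_half_region(2)[OF z(2)] p by
      simp
  have r: "0 < ?r1" "?r1 < \<epsilon>" "0 < ?r2" "?r2 < \<epsilon>" using o1 o2 by (auto simp: in_half_def)
  have "?r1 = ?r2 \<and> ?t1 = ?t2"
  proof (cases "cos (phase ?t1) = 0")
    case True
    then have c2: "cos (phase ?t2) = 0" using p r by auto
    have "phase ?t1 = phase ?t2" using T_not_opposite(2)[OF z(1) True] T_not_opposite(2)[OF z(2) c2]
        ph by simp
    then have t: "?t1 = ?t2" using n0 by (simp add: phase_def)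
    have "\<not> ?r1 < ?r2" using ray_increasing[OF o1(1) True, of ?r1 ?r2] r q t by auto
    moreover have "\<not> ?r2 < ?r1" using ray_increasing[OF o1(1) True, of ?r2 ?r1] r q t by auto
    ultimately show ?thesis using t by simp
  next
    case False
    then have c2: "cos (phase ?t2) \<noteq> 0" using p r by auto
    obtain k where k: "\<bar>phase ?t1 - of_int k * pi\<bar> \<le> pi / 2" using sector_exists by blast
    obtain l where l: "\<bar>phase ?t2 - of_int l * pi\<bar> \<le> pi / 2" using sector_exists by blast
    have "\<bar>of_int k * pi - of_int l * pi\<bar> < pi"
      using \<phi>_sector(2)[OF z(1) k False] \<phi>_sector(2)[OF z(2) l c2] ph by linarith
    moreover have "\<bar>of_int k * pi - of_int l * pi\<bar> = \<bar>of_int (k - l)\<bar> * pi"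
      by (simp add: abs_mult flip: left_diff_distrib)
    ultimately have "\<bar>of_int (k - l)\<bar> < (1::real)" by simp
    then have kl: "k = l" by linarith
    have s1: "\<bar>phase ?t1 - of_int k * pi\<bar> < pi / 2" and s2: "\<bar>phase ?t2 - of_int k * pi\<bar> < pi / 2"
      using sector_strict[OF k False] sector_strict[OF l c2] kl by auto
    have "\<not> ?r1 ^ n * sin (phase ?t1) < ?r2 ^ n * sin (phase ?t2)"
      using level_increasing_in_half[OF o1(1) o2(1) s1 s2 p] q by auto
    moreover have "\<not> ?r2 ^ n * sin (phase ?t2) < ?r1 ^ n * sin (phase ?t1)"
      using level_increasing_in_half[OF o2(1) o1(1) s2 s1 p[symmetric]] q by auto
    ultimately have "?r1 ^ n * sin (phase ?t1) = ?r2 ^ n * sin (phase ?t2)" by linarith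
    then have e: "of_real (?r1 ^ n) * cis (phase ?t1) = of_real (?r2 ^ n) * cis (phase ?t2)"
      using p by (simp add: complex_eq_iff)
    have "\<bar>phase ?t1 - of_int k * pi\<bar> < pi" "\<bar>phase ?t2 - of_int k * pi\<bar> < pi" using s1 s2
        pi_gt_zero by linarith+
    then have "of_real ?r1 * cis ?t1 = of_real ?r2 * cis ?t2"
      using sector_root_polar[OF r(1), of ?t1 k] sector_root_polar[OF r(3), of ?t2 k] e by metis
    then show ?thesis
      using polar_inject[OF r(1,3)] o1(1) o2(1) by (auto simp: in_half_def)
  qed
  then show ?thesis using polar_eq[of z1] polar_eq[of z2] by metis
qed

lemma continuous_T: "continuous_on A T"
proof -
  have K: "continuous_on A K" by (rule holomorphic_on_imp_continuous_on[OF holomorphic_on_subset[OF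
      holK]]) simp
  have "continuous_on A (\<lambda>z. Complex (Re (cis (\<delta> * pi / 2) * z ^ n)) (Re (K z)))"
    unfolding Complex_eq by (intro continuous_intros K)
  then show ?thesis
    unfolding T_def[abs_def] by (rule continuous_on_compose2[OF continuous_shear[OF b_cont]]) auto
qed

lemma continuous_\<phi>: "continuous_on half_region \<phi>"
proof -
  have np: "- \<i> * z \<notin> \<real>\<^sub>\<le>\<^sub>0" if "z \<in> half_region" for z
  proof
    note o = half_region_in_half[OF that]
    assume "- \<i> * z \<in> \<real>\<^sub>\<le>\<^sub>0"
    then have "Re z = 0" "Im z \<le> 0" by (auto simp: complex_nonpos_Reals_iff)
    then have "Im z = - norm z" by (simp add: cmod_eq_Im)
    then have "sin (polar_angle z) = - 1" using sin_polar_angle[OF o(3)] o(3) by simp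
    moreover have "-1 < - \<delta> * \<eta> (norm z)"
      using dcases eta_pos[of "norm z"] eta_lt1[of "norm z"] o(1) by (auto simp: in_half_def)
    ultimately show False using o(1) by (auto simp: in_half_def)
  qed
  have ca: "continuous_on half_region (\<lambda>z. Arg (- \<i> * z))"
    by (rule continuous_on_Arg'[OF _ np]) (intro continuous_intros)
  have x: "continuous_on half_region (\<lambda>z. phase (polar_angle z))"
    unfolding phase_def polar_angle_def by (intro continuous_on_add continuous_on_mult
        continuous_on_const ca)
  have "continuous_on half_region (\<lambda>z. T z * cis (- phase (polar_angle z)))"
    by (intro continuous_intros continuous_T x)
  then show ?thesis
    unfolding \<phi>_def[abs_def] using T_not_opposite(1) by (intro continuous_on_add x
        continuous_on_Arg')
qed

text \<open>The criterion of \<open>op_homeomorphismI\<close> for modulus |T z| and argument \<phi>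
  z / a. That argument lies in [0, pi], so only Im z \<le> 0 needs care. Up to reflection the polar
  angle is then at most 0, hence Re z > 0 while \<phi> z / a \<le> pi / 2, and the real parts cannot
  be opposite.\<close>

lemma T_cis_not_opposite:
  assumes z: "z \<in> half_region" and c: "0 \<le> c"
  shows "of_real (norm (T z)) * cis (\<phi> z / real a) \<noteq> - (of_real c * z)"
proof
  assume eq: "of_real (norm (T z)) * cis (\<phi> z / real a) = - (of_real c * z)"
  have T0: "0 < norm (T z)" using T_nonzero[OF z] by simp
  have c0: "0 < c" using eq T0 c by (cases "c = 0") auto
  have a0: "0 < real a" using a1 by simp
  have ra: "0 \<le> \<phi> z / real a" "\<phi> z / real a \<le> pi"
    using \<phi>_range(1,2)[OF z] a0 by (auto simp: divide_le_eq mult.commute)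
  then have "0 \<le> norm (T z) * sin (\<phi> z / real a)" by (intro mult_nonneg_nonneg sin_ge_zero) auto
  then have "0 \<le> - (c * Im z)" using arg_cong[OF eq, of Im] by simp
  then have im: "Im z \<le> 0" using c0 by (simp add: mult_le_0_iff)
  have first: False if z: "z \<in> half_region" and t: "polar_angle z \<le> 0"
    and eq: "of_real (norm (T z)) * cis (\<phi> z / real a) = - (of_real c * z)" for z
  proof -
    note o = half_region_in_half[OF z]
    have "real n * polar_angle z \<le> 0" using t by (simp add: mult_le_0_iff)
    moreover have "\<delta> * pi / 2 \<le> pi / 2" using dcases by auto
    ultimately have up: "phase (polar_angle z) \<le> pi / 2" unfolding phase_def by linarith
    have "\<not> phase (polar_angle z) < - (pi / 2)"
      using sector_ge_0[OF o(1), of "-1"] pi_gt_zero by auto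
    with up have x: "\<bar>phase (polar_angle z)\<bar> \<le> pi / 2" by simp
    have "\<phi> z / real a \<le> \<phi> z / 1"
      using \<phi>_first_sector(1)[OF z x] a1 by (intro divide_left_mono) auto
    then have "\<phi> z / real a \<le> pi / 2" using \<phi>_first_sector(2)[OF z x] by linarith
    moreover have "0 \<le> \<phi> z / real a" using \<phi>_first_sector(1)[OF z x] a0 by simp
    ultimately have "0 \<le> cos (\<phi> z / real a)" using pi_gt_zero by (intro cos_ge_zero) linarith+
    moreover have "norm (T z) * cos (\<phi> z / real a) = - (c * Re z)" using arg_cong[OF eq, of Re] by
        simp
    moreover have "0 < cos (polar_angle z)" using t o(1) by (intro cos_gt_zero_pi) (auto simp:
        in_half_def)
    then have "0 < Re z" using cos_polar_angle[OF o(3)] o(3) by (simp add: zero_less_divide_iff)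
    ultimately show False using c0 T_nonzero[OF z]
      by (metis mult_nonneg_nonneg mult_pos_pos neg_0_le_iff_le norm_ge_zero not_le)
  qed
  note o = half_region_in_half[OF z]
  have "sin (polar_angle z) \<le> 0" using sin_polar_angle[OF o(3)] im by (simp add: divide_le_0_iff)
  then have "\<not> (0 < polar_angle z \<and> polar_angle z < pi)" using sin_gt_zero[of "polar_angle z"] by
      auto
  then consider "polar_angle z \<le> 0" | "pi \<le> polar_angle z" by linarith
  then show False
  proof cases
    case 1
    then show ?thesis using first[OF z] eq by blast
  next
    case 2
    have t: "polar_angle (- cnj z) \<le> 0" using polar_angle_reflect[OF z] 2 by simp
    have "\<phi> (- cnj z) / real a = pi - \<phi> z / real a"
      using \<phi>_reflect[OF z] a0 by (simp add: diff_divide_distrib)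
    then have "cis (\<phi> (- cnj z) / real a) = - cnj (cis (\<phi> z / real a))"
      by (simp add: complex_eq_iff cos_diff sin_diff)
    then have "of_real (norm (T (- cnj z))) * cis (\<phi> (- cnj z) / real a) = - cnj (of_real (norm (T
        z)) * cis (\<phi> z / real a))"
      by (simp add: T_reflect)
    also have "\<dots> = - (of_real c * (- cnj z))" unfolding eq by simp
    finally show False using first[OF half_region_reflect[OF z] t] by blast
  qed
qed

end

section \<open>Gluing the two sides\<close>

lemma cis_inj_half:
  assumes "cis x = cis y" "0 \<le> x" "x \<le> pi" "0 \<le> y" "y \<le> pi"
  shows "x = y"
proof -
  have "cos x = cos y" using arg_cong[OF assms(1), of Re] by simp
  then show ?thesis using assms by (simp add: cos_inj_pi)
qed

text \<open>On each side the point is sent to the modulus of the sheared map S and its lifted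
  argument divided by the degree, on the lower side through conjugation. Both definitions agree on
  the critical curve: the angles are 0 on the right branch, pi and -pi on the left.\<close>

lemma half_models_glue:
  fixes f :: "complex \<Rightarrow> complex"
  assumes H1: "half_model n a \<delta> \<epsilon> \<epsilon>' K \<kappa> \<eta> b" and H2: "half_model n a' (- \<delta>) \<epsilon> \<epsilon>' K' \<kappa>' \<eta> b"
    and KK: "\<And>z. Re (K' z) = Re (K (cnj z))" and eta: "continuous_on {0<..<\<epsilon>} \<eta>"
    and f: "\<And>z. f z = Complex (Re (cis (\<delta> * pi / 2) * z ^ n)) (Re (K z))"
  shows "\<exists>\<Delta> h1 g1 h2 g2. 0 \<in> \<Delta> \<and> \<Delta> \<subseteq> UNIV \<and>
        op_homeomorphism \<Delta> (ball 0 1) h1 g1 \<and> h1 0 = 0 \<and>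
        op_homeomorphism UNIV UNIV h2 g2 \<and> h2 (f 0) = 0 \<and>
        (\<forall>r \<theta>. 0 \<le> r \<and> r < 1 \<and> 0 \<le> \<theta> \<and> \<theta> \<le> pi \<longrightarrow>
           h2 (f (g1 (of_real r * cis \<theta>))) = of_real r * cis (real a * \<theta>)) \<and>
        (\<forall>r \<theta>. 0 \<le> r \<and> r < 1 \<and> pi \<le> \<theta> \<and> \<theta> \<le> 2 * pi \<longrightarrow>
           h2 (f (g1 (of_real r * cis \<theta>))) = of_real r * cis (- real a' * \<theta>))"
proof -
  interpret A: half_model n a \<delta> \<epsilon> \<epsilon>' K \<kappa> \<eta> b by (rule H1)
  interpret B: half_model n a' "- \<delta>" \<epsilon> \<epsilon>' K' \<kappa>' \<eta> b by (rule H2)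
  define S where "S z = shear b (f z)" for z
  have AT: "A.T z = S z" for z by (simp add: A.T_def S_def f)
  have BT: "B.T (cnj z) = S z" for z
  proof -
    have "cis (- \<delta> * pi / 2) * cnj z ^ n = cnj (cis (\<delta> * pi / 2) * z ^ n)" by (simp add: cis_cnj)
    then have "Re (cis (- \<delta> * pi / 2) * cnj z ^ n) = Re (cis (\<delta> * pi / 2) * z ^ n)" by (metis
        complex_cnj(1) cnj.sel(1))
    then show ?thesis by (simp only: B.T_def S_def f KK complex_cnj_cnj)
  qed
  \<comment> \<open>Positive above the critical curve and negative below it.\<close>
  define s where "s z = Im z + \<delta> * \<eta> (norm z) * norm z" for z
  define u where "u z = of_real (norm (S z)) * cis (A.\<phi> z / real a)" for z
  define l where "l z = of_real (norm (S z)) * cis (- B.\<phi> (cnj z) / real a')" for z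
  define h where "h z = (if z = 0 then 0 else if - s z \<le> 0 then u z else l z)" for z
  define D where "D = ball (0::complex) \<epsilon>' - {0}"
  have UA: "z \<in> A.half_region" if "z \<in> D" "- s z \<le> 0" for z using that by (auto simp:
      A.half_region_def D_def s_def)
  have LB: "cnj z \<in> B.half_region" if "z \<in> D" "0 \<le> - s z" for z using that by (auto simp:
      B.half_region_def D_def s_def)
  have a0: "0 < real a" "0 < real a'" using A.a1 B.a1 by simp_all
  have Arange: "0 \<le> A.\<phi> z / real a" "A.\<phi> z / real a \<le> pi" if "z \<in> A.half_region" for z
    using A.\<phi>_range(1,2)[OF that] a0 by (auto simp: divide_le_eq mult.commute)
  have Brange: "0 \<le> B.\<phi> z / real a'" "B.\<phi> z / real a' \<le> pi" if "z \<in> B.half_region" for z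
    using B.\<phi>_range(1,2)[OF that] a0 by (auto simp: divide_le_eq mult.commute)
  have S0: "S z \<noteq> 0" if "z \<in> D" for z
    using A.T_nonzero[OF UA[OF that]] B.T_nonzero[OF LB[OF that]] by (cases "- s z \<le> 0") (auto simp:
        AT BT)
  have eqGamma: "u z = l z" if "z \<in> D" "s z = 0" for z
  proof -
    have zA: "z \<in> A.half_region" "cnj z \<in> B.half_region" using UA LB that by auto
    have bd: "A.bdry z" "B.bdry (cnj z)" using that by (auto simp: A.bdry_def B.bdry_def s_def)
    consider "0 < Re z" | "Re z < 0" using A.bdry_Re[OF zA(1) bd(1)] by linarith
    then show ?thesis
    proof cases
      case 1
      then show ?thesis
        using A.\<phi>_range(3)[OF zA(1)] B.\<phi>_range(3)[OF zA(2)] bd by (simp add: u_def l_def)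
    next
      case 2
      then have "A.\<phi> z = real a * pi" "B.\<phi> (cnj z) = real a' * pi"
        using A.\<phi>_range(4)[OF zA(1)] B.\<phi>_range(4)[OF zA(2)] bd by auto
      then show ?thesis using a0 by (simp add: u_def l_def complex_eq_iff)
    qed
  qed
  have contS: "continuous_on X S" for X using A.continuous_T[of X] by (simp add: AT[abs_def])
  have cont_h: "continuous_on D h"
  proof -
    have "continuous_on D (\<lambda>z. if - s z \<le> 0 then u z else l z)"
    proof (rule continuous_on_cases_le)
      have "continuous_on {z \<in> D. - s z \<le> 0} A.\<phi>"
        by (rule continuous_on_subset[OF A.continuous_\<phi>]) (use UA in auto)
      then show "continuous_on {z \<in> D. - s z \<le> 0} u"
        unfolding u_def[abs_def] using a0 by (intro continuous_intros contS) auto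
      have "continuous_on {z \<in> D. 0 \<le> - s z} (\<lambda>z. B.\<phi> (cnj z))"
        by (rule continuous_on_compose2[OF B.continuous_\<phi>]) (use LB in \<open>auto intro!:
            continuous_intros\<close>)
      then show "continuous_on {z \<in> D. 0 \<le> - s z} l"
        unfolding l_def[abs_def] using a0 by (intro continuous_intros contS) auto
      have "continuous_on D (\<lambda>z. \<eta> (norm z))"
        by (rule continuous_on_compose2[OF eta]) (use A.eps in \<open>auto simp: D_def intro!:
            continuous_intros\<close>)
      then show "continuous_on D (\<lambda>z. - s z)"
        unfolding s_def[abs_def] by (intro continuous_intros)
      show "u z = l z" if "z \<in> D" "- s z = 0" for z using eqGamma[of z] that by simp
    qed
    then show ?thesis by (rule continuous_on_eq) (auto simp: h_def D_def)
  qed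
  have norm_h: "norm (h z) = norm (S z)" if "z \<in> D" for z
    using that by (auto simp: h_def u_def l_def norm_mult D_def)
  have f0: "S 0 = 0" using A.n1 A.K0 A.b0 by (simp add: S_def f complex_eq_iff power_0_left)
  have cont: "continuous_on (ball 0 \<epsilon>') h"
  proof -
    have "isCont h z" if "z \<in> ball 0 \<epsilon>'" for z
    proof (cases "z = 0")
      case False
      have "open D" by (auto simp: D_def intro: open_delete)
      then show ?thesis using cont_h that False by (simp add: continuous_on_eq_continuous_at D_def)
    next
      \<comment> \<open>The angle has no limit at 0, but the modulus of h is that of S, which tends
        to 0.\<close>
      case True
      have "(S \<longlongrightarrow> 0) (at 0)"
      proof -
        have "isCont S 0" using contS[of UNIV] continuous_on_eq_continuous_at[OF open_UNIV] by blast
        then show ?thesis using f0 by (simp add: isCont_def)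
      qed
      then have "((\<lambda>z. norm (S z)) \<longlongrightarrow> 0) (at 0)" by (rule tendsto_norm_zero)
      moreover have "eventually (\<lambda>z. norm (h z) = norm (S z)) (at 0)"
      proof -
        have "eventually (\<lambda>z. z \<in> ball 0 \<epsilon>' \<and> z \<noteq> 0) (at (0::complex))"
          using A.eps(1) by (auto simp: eventually_at intro!: exI[of _ \<epsilon>'])
        then show ?thesis by eventually_elim (auto intro!: norm_h simp: D_def)
      qed
      ultimately have "((\<lambda>z. norm (h z)) \<longlongrightarrow> 0) (at 0)"
        using tendsto_cong[of "\<lambda>z. norm (h z)" "\<lambda>z. norm (S z)" "at 0"] by blast
      then have "(h \<longlongrightarrow> 0) (at 0)" by (rule tendsto_norm_zero_cancel)
      then show ?thesis using True by (simp add: isCont_def h_def)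
    qed
    then show ?thesis by (simp add: continuous_at_imp_continuous_on)
  qed
  have upper: "h z = u z" if "z \<in> D" "0 \<le> s z" for z using that by (auto simp: h_def D_def)
  have lower: "h z = l z" if "z \<in> D" "s z \<le> 0" for z
    using that eqGamma[OF that(1)] by (auto simp: h_def D_def)
  have Im_u: "0 \<le> Im (u z)" if "z \<in> D" "0 \<le> s z" for z
    using Arange[OF UA] that by (auto simp: u_def intro!: mult_nonneg_nonneg sin_ge_zero)
  have Im_l: "Im (l z) \<le> 0" if "z \<in> D" "s z \<le> 0" for z
    using Brange[OF LB[OF that(1)]] that by (auto simp: l_def intro!: mult_nonneg_nonneg
        sin_ge_zero)
  have SA: "S z = of_real (norm (S z)) * cis (A.\<phi> z)" if "z \<in> D" "0 \<le> s z" for z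
    using A.T_cis_\<phi>[OF UA[OF that(1)]] that(2) by (simp add: AT)
  have SB: "S z = of_real (norm (S z)) * cis (B.\<phi> (cnj z))" if "z \<in> D" "s z \<le> 0" for z
    using B.T_cis_\<phi>[OF LB[OF that(1)]] that(2) by (simp add: BT)
  have inj_u: "z = w" if "z \<in> D" "w \<in> D" "0 \<le> s z" "0 \<le> s w" "u z = u w" for z w
  proof -
    have zw: "z \<in> A.half_region" "w \<in> A.half_region" using UA that by auto
    have n: "norm (S z) = norm (S w)" using arg_cong[OF that(5), of norm] by (simp add: u_def
        norm_mult)
    then have "cis (A.\<phi> z / real a) = cis (A.\<phi> w / real a)" using that(5) S0[OF that(2)] by (simp
        add: u_def)
    then have "A.\<phi> z / real a = A.\<phi> w / real a" using Arange zw by (intro cis_inj_half) auto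
    then have "A.\<phi> z = A.\<phi> w" using a0 by simp
    moreover from this have "A.T z = A.T w" using SA[OF that(1,3)] SA[OF that(2,4)] n by (metis AT)
    ultimately show ?thesis using A.\<phi>_inj[OF zw] by blast
  qed
  have inj_l: "z = w" if "z \<in> D" "w \<in> D" "s z \<le> 0" "s w \<le> 0" "l z = l w" for z w
  proof -
    have zw: "cnj z \<in> B.half_region" "cnj w \<in> B.half_region" using LB that by auto
    have n: "norm (S z) = norm (S w)" using arg_cong[OF that(5), of norm] by (simp add: l_def
        norm_mult)
    then have "cis (- B.\<phi> (cnj z) / real a') = cis (- B.\<phi> (cnj w) / real a')" using that(5) S0[OF
        that(2)] by (simp add: l_def)
    then have "cis (B.\<phi> (cnj z) / real a') = cis (B.\<phi> (cnj w) / real a')"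
      by (simp add: complex_eq_iff)
    then have "B.\<phi> (cnj z) / real a' = B.\<phi> (cnj w) / real a'" using Brange zw by (intro
        cis_inj_half) auto
    then have "B.\<phi> (cnj z) = B.\<phi> (cnj w)" using a0 by simp
    moreover from this have "B.T (cnj z) = B.T (cnj w)" using SB[OF that(1,3)] SB[OF that(2,4)] n by
        (metis BT)
    ultimately have "cnj z = cnj w" using B.\<phi>_inj[OF zw] by blast
    then show ?thesis by simp
  qed
  \<comment> \<open>The image of the upper side lies in the closed upper half-plane. It is real only
    if \<phi> is 0 or a pi, that is, on the critical curve; this separates the images of the two
    sides.\<close>
  have real_upper: "s z = 0" if "z \<in> D" "0 \<le> s z" "Im (u z) \<le> 0" for z
  proof -
    have z: "z \<in> A.half_region" using UA that by simp
    have "Im (u z) = 0" using Im_u[OF that(1,2)] that(3) by simp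
    then have "sin (A.\<phi> z / real a) = 0" using S0[OF that(1)] by (simp add: u_def)
    then have "A.\<phi> z / real a = 0 \<or> A.\<phi> z / real a = pi"
      using Arange[OF z] sin_gt_zero[of "A.\<phi> z / real a"] by linarith
    then have "A.bdry z" using A.\<phi>_range(3,4)[OF z] a0 by (auto simp: divide_eq_eq mult.commute)
    then show ?thesis by (simp add: A.bdry_def s_def)
  qed
  have "inj_on h (ball 0 \<epsilon>')"
  proof (rule inj_onI)
    fix z w assume zw: "z \<in> ball 0 \<epsilon>'" "w \<in> ball 0 \<epsilon>'" "h z = h w"
    have hn: "h x \<noteq> 0" if "x \<in> D" for x using norm_h[OF that] S0[OF that] by auto
    have main: "z = w" if zw: "z \<in> D" "w \<in> D" "h z = h w" "0 \<le> s z" for z w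
    proof (cases "0 \<le> s w")
      case True
      then show ?thesis using inj_u zw upper by metis
    next
      case False
      then have "u z = l w" using zw upper[of z] lower[of w] by simp
      then have "s z = 0" using real_upper[OF zw(1,4)] Im_l[OF zw(2)] False by simp
      then show ?thesis using inj_l[OF zw(1,2)] zw(3) lower[OF zw(1)] lower[OF zw(2)] False by simp
    qed
    show "z = w"
    proof (cases "z = 0 \<or> w = 0")
      case True
      have h0: "h 0 = 0" by (simp add: h_def)
      show ?thesis
      proof (cases "z = 0")
        case True
        then have "w \<notin> D" using hn[of w] zw(3) h0 by auto
        then show ?thesis using True zw(2) by (simp add: D_def)
      next
        case False
        with True have "w = 0" by simp
        then have "z \<notin> D" using hn[of z] zw(3) h0 by auto
        then show ?thesis using \<open>w = 0\<close> zw(1) by (simp add: D_def)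
      qed
    next
      case False
      then have d: "z \<in> D" "w \<in> D" using zw by (auto simp: D_def)
      consider "0 \<le> s z" | "0 \<le> s w" | "s z \<le> 0" "s w \<le> 0" by linarith
      then show ?thesis
      proof cases
        case 1 then show ?thesis using main[OF d zw(3)] by blast
      next
        case 2 then show ?thesis using main[OF d(2,1) zw(3)[symmetric]] by simp
      next
        case 3 then show ?thesis using inj_l[OF d] zw(3) lower[OF d(1)] lower[OF d(2)] by simp
      qed
    qed
  qed
  show ?thesis
  proof (rule topological_model_exists[where ?h1.0 = h and b = b and f = f and \<epsilon> = \<epsilon>'])
    show "0 < \<epsilon>'" by (rule A.eps(1))
    show "continuous_on (ball 0 \<epsilon>') h" "inj_on h (ball 0 \<epsilon>')" by fact+
    show "h 0 = 0" by (simp add: h_def)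
    show "continuous_on UNIV b" by (rule A.b_cont)
    show "shear b (f 0) = 0" using f0 by (simp add: S_def)
    fix z :: complex assume zb: "z \<in> ball 0 \<epsilon>'"
    show "h z \<noteq> - (of_real c * z)" if "z \<noteq> 0" "0 \<le> c" for c
    proof (cases "0 \<le> s z")
      case True
      have d: "z \<in> D" using zb that by (simp add: D_def)
      show ?thesis using A.T_cis_not_opposite[OF UA[OF d] that(2)] upper[OF d True] True by (simp
          add: u_def AT)
    next
      case False
      have d: "z \<in> D" using zb that by (simp add: D_def)
      have "of_real (norm (S z)) * cis (B.\<phi> (cnj z) / real a') \<noteq> - (of_real c * cnj z)"
        using B.T_cis_not_opposite[OF LB[OF d] that(2)] False by (simp add: BT)
      moreover have "cnj (l z) = of_real (norm (S z)) * cis (B.\<phi> (cnj z) / real a')"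
        by (simp add: l_def cis_cnj)
      ultimately have "cnj (l z) \<noteq> cnj (- (of_real c * z))" by simp
      then have "l z \<noteq> - (of_real c * z)" by metis
      then show ?thesis using lower[OF d] False by simp
    qed
    have zero: "S z = of_real r * cis x" if "z = 0" "h z = of_real r * cis \<theta>" for r \<theta> x
    proof -
      have "of_real r * cis \<theta> = 0" using that by (simp add: h_def)
      then have "r = 0" by simp
      then show ?thesis using that f0 by simp
    qed
    show "shear b (f z) = of_real r * cis (real a * \<theta>)"
      if r: "0 \<le> r" "0 \<le> \<theta>" "\<theta> \<le> pi" "h z = of_real r * cis \<theta>" for r \<theta>
    proof (cases "z = 0")
      case True
      then show ?thesis using zero[OF True r(4)] by (simp add: S_def)
    next
      case False
      then have d: "z \<in> D" using zb by (simp add: D_def)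
      have rn: "r = norm (S z)" using norm_h[OF d] r by (simp add: norm_mult)
      then have r0: "0 < r" using S0[OF d] by simp
      have "0 \<le> s z"
      proof (rule ccontr)
        assume neg: "\<not> 0 \<le> s z"
        have zB: "cnj z \<in> B.half_region" using LB[OF d] neg by simp
        have "l z = of_real r * cis (- (B.\<phi> (cnj z) / real a'))" by (simp add: l_def rn)
        moreover have "h z = l z" using lower[OF d] neg by simp
        ultimately have "of_real r * cis \<theta> = of_real r * cis (- (B.\<phi> (cnj z) / real a'))"
          using r(4) by metis
        then have c: "cis \<theta> = cis (- (B.\<phi> (cnj z) / real a'))" using r0 by simp
        have "sin \<theta> = - sin (B.\<phi> (cnj z) / real a')" using arg_cong[OF c, of Im] by simp
        moreover have "0 \<le> sin \<theta>" "0 \<le> sin (B.\<phi> (cnj z) / real a')"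
          using r Brange[OF zB] by (auto intro!: sin_ge_zero)
        ultimately have "sin (B.\<phi> (cnj z) / real a') = 0" by simp
        then have "B.\<phi> (cnj z) / real a' = 0 \<or> B.\<phi> (cnj z) / real a' = pi"
          using Brange[OF zB] sin_gt_zero[of "B.\<phi> (cnj z) / real a'"] by linarith
        then have "B.bdry (cnj z)" using B.\<phi>_range(3,4)[OF zB] a0 by (auto simp: divide_eq_eq
            mult.commute)
        then show False using neg by (simp add: B.bdry_def s_def)
      qed
      then have zA: "z \<in> A.half_region" using UA[OF d] by simp
      have "u z = of_real r * cis (A.\<phi> z / real a)" by (simp add: u_def rn)
      then have "of_real r * cis \<theta> = of_real r * cis (A.\<phi> z / real a)"
        using r(4) upper[OF d \<open>0 \<le> s z\<close>] by metis
      then have "cis \<theta> = cis (A.\<phi> z / real a)" using r0 by simp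
      then have "\<theta> = A.\<phi> z / real a" using Arange[OF zA] r by (intro cis_inj_half)
      then have "real a * \<theta> = A.\<phi> z" using a0 by simp
      then show ?thesis using SA[OF d \<open>0 \<le> s z\<close>] rn by (simp add: S_def)
    qed
    show "shear b (f z) = of_real r * cis (- real a' * \<theta>)"
      if r: "0 \<le> r" "pi \<le> \<theta>" "\<theta> \<le> 2 * pi" "h z = of_real r * cis \<theta>" for r \<theta>
    proof (cases "z = 0")
      case True
      then show ?thesis using zero[OF True r(4)] by (simp add: S_def)
    next
      case False
      then have d: "z \<in> D" using zb by (simp add: D_def)
      have rn: "r = norm (S z)" using norm_h[OF d] r by (simp add: norm_mult)
      then have r0: "0 < r" using S0[OF d] by simp
      have "sin \<theta> \<le> 0" using r sin_ge_zero[of "\<theta> - pi"] by (simp add: sin_diff)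
      have "s z \<le> 0"
      proof (rule ccontr)
        assume pos: "\<not> s z \<le> 0"
        have "Im (u z) = r * sin \<theta>" using r(4) upper[OF d] pos by simp
        then have "Im (u z) \<le> 0" using \<open>sin \<theta> \<le> 0\<close> r0 by (simp add: mult_le_0_iff)
        then show False using real_upper[OF d] pos by simp
      qed
      then have zB: "cnj z \<in> B.half_region" using LB[OF d] by simp
      have "l z = of_real r * cis (- (B.\<phi> (cnj z) / real a'))" by (simp add: l_def rn)
      then have "of_real r * cis \<theta> = of_real r * cis (- (B.\<phi> (cnj z) / real a'))"
        using r(4) lower[OF d \<open>s z \<le> 0\<close>] by metis
      then have "cis \<theta> = cis (- (B.\<phi> (cnj z) / real a'))" using r0 by simp
      \<comment> \<open>Passing to 2 pi - \<theta> brings both angles into [0, pi], where the cosine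
        determines them; the a' full turns drop out below.\<close>
      then have "cis (2 * pi - \<theta>) = cis (B.\<phi> (cnj z) / real a')"
        by (simp add: complex_eq_iff cos_diff sin_diff)
      then have "2 * pi - \<theta> = B.\<phi> (cnj z) / real a'" using Brange[OF zB] r by (intro cis_inj_half)
          auto
      then have "B.\<phi> (cnj z) = real a' * (2 * pi - \<theta>)" using a0 by (simp add: field_simps)
      also have "real a' * (2 * pi - \<theta>) = real a' * 2 * pi + - real a' * \<theta>" by (simp add:
          algebra_simps)
      finally have "cis (B.\<phi> (cnj z)) = cis (real a' * 2 * pi + - real a' * \<theta>)" by (rule arg_cong)
      also have "\<dots> = cis (- real a' * \<theta>)"
      proof -
        have "cis (real a' * 2 * pi) = 1"
          using cos_int_2pin[of "int a'"] sin_int_2pin[of "int a'"] by (simp add: complex_eq_iff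
              mult_ac)
        then show ?thesis by (simp only: cis_mult[symmetric]) simp
      qed
      finally show ?thesis using SB[OF d \<open>s z \<le> 0\<close>] rn by (simp add: S_def)
    qed
  qed
qed

section \<open>Realizing the topological models\<close>

text \<open>\<beta> carries the factor s so that conjugation turns s into -s; the two sides of the
  critical curve then belong to one family.\<close>

definition twisted :: "nat \<Rightarrow> real \<Rightarrow> nat \<Rightarrow> real \<Rightarrow> nat \<Rightarrow> real \<Rightarrow> complex \<Rightarrow> complex" where
  "twisted n \<alpha> p \<beta> q s z = cis (s * pi / 2) * (of_real \<alpha> * z ^ p + \<i> * of_real (s * \<beta>) * z ^ q)"

text \<open>G is the first component along the right branch of the critical curve. It is strictly
  increasing because n arcsin (\<eta> r) stays below pi / 2, so its inverse parametrizes the branch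
  by the first component; b is Re K along it, extended evenly.\<close>

lemma fold_function_exists:
  fixes K :: "complex \<Rightarrow> complex"
  assumes n: "1 \<le> n" and d: "\<delta> = -1 \<or> \<delta> = 0 \<or> \<delta> = 1" and K: "continuous_on UNIV K" "K 0 = 0"
    and eps: "0 < \<epsilon>" and eta: "continuous_on {0..<\<epsilon>} \<eta>" "\<eta> 0 = 0"
    and mono: "\<And>r s. 0 < r \<Longrightarrow> r \<le> s \<Longrightarrow> s < \<epsilon> \<Longrightarrow> \<eta> r \<le> \<eta> s"
    and pos: "\<And>r. 0 < r \<Longrightarrow> r < \<epsilon> \<Longrightarrow> 0 < \<eta> r"
    and small: "\<And>r. 0 < r \<Longrightarrow> r < \<epsilon> \<Longrightarrow> \<eta> r < sin (pi / (2 * real n))"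
  shows "\<exists>\<epsilon>' b. 0 < \<epsilon>' \<and> \<epsilon>' \<le> \<epsilon> \<and> continuous_on UNIV b \<and> b 0 = 0 \<and> (\<forall>p. b (- p) = b p) \<and>
    (\<forall>p. 0 < p \<and> p < \<epsilon>' ^ n \<longrightarrow> (\<exists>r. 0 < r \<and> r < \<epsilon> \<and>
        r ^ n * cos (real n * (- \<delta> * arcsin (\<eta> r)) + \<delta> * pi / 2) = p \<and>
        b p = Re (K (of_real r * cis (- \<delta> * arcsin (\<eta> r))))))"
proof -
  \<comment> \<open>A compact interval inside the half-open one, on which a continuous injection has
    a continuous inverse.\<close>
  define e where "e = \<epsilon> / 2"
  have e: "0 < e" "e < \<epsilon>" using eps by (auto simp: e_def)
  define m where "m = pi / (2 * real n)"
  have m: "0 < m" "m \<le> pi / 2" "real n * m = pi / 2" using n by (auto simp: m_def field_simps)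
  define \<alpha> where "\<alpha> r = arcsin (\<eta> r)" for r
  define G where "G r = r ^ n * cos (real n * (- \<delta> * \<alpha> r) + \<delta> * pi / 2)" for r
  define B where "B r = Re (K (of_real r * cis (- \<delta> * \<alpha> r)))" for r
  have eta01: "0 \<le> \<eta> r" "\<eta> r < 1" if "0 \<le> r" "r \<le> e" for r
  proof -
    have "0 \<le> \<eta> r \<and> \<eta> r < 1"
    proof (cases "r = 0")
      case False
      then have "0 < \<eta> r" "\<eta> r < sin (pi / (2 * real n))" using that pos[of r] small[of r] e by auto
      then show ?thesis using sin_le_one[of "pi / (2 * real n)"] by linarith
    qed (simp add: eta(2))
    then show "0 \<le> \<eta> r" "\<eta> r < 1" by auto
  qed
  have al: "0 < \<alpha> r" "\<alpha> r < m" if "0 < r" "r \<le> e" for r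
  proof -
    have b: "0 < \<eta> r" "\<eta> r < sin m" "\<eta> r < 1" using that pos[of r] small[of r] eta01[of r] e by
        (auto simp: m_def)
    then show "0 < \<alpha> r" using arcsin_less_mono[of 0 "\<eta> r"] by (simp add: \<alpha>_def)
    have "arcsin (\<eta> r) < arcsin (sin m)" using b by (subst arcsin_less_mono) auto
    then show "\<alpha> r < m" using m by (simp add: \<alpha>_def arcsin_sin)
  qed
  have al_mono: "\<alpha> r \<le> \<alpha> s" if "0 < r" "r \<le> s" "s \<le> e" for r s
    unfolding \<alpha>_def using that mono[of r s] eta01[of r] eta01[of s] e by (intro arcsin_le_arcsin)
        auto
  have ca: "continuous_on {0..e} \<alpha>"
    unfolding \<alpha>_def
    by (intro continuous_on_arcsin continuous_on_subset[OF eta(1)] ballI)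
      (use e eta01 in \<open>auto intro: less_imp_le order_trans[of "-1" 0]\<close>)
  have cG: "continuous_on {0..e} G" unfolding G_def by (intro continuous_intros ca)
  have cB: "continuous_on {0..e} B"
  proof -
    have "continuous_on {0..e} (\<lambda>r. K (of_real r * cis (- \<delta> * \<alpha> r)))"
      by (rule continuous_on_compose2[OF K(1)]) (auto intro!: continuous_intros ca)
    then show ?thesis unfolding B_def by (intro continuous_intros)
  qed
  have sinpos: "0 < cos (real n * (- \<delta> * \<alpha> r) + \<delta> * pi / 2)" if "0 < r" "r \<le> e" for r
  proof -
    have "0 < real n * \<alpha> r" "real n * \<alpha> r < real n * m" using al[OF that] n by simp_all
    then show ?thesis unfolding m(3) using d by (intro cos_gt_zero_pi) auto
  qed
  have cosmono: "cos (real n * (- \<delta> * \<alpha> r) + \<delta> * pi / 2) \<le> cos (real n * (- \<delta> * \<alpha> s) + \<delta> * pi / 2)"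
    if rs: "0 < r" "r \<le> s" "s \<le> e" for r s
  proof -
    have "0 < real n * \<alpha> r" "real n * \<alpha> r \<le> real n * \<alpha> s" "real n * \<alpha> s < real n * m"
      using al[of r] al[of s] al_mono[OF rs] rs n by simp_all
    then have sm: "sin (real n * \<alpha> r) \<le> sin (real n * \<alpha> s)"
      unfolding m(3) by (intro sin_monotone_2pi_le) auto
    from d show ?thesis
    proof (elim disjE)
      assume "\<delta> = -1"
      then show ?thesis using sm by (simp add: cos_diff)
    next
      assume "\<delta> = 1"
      then show ?thesis using sm by (simp add: cos_add cos_diff)
    qed simp
  qed
  have G0: "G 0 = 0" using n by (simp add: G_def)
  have Gpos: "0 < G r" if "0 < r" "r \<le> e" for r using sinpos[OF that] that by (simp add: G_def)
  have Gmono: "G r < G s" if "0 \<le> r" "r < s" "s \<le> e" for r s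
  proof (cases "r = 0")
    case True
    then show ?thesis using G0 Gpos[of s] that by simp
  next
    case False
    then have "G r \<le> r ^ n * cos (real n * (- \<delta> * \<alpha> s) + \<delta> * pi / 2)"
      unfolding G_def using that cosmono[of r s] by (intro mult_left_mono) auto
    also have "\<dots> < G s"
      unfolding G_def using that n sinpos[of s] by (intro mult_strict_right_mono power_strict_mono)
          auto
    finally show ?thesis .
  qed
  define M where "M = G e"
  have M: "0 < M" using Gpos[of e] e by (simp add: M_def)
  have img: "G ` {0..e} = {0..M}"
  proof (intro equalityI subsetI)
    fix y assume "y \<in> G ` {0..e}"
    then obtain r where r: "0 \<le> r" "r \<le> e" "y = G r" by auto
    have "0 \<le> G r" using Gpos[of r] G0 r by (cases "r = 0") auto
    moreover have "G r \<le> M" unfolding M_def using Gmono[of r e] r by (cases "r = e") auto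
    ultimately show "y \<in> {0..M}" using r by simp
  next
    fix y assume "y \<in> {0..M}"
    then obtain r where "0 \<le> r" "r \<le> e" "G r = y"
      using IVT'[of G 0 y e] cG G0 e by (auto simp: M_def)
    then show "y \<in> G ` {0..e}" by auto
  qed
  have injG: "inj_on G {0..e}"
  proof (rule inj_onI)
    fix r s assume "r \<in> {0..e}" "s \<in> {0..e}" "G r = G s"
    then show "r = s" using Gmono[of r s] Gmono[of s r] by (cases r s rule: linorder_cases) auto
  qed
  define g where "g = the_inv_into {0..e} G"
  have gG: "g (G r) = r" if "r \<in> {0..e}" for r unfolding g_def using the_inv_into_f_f[OF injG that]
      .
  have cg: "continuous_on {0..M} g"
    unfolding img[symmetric] g_def by (rule continuous_on_inv_into[OF cG _ injG]) simp
  have gr: "g y \<in> {0..e}" "G (g y) = y" if yM: "y \<in> {0..M}" for y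
  proof -
    obtain r where "r \<in> {0..e}" "y = G r" using yM unfolding img[symmetric] by blast
    then show "g y \<in> {0..e}" "G (g y) = y" using gG by auto
  qed
  \<comment> \<open>The minimum with M continues b as a constant beyond the range of G; \<epsilon>'
    keeps all relevant p below M.\<close>
  define b where "b p = B (g (min \<bar>p\<bar> M))" for p
  define \<epsilon>' where "\<epsilon>' = min e (root n M)"
  show ?thesis
  proof (rule exI[of _ \<epsilon>'], rule exI[of _ b], intro conjI allI impI)
    show "0 < \<epsilon>'" using e M n by (simp add: \<epsilon>'_def)
    show "\<epsilon>' \<le> \<epsilon>" using e by (simp add: \<epsilon>'_def)
    have "continuous_on UNIV (\<lambda>p. g (min \<bar>p\<bar> M))"
      by (rule continuous_on_compose2[OF cg]) (use M in \<open>auto intro!: continuous_intros\<close>)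
    then show "continuous_on UNIV b"
      unfolding b_def by (rule continuous_on_compose2[OF cB]) (use gr M in auto)
    have "g 0 = 0" using gG[of 0] G0 e by simp
    then show "b 0 = 0" using M K(2) by (simp add: b_def B_def)
    show "b (- p) = b p" for p by (simp add: b_def)
    fix p :: real assume p: "0 < p \<and> p < \<epsilon>' ^ n"
    have "\<epsilon>' ^ n \<le> root n M ^ n" using e M n by (intro power_mono) (auto simp: \<epsilon>'_def)
    also have "\<dots> = M" using M n by simp
    finally have pM: "p \<in> {0..M}" using p by simp
    have "g p \<noteq> 0" using gr(2)[OF pM] G0 p by auto
    then have "0 < g p" "g p < \<epsilon>" using gr(1)[OF pM] e by auto
    moreover have "b p = B (g p)" using pM by (simp add: b_def)
    ultimately show "\<exists>r. 0 < r \<and> r < \<epsilon> \<and> r ^ n * cos (real n * (- \<delta> * arcsin (\<eta> r)) + \<delta> * pi / 2) =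
        p \<and>
        b p = Re (K (of_real r * cis (- \<delta> * arcsin (\<eta> r))))"
      using gr(2)[OF pM] by (intro exI[of _ "g p"]) (auto simp: G_def B_def \<alpha>_def)
  qed
qed

lemma twisted_cnj: "twisted n \<alpha> p \<beta> q (- s) z = cnj (twisted n \<alpha> p \<beta> q s (cnj z))"
  by (simp add: twisted_def cis_cnj)

text \<open>p has the parity opposite to n and q the same, so the two powers change by opposite
  signs, as they do under conjugation because of the factor i. The remaining common sign is absorbed
  by cis (s pi / 2), since a is odd.\<close>

lemma twisted_reflect:
  assumes a: "real a = real n + s" "odd a" and pq: "even p \<longleftrightarrow> odd n" "even q \<longleftrightarrow> even n"
  shows "twisted n \<alpha> p \<beta> q s (- cnj z) = cnj (twisted n \<alpha> p \<beta> q s z)"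
proof -
  have an: "cis (real a * pi) = -1" using a(2) by (simp add: complex_eq_iff)
  have "(-1 :: complex) ^ n = cis (real n * pi)"
    using Complex.DeMoivre[of pi n] by (simp add: cis_pi)
  moreover have "cis (s * pi / 2) * cis (real n * pi) = cis (real a * pi) * cis (- (s * pi / 2))"
    unfolding cis_mult by (rule arg_cong[of _ _ cis]) (simp add: a(1) algebra_simps)
  ultimately have E: "cis (s * pi / 2) * (-1) ^ n = - cis (- (s * pi / 2))" unfolding an by simp
  have P: "(- cnj z) ^ p = - ((-1) ^ n) * cnj z ^ p" "(- cnj z) ^ q = (-1) ^ n * cnj z ^ q"
    using pq by (cases "even n"; simp add: power_minus[of "cnj z"])+
  have "twisted n \<alpha> p \<beta> q s (- cnj z) = (cis (s * pi / 2) * (-1) ^ n) * (- of_real \<alpha> * cnj z ^ p + \<i>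
      * of_real (s * \<beta>) * cnj z ^ q)"
    unfolding twisted_def P by (simp add: algebra_simps)
  also have "\<dots> = cnj (twisted n \<alpha> p \<beta> q s z)"
    unfolding E twisted_def by (simp add: cis_cnj algebra_simps)
  finally show ?thesis .
qed

text \<open>The two sides are half models for \<delta> and -\<delta>, and stating \<open>dK\<close>
  and \<open>sgn\<close> for general s covers both. One b serves them: conjugation carries the
  critical curve of one to that of the other, with the same values of both components.\<close>

lemma twisted_model:
  assumes n: "1 \<le> n" and d: "\<delta> = -1 \<or> \<delta> = 0 \<or> \<delta> = 1" and n2: "\<delta> \<noteq> 0 \<Longrightarrow> 2 \<le> n"
    and a: "real a = real n + \<delta>" "odd a" and a': "real a' = real n - \<delta>" "odd a'"
    and pq: "1 \<le> p" "1 \<le> q" "even p \<longleftrightarrow> odd n" "even q \<longleftrightarrow> even n"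
    and eps: "0 < \<epsilon>" and eta: "continuous_on {0..<\<epsilon>} \<eta>" "\<eta> 0 = 0"
    and mono: "\<And>r s. 0 < r \<Longrightarrow> r \<le> s \<Longrightarrow> s < \<epsilon> \<Longrightarrow> \<eta> r \<le> \<eta> s"
    and pos: "\<And>r. 0 < r \<Longrightarrow> r < \<epsilon> \<Longrightarrow> 0 < \<eta> r"
    and small: "\<And>r. 0 < r \<Longrightarrow> r < \<epsilon> \<Longrightarrow> \<eta> r < sin (pi / (2 * real n))"
    and dK: "\<And>s z. z \<noteq> 0 \<Longrightarrow> (twisted n \<alpha> p \<beta> q s has_field_derivative \<kappa> s z * (of_nat n * cis (s * pi
        / 2) * z ^ (n - 1))) (at z)"
    and sgn: "\<And>s r t. s = -1 \<or> s = 0 \<or> s = 1 \<Longrightarrow> 0 < r \<Longrightarrow> r < \<epsilon> \<Longrightarrow> - s * \<eta> r < sin t \<Longrightarrow> Im (\<kappa> s (of_real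
        r * cis t)) < 0"
  shows "\<exists>\<Delta> h1 g1 h2 g2. 0 \<in> \<Delta> \<and> \<Delta> \<subseteq> UNIV \<and>
        op_homeomorphism \<Delta> (ball 0 1) h1 g1 \<and> h1 0 = 0 \<and>
        op_homeomorphism UNIV UNIV h2 g2 \<and> h2 (poly_pair (cis (\<delta> * pi / 2)) n \<alpha> p (\<delta> * \<beta>) q 0) = 0 \<and>
        (\<forall>r \<theta>. 0 \<le> r \<and> r < 1 \<and> 0 \<le> \<theta> \<and> \<theta> \<le> pi \<longrightarrow>
           h2 (poly_pair (cis (\<delta> * pi / 2)) n \<alpha> p (\<delta> * \<beta>) q (g1 (of_real r * cis \<theta>))) = of_real r *
               cis (real a * \<theta>)) \<and>
        (\<forall>r \<theta>. 0 \<le> r \<and> r < 1 \<and> pi \<le> \<theta> \<and> \<theta> \<le> 2 * pi \<longrightarrow>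
           h2 (poly_pair (cis (\<delta> * pi / 2)) n \<alpha> p (\<delta> * \<beta>) q (g1 (of_real r * cis \<theta>))) = of_real r *
               cis (- real a' * \<theta>))"
proof -
  let ?K = "twisted n \<alpha> p \<beta> q"
  have hol: "?K s holomorphic_on UNIV" for s
    unfolding twisted_def[abs_def] by (intro holomorphic_intros)
  have K0: "?K s 0 = 0" for s using pq(1,2) by (simp add: twisted_def power_0_left)
  have "\<exists>\<epsilon>' b. 0 < \<epsilon>' \<and> \<epsilon>' \<le> \<epsilon> \<and> continuous_on UNIV b \<and> b 0 = 0 \<and> (\<forall>p. b (- p) = b p) \<and>
    (\<forall>p. 0 < p \<and> p < \<epsilon>' ^ n \<longrightarrow> (\<exists>r. 0 < r \<and> r < \<epsilon> \<and>
        r ^ n * cos (real n * (- \<delta> * arcsin (\<eta> r)) + \<delta> * pi / 2) = p \<and>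
        b p = Re (?K \<delta> (of_real r * cis (- \<delta> * arcsin (\<eta> r))))))"
    by (rule fold_function_exists[OF n d holomorphic_on_imp_continuous_on[OF hol] K0 eps eta]) (fact
        mono pos small)+
  then obtain \<epsilon>' b where b: "0 < \<epsilon>'" "\<epsilon>' \<le> \<epsilon>" "continuous_on UNIV b" "b 0 = 0" "\<forall>p. b (- p) = b p"
    "\<forall>p. 0 < p \<and> p < \<epsilon>' ^ n \<longrightarrow> (\<exists>r. 0 < r \<and> r < \<epsilon> \<and>
        r ^ n * cos (real n * (- \<delta> * arcsin (\<eta> r)) + \<delta> * pi / 2) = p \<and>
        b p = Re (?K \<delta> (of_real r * cis (- \<delta> * arcsin (\<eta> r)))))"
    by (elim exE conjE) (rule that)
  have H1: "half_model n a \<delta> \<epsilon> \<epsilon>' (?K \<delta>) (\<kappa> \<delta>) \<eta> b"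
  proof
    show "Re (?K \<delta> (- cnj z)) = Re (?K \<delta> z)" for z
      unfolding twisted_reflect[OF a pq(3,4)] by simp
    show "b (- p) = b p" for p using b(5) by blast
    show "\<exists>r. 0 < r \<and> r < \<epsilon> \<and> r ^ n * cos (real n * (- \<delta> * arcsin (\<eta> r)) + \<delta> * pi / 2) = p \<and>
        b p = Re (?K \<delta> (of_real r * cis (- \<delta> * arcsin (\<eta> r))))" if "0 < p" "p < \<epsilon>' ^ n" for p
      using b(6) that by blast
    show "Im (\<kappa> \<delta> (of_real r * cis t)) < 0" if "0 < r" "r < \<epsilon>" "- \<delta> * \<eta> r < sin t" for r t
      by (rule sgn[OF d that])
  qed (fact n d n2 a b(1-4) mono pos small hol K0 dK)+
  have H2: "half_model n a' (- \<delta>) \<epsilon> \<epsilon>' (?K (- \<delta>)) (\<kappa> (- \<delta>)) \<eta> b"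
  proof
    show "Re (?K (- \<delta>) (- cnj z)) = Re (?K (- \<delta>) z)" for z
    proof -
      have "real a' = real n + - \<delta>" using a'(1) by simp
      from twisted_reflect[OF this a'(2) pq(3,4)] show ?thesis by simp
    qed
    show "- \<delta> = -1 \<or> - \<delta> = 0 \<or> - \<delta> = 1" using d by auto
    show "\<exists>r. 0 < r \<and> r < \<epsilon> \<and> r ^ n * cos (real n * (- (- \<delta>) * arcsin (\<eta> r)) + - \<delta> * pi / 2) = p \<and>
        b p = Re (?K (- \<delta>) (of_real r * cis (- (- \<delta>) * arcsin (\<eta> r))))" if pp: "0 < p" "p < \<epsilon>' ^ n"
            for p
    proof -
      obtain r where r: "0 < r" "r < \<epsilon>" "r ^ n * cos (real n * (- \<delta> * arcsin (\<eta> r)) + \<delta> * pi / 2) =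
          p"
        "b p = Re (?K \<delta> (of_real r * cis (- \<delta> * arcsin (\<eta> r))))"
        using b(6) pp by blast
      have "cos (real n * (- (- \<delta>) * arcsin (\<eta> r)) + - \<delta> * pi / 2) = cos (real n * (- \<delta> * arcsin (\<eta>
          r)) + \<delta> * pi / 2)"
        by (subst cos_minus[symmetric]) (simp add: algebra_simps)
      moreover have "Re (?K (- \<delta>) (of_real r * cis (- (- \<delta>) * arcsin (\<eta> r)))) = Re (?K \<delta> (of_real r
          * cis (- \<delta> * arcsin (\<eta> r))))"
        unfolding twisted_cnj by (simp add: cis_cnj)
      ultimately show ?thesis using r by (intro exI[of _ r]) simp
    qed
    show "b (- p) = b p" for p using b(5) by blast
    show "Im (\<kappa> (- \<delta>) (of_real r * cis t)) < 0" if "0 < r" "r < \<epsilon>" "- (- \<delta>) * \<eta> r < sin t" for r t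
      by (rule sgn[OF _ that]) (use d in auto)
    show "real a' = real n + - \<delta>" using a'(1) by simp
    show "2 \<le> n" if "- \<delta> \<noteq> 0" using n2 that by simp
  qed (fact n a'(2) b(1-4) mono pos small hol K0 dK)+
  show ?thesis
  proof (rule half_models_glue[OF H1 H2])
    show "Re (?K (- \<delta>) z) = Re (?K \<delta> (cnj z))" for z unfolding twisted_cnj by simp
    show "continuous_on {0<..<\<epsilon>} \<eta>" by (rule continuous_on_subset[OF eta(1)]) auto
    show "poly_pair (cis (\<delta> * pi / 2)) n \<alpha> p (\<delta> * \<beta>) q z = Complex (Re (cis (\<delta> * pi / 2) * z ^ n))
        (Re (?K \<delta> z))" for z
      by (simp only: poly_pair_def re_pair_def twisted_def)
  qed
qed

text \<open>The positive root of $2r\eta^2+\eta=r$, that is, of $-\eta+r(1-2\eta^2)=0$ with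
  $\cos 2t=1-2\sin^2t$.\<close>

definition eta_Suc :: "real \<Rightarrow> real" where "eta_Suc r = 2 * r / (1 + sqrt (1 + 8 * r\<^sup>2))"

lemma eta_Suc:
  assumes "0 \<le> r"
  shows "2 * r * (eta_Suc r)\<^sup>2 + eta_Suc r = r" "0 \<le> eta_Suc r" "eta_Suc r \<le> r" "0 < r \<Longrightarrow> 0 < eta_Suc
      r"
proof -
  define w where "w = sqrt (1 + 8 * r\<^sup>2)"
  have w: "w\<^sup>2 = 1 + 8 * r\<^sup>2" "1 \<le> w" by (simp_all add: w_def)
  have e: "eta_Suc r = 2 * r / (1 + w)" by (simp add: eta_Suc_def w_def)
  have ew: "eta_Suc r * (1 + w) = 2 * r" using w(2) by (simp add: e)
  have "(2 * r * (eta_Suc r)\<^sup>2 + eta_Suc r) * (1 + w)\<^sup>2 = 2 * r * (eta_Suc r * (1 + w))\<^sup>2 + eta_Suc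
      r * (1 + w) * (1 + w)"
    by (simp add: power2_eq_square algebra_simps)
  also have "\<dots> = r * (8 * r\<^sup>2 + 2 + 2 * w)" unfolding ew by (simp add: power2_eq_square
      algebra_simps)
  also have "8 * r\<^sup>2 + 2 + 2 * w = (1 + w)\<^sup>2" using w(1) by (simp add: power2_eq_square
      algebra_simps)
  finally show "2 * r * (eta_Suc r)\<^sup>2 + eta_Suc r = r" using w(2) by simp
  show "0 \<le> eta_Suc r" "0 < r \<Longrightarrow> 0 < eta_Suc r" using assms w(2) by (simp_all add: e)
  have "r * 2 \<le> r * (1 + w)" using assms w(2) by (intro mult_left_mono) auto
  then show "eta_Suc r \<le> r" using w(2) by (simp add: e divide_le_eq)
qed

text \<open>In \<eta> = r (1 - 2 \<eta>^2) a smaller \<eta> at a larger radius would leave neither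
  factor on the right smaller, a contradiction.\<close>

lemma eta_Suc_mono:
  assumes "0 < r" "r \<le> s" "s < 1 / 4"
  shows "eta_Suc r \<le> eta_Suc s"
proof (rule ccontr)
  assume "\<not> ?thesis"
  then have lt: "eta_Suc s < eta_Suc r" by simp
  note er = eta_Suc[of r] and es = eta_Suc[of s]
  have sq: "(eta_Suc s)\<^sup>2 \<le> (eta_Suc r)\<^sup>2" using lt es assms by (intro power_mono) auto
  have "eta_Suc r \<le> 1 / 4" using er(3) assms by simp
  then have "(eta_Suc r)\<^sup>2 \<le> (1 / 4)\<^sup>2" using er(2) assms by (intro power_mono) auto
  then have p: "0 \<le> 1 - 2 * (eta_Suc r)\<^sup>2" by (simp add: power2_eq_square)
  have "eta_Suc r = r * (1 - 2 * (eta_Suc r)\<^sup>2)" using er(1) assms by (simp add: algebra_simps)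
  also have "\<dots> \<le> s * (1 - 2 * (eta_Suc r)\<^sup>2)" using p assms by (intro mult_right_mono) auto
  also have "\<dots> \<le> s * (1 - 2 * (eta_Suc s)\<^sup>2)" using sq assms by (intro mult_left_mono) auto
  also have "\<dots> = eta_Suc s" using es(1) assms by (simp add: algebra_simps)
  finally show False using lt by simp
qed

text \<open>By cos 2t = 1 - 2 sin^2 t this is a polynomial in u = sin t with the root -s \<eta>, and
  it factors as (u + s \<eta>) (1 - 2 s r (u - s \<eta>)). Since |u - s \<eta>| \<le> 2, the bound r
  < 1/4 makes the second factor positive.\<close>

lemma sign_Suc:
  assumes s: "s = -1 \<or> s = 0 \<or> s = (1::real)" and r: "0 < r" "r < 1 / 4" and t: "- s * eta_Suc r <
      sin t"
  shows "0 < sin t + s * r * cos (2 * t)"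
proof -
  let ?e = "eta_Suc r" and ?u = "sin t"
  have e: "2 * r * ?e\<^sup>2 + ?e = r" "0 \<le> ?e" "?e \<le> r" using eta_Suc[of r] r by auto
  have c: "cos (2 * t) = 1 - 2 * ?u\<^sup>2" by (rule cos_double_sin)
  have s3: "s * s\<^sup>2 = s" using s by auto
  have "?u + s * r * cos (2 * t) = ?u + s * (2 * r * ?e\<^sup>2 + ?e) - 2 * s * r * ?u\<^sup>2"
    unfolding c e(1) by (simp add: algebra_simps)
  also have "\<dots> = (?u + s * ?e) * (1 - 2 * s * r * (?u - s * ?e))"
  proof -
    have "(?u + s * ?e) * (1 - 2 * s * r * (?u - s * ?e)) = ?u + s * ?e - 2 * s * r * ?u\<^sup>2 + 2 * (s
        * s\<^sup>2) * r * ?e\<^sup>2"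
      by (simp add: power2_eq_square algebra_simps)
    then show ?thesis unfolding s3 by (simp add: algebra_simps)
  qed
  also have "\<dots> > 0"
  proof (rule mult_pos_pos)
    show "0 < ?u + s * ?e" using t by simp
    have "\<bar>s * ?e\<bar> \<le> 1" using s e r by (auto simp: abs_mult)
    then have "\<bar>?u - s * ?e\<bar> \<le> 2" using sin_le_one[of t] sin_ge_minus_one[of t] by linarith
    then have "\<bar>2 * s * r * (?u - s * ?e)\<bar> \<le> 2 * 1 * r * 2"
      unfolding abs_mult using s r by (intro mult_mono) auto
    then show "0 < 1 - 2 * s * r * (?u - s * ?e)" using r by auto
  qed
  finally show ?thesis .
qed

section \<open>The examples of order n\<close>

lemma second_Suc_twisted:
  "twisted n (- real n / real (n + 1)) (n + 1) (- real n / real (n + 2)) (n + 2) s = second_Suc (cis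
      (s * pi / 2)) n s 2"
proof -
  have "s * (- real n / real (n + 2)) = - s * real n / real (n + 2)" by simp
  then show ?thesis by (intro ext) (simp only: twisted_def second_Suc_def)
qed

lemma pair_Suc_poly_pair:
  "pair_Suc (cis (s * pi / 2)) n s 2 =
     poly_pair (cis (s * pi / 2)) n (- real n / real (n + 1)) (n + 1) (s * (- real n / real (n +
         2))) (n + 2)"
  by (simp add: pair_Suc_def)

lemma Im_twist_polar: "Im (twist s 2 (of_real r * cis t)) = r * (sin t + s * r * cos (2 * t))"
proof -
  have c: "cos (2 * t) = cos t * cos t - sin t * sin t" by (simp add: cos_double power2_eq_square)
  show ?thesis unfolding c by (simp add: twist_def power2_eq_square algebra_simps)
qed

section \<open>The examples of order n - 1\<close>

definition pair_pred :: "nat \<Rightarrow> real \<Rightarrow> complex \<Rightarrow> complex" where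
  "pair_pred n s = poly_pair (cis (s * pi / 2)) n (real n / real (n - 1)) (n - 1) (s * -1) n"

text \<open>Integrating (1 / z - i s) n z^(n - 1) gives the coefficients n / (n - 1) and -i s.
  Absorbing the pole of \<kappa> into the power of z makes the formula valid at 0 as well.\<close>

lemma DERIV_pred_twisted:
  assumes n: "2 \<le> n"
  shows "(twisted n (real n / real (n - 1)) (n - 1) (-1) n s has_field_derivative
     (1 - \<i> * of_real s * z) * (of_nat n * cis (s * pi / 2) * z ^ (n - 2))) (at z)"
proof -
  have z: "z ^ (n - 1) = z * z ^ (n - 2)" "n - 1 - 1 = n - 2"
    using n by (simp_all flip: power_Suc add: Suc_diff_Suc numeral_2_eq_2)
  have c: "of_real (real n / real (n - 1)) * of_nat (n - 1) = (of_nat n :: complex)"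
    using n by simp
  have "(twisted n (real n / real (n - 1)) (n - 1) (-1) n s has_field_derivative
     cis (s * pi / 2) * (of_real (real n / real (n - 1)) * (of_nat (n - 1) * z ^ (n - 1 - 1)) +
       \<i> * of_real (s * -1) * (of_nat n * z ^ (n - 1)))) (at z)"
    unfolding twisted_def[abs_def] by (intro DERIV_cmult DERIV_add DERIV_monom)
  also have "cis (s * pi / 2) * (of_real (real n / real (n - 1)) * (of_nat (n - 1) * z ^ (n - 1 -
      1)) +
       \<i> * of_real (s * -1) * (of_nat n * z ^ (n - 1))) =
     (1 - \<i> * of_real s * z) * (of_nat n * cis (s * pi / 2) * z ^ (n - 2))"
    unfolding mult.assoc[symmetric] c z by (simp add: algebra_simps)
  finally show ?thesis .
qed

lemma harmonic_map_pair_pred: "harmonic_map UNIV (pair_pred n s)"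
  unfolding pair_pred_def poly_pair_def by (intro harmonic_map_re_pair holomorphic_intros)

text \<open>For \<kappa> = 1 / z - i s the critical set is the line or circle Im z + s |z|^2 = 0
  through 0. It is straightened by the Moebius map X = 1 / \<kappa> = z / (1 - i s z), which is
  regular at 0.\<close>

lemma smooth_critical_point_pair_pred:
  assumes n: "2 \<le> n" and s: "s = -1 \<or> s = 0 \<or> s = 1"
  shows "smooth_critical_point UNIV (pair_pred n s) 0"
proof -
  let ?K = "twisted n (real n / real (n - 1)) (n - 1) (-1) n s"
  have eq: "pair_pred n s = re_pair (\<lambda>z. cis (s * pi / 2) * z ^ n) ?K"
    by (simp only: pair_pred_def poly_pair_def twisted_def[abs_def])
  have J: "jacobian (pair_pred n s) z = (real n * norm (z ^ (n - 2)))\<^sup>2 * (Im z + s * (norm z)\<^sup>2)"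
      for z
  proof -
    define w where "w = of_nat n * cis (s * pi / 2) * z ^ (n - 2)"
    have "z ^ (n - 1) = z * z ^ (n - 2)"
      using n by (simp flip: power_Suc add: Suc_diff_Suc numeral_2_eq_2)
    then have V: "cis (s * pi / 2) * (of_nat n * z ^ (n - 1)) = z * w" by (simp add: w_def mult_ac)
    have "((\<lambda>z. cis (s * pi / 2) * z ^ n) has_field_derivative z * w) (at z)"
      unfolding V[symmetric] by (rule DERIV_monom)
    moreover have "(?K has_field_derivative (1 - \<i> * of_real s * z) * w) (at z)"
      unfolding w_def by (rule DERIV_pred_twisted[OF n])
    ultimately have "jacobian (pair_pred n s) z = Im (z * w * cnj ((1 - \<i> * of_real s * z) * w))"
      unfolding eq by (rule jacobian_re_pair)
    also have "z * w * cnj ((1 - \<i> * of_real s * z) * w) = of_real ((norm w)\<^sup>2) * (z + \<i> * of_real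
        (s * (norm z)\<^sup>2))"
    proof -
      have "z * w * cnj ((1 - \<i> * of_real s * z) * w) = (w * cnj w) * (z + \<i> * of_real s * (z * cnj
          z))"
        by (simp add: algebra_simps)
      then show ?thesis using complex_norm_square[of w] complex_norm_square[of z] by (simp add:
          mult.assoc)
    qed
    finally show ?thesis by (simp add: w_def norm_mult)
  qed
  have Z: "critical_set UNIV (pair_pred n s) = {z. Im z + s * (norm z)\<^sup>2 = 0}"
    using n by (auto simp: critical_set_def J)
  define X where "X z = z / (1 - \<i> * of_real s * z)" for z
  have nz: "1 - \<i> * of_real s * z \<noteq> 0" if "z \<in> ball 0 1" for z
  proof
    assume "1 - \<i> * of_real s * z = 0"
    then have "norm (\<i> * of_real s * z) = norm (1::complex)" by (metis eq_iff_diff_eq_0)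
    then have "\<bar>s\<bar> * norm z = 1" by (simp add: norm_mult)
    moreover have "\<bar>s\<bar> * norm z \<le> 1 * norm z" using s by (intro mult_right_mono) auto
    ultimately show False using that by simp
  qed
  have D: "(X has_field_derivative 1 / (1 - \<i> * of_real s * z)\<^sup>2) (at z)" if "z \<in> ball 0 1" for z
    unfolding X_def[abs_def]
    by (rule derivative_eq_intros refl nz[OF that])+ (use nz[OF that] in \<open>simp add:
        power2_eq_square\<close>)
  have ImX: "Im (X z) = (Im z + s * (norm z)\<^sup>2) / (norm (1 - \<i> * of_real s * z))\<^sup>2" for z
  proof -
    have "X z = z * cnj (1 - \<i> * of_real s * z) / of_real ((norm (1 - \<i> * of_real s * z))\<^sup>2)"
      unfolding X_def by (rule complex_div_cnj)
    moreover have "Im (z * cnj (1 - \<i> * of_real s * z)) = Im z + s * (norm z)\<^sup>2"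
      unfolding cmod_power2 by (simp add: power2_eq_square algebra_simps)
    ultimately show ?thesis by (simp only: Im_divide_of_real)
  qed
  show ?thesis
  proof (rule smooth_critical_point_re_pair[of "ball 0 1" _ X])
    show "X holomorphic_on ball 0 1" unfolding holomorphic_on_open[OF open_ball] using D by blast
    show "deriv X z \<noteq> 0" if "z \<in> ball 0 1" for z
      using DERIV_imp_deriv[OF D[OF that]] nz[OF that] by simp
    have "Im (X z) = 0 \<longleftrightarrow> Im z + s * (norm z)\<^sup>2 = 0" if "z \<in> ball 0 1" for z
      unfolding ImX using nz[OF that] by simp
    then show "critical_set UNIV (pair_pred n s) \<inter> ball 0 1 = {z \<in> ball 0 1. Im (X z) = 0}"
      unfolding Z by blast
    show "Im (X 0) = 0" by (simp add: X_def)
  qed simp_all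
qed

lemma pair_pred_has_order:
  assumes "2 \<le> n"
  shows "has_order (pair_pred n s) 0 (n - 1)"
  unfolding pair_pred_def using assms by (intro has_order_poly_pair) auto

section \<open>Choice of the example for a given pair of degrees\<close>

context
  fixes np nm n :: nat and \<delta> :: real
  assumes np: "1 \<le> np" "1 \<le> nm" "np = nm \<or> \<bar>int np - int nm\<bar> = 1"
    and n_eq: "n = np + nm - 1" and d_eq: "\<delta> = real np - real nm"
begin

lemma delta_cases: "\<delta> = -1 \<or> \<delta> = 0 \<or> \<delta> = 1"
  using np(3) unfolding d_eq by linarith

text \<open>n is the mean of the degrees 2 np - 1 and 2 nm - 1, and \<delta> is half their
  difference.\<close>

lemma model_degrees:
  "1 \<le> n" "\<delta> \<noteq> 0 \<Longrightarrow> 2 \<le> n"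
  "real (2 * np - 1) = real n + \<delta>" "odd (2 * np - 1)" "real (2 * nm - 1) = real n - \<delta>" "odd (2 * nm
      - 1)"
  using np n_eq d_eq by (auto simp: of_nat_diff)

lemma Re_cis_delta: "Re (cis (\<delta> * pi / 2)) = 0 \<longleftrightarrow> \<delta> \<noteq> 0"
  using delta_cases by auto

lemma parity_n: "\<delta> = 0 \<Longrightarrow> odd n" "\<delta> \<noteq> 0 \<Longrightarrow> even n"
proof -
  show "odd n" if "\<delta> = 0"
  proof -
    have "np = nm" using that d_eq by simp
    then show ?thesis using n_eq np by simp
  qed
  show "even n" if "\<delta> \<noteq> 0"
  proof -
    have "np = nm + 1 \<or> nm = np + 1" using that d_eq np(3) by auto
    then show ?thesis using n_eq by auto
  qed
qed

text \<open>The multiplicity is n (n + 1), even, for \<delta> = 0. Otherwise it is (n - 1) (n + 1) +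
  n + 2, odd because n is then even. This is the parity that the model prescribes for equal and for
  unequal degrees.\<close>

lemma realizes_model_Suc: "\<exists>U f z0. realizes_model U f z0 np nm n"
proof -
  let ?e = "cis (\<delta> * pi / 2)"
  let ?f = "pair_Suc ?e n \<delta> 2"
  have "\<exists>\<mu>::nat. has_multiplicity ?f 0 (enat \<mu>) \<and>
        (2 * int np - 1, 2 * int nm - 1) \<in>
          (if even \<mu>
           then {(int n, int n), (int n + 1, int n + 1)}
           else {(int n + 1, int n - 1), (int n - 1, int n + 1),
                 (int n, int n + 2), (int n + 2, int n)})"
  proof -
    define \<mu> where "\<mu> = (if Re ?e = 0 then (n - 1) * (n + 1) + (n + 2) else n * (n + 1))"
    have "has_multiplicity ?f 0 (enat \<mu>)"
      unfolding pair_Suc_poly_pair \<mu>_def using model_degrees(1) Re_cis_delta by (intro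
          has_multiplicity_poly_pair_Suc) auto
    moreover have "even \<mu> \<longleftrightarrow> \<delta> = 0"
      using Re_cis_delta parity_n model_degrees(1) by (auto simp: \<mu>_def)
    moreover have "int n = int np + int nm - 1" using n_eq np by (simp add: of_nat_diff)
    moreover have "\<delta> = 0 \<longleftrightarrow> np = nm" using d_eq by auto
    ultimately show ?thesis using np(3) by (intro exI[of _ \<mu>]) auto
  qed
  moreover
  \<comment> \<open>1/4 is the bound in \<open>sign_Suc\<close> and \<open>eta_Suc_mono\<close>; the
    sine bounds \<open>eta_Suc r\<close>, which is at most r.\<close>
  define \<epsilon> where "\<epsilon> = min (1 / 4) (sin (pi / (2 * real n)))"
  have sp: "0 < sin (pi / (2 * real n))"
    using model_degrees(1) by (intro sin_gt_zero) (auto simp: field_simps)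
  have \<epsilon>: "0 < \<epsilon>" "\<epsilon> \<le> 1 / 4" "\<epsilon> \<le> sin (pi / (2 * real n))" using sp by (auto simp: \<epsilon>_def)
  have "\<exists>\<Delta> h1 g1 h2 g2. 0 \<in> \<Delta> \<and> \<Delta> \<subseteq> UNIV \<and>
        op_homeomorphism \<Delta> (ball 0 1) h1 g1 \<and> h1 0 = 0 \<and>
        op_homeomorphism UNIV UNIV h2 g2 \<and> h2 (?f 0) = 0 \<and>
        (\<forall>r \<theta>. 0 \<le> r \<and> r < 1 \<and> 0 \<le> \<theta> \<and> \<theta> \<le> pi \<longrightarrow>
           h2 (?f (g1 (of_real r * cis \<theta>))) = of_real r * cis (real (2 * np - 1) * \<theta>)) \<and>
        (\<forall>r \<theta>. 0 \<le> r \<and> r < 1 \<and> pi \<le> \<theta> \<and> \<theta> \<le> 2 * pi \<longrightarrow>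
           h2 (?f (g1 (of_real r * cis \<theta>))) = of_real r * cis (- real (2 * nm - 1) * \<theta>))"
    unfolding pair_Suc_poly_pair
  proof (rule twisted_model[where \<epsilon> = \<epsilon> and \<eta> = eta_Suc and \<kappa> = "\<lambda>s z. - twist s 2 z"])
    show "continuous_on {0..<\<epsilon>} eta_Suc"
      unfolding eta_Suc_def[abs_def]
      by (intro continuous_intros) (smt (verit) real_sqrt_ge_zero zero_le_power2)
    show "eta_Suc 0 = 0" by (simp add: eta_Suc_def)
    show "eta_Suc r \<le> eta_Suc s" if "0 < r" "r \<le> s" "s < \<epsilon>" for r s using eta_Suc_mono[of r s] that
        \<epsilon> by simp
    show "0 < eta_Suc r" if "0 < r" for r using eta_Suc(4)[of r] that by simp
    show "eta_Suc r < sin (pi / (2 * real n))" if "0 < r" "r < \<epsilon>" for r using eta_Suc(3)[of r] that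
        \<epsilon> by simp
    show "(twisted n (- real n / real (n + 1)) (n + 1) (- real n / real (n + 2)) (n + 2) s
        has_field_derivative
        - twist s 2 z * (of_nat n * cis (s * pi / 2) * z ^ (n - 1))) (at z)" for s z
      unfolding second_Suc_twisted using DERIV_second_Suc[OF model_degrees(1), of "cis (s * pi / 2)"
          s 2 z] by (simp add: mult_ac)
    show "Im (- twist s 2 (of_real r * cis t)) < 0"
      if "s = -1 \<or> s = 0 \<or> s = 1" "0 < r" "r < \<epsilon>" "- s * eta_Suc r < sin t" for s r t
      using sign_Suc[OF that(1,2) _ that(4)] that \<epsilon> Im_twist_polar[of s r t] by simp
  qed (use model_degrees delta_cases \<epsilon> in auto)
  moreover have "real (2 * np - 1) = 2 * real np - 1" "- real (2 * nm - 1) = - (2 * real nm - 1)"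
    using np by (simp_all add: of_nat_diff)
  ultimately have "realizes_model UNIV ?f 0 np nm n"
    unfolding realizes_model_def
    using harmonic_map_pair_Suc smooth_critical_point_pair_Suc[of ?e n 2 \<delta>] pair_Suc_has_order[of ?e
        n 2 \<delta>] model_degrees(1)
    by simp
  then show ?thesis by blast
qed

text \<open>The critical curve Im z = -s |z|^2 reads sin t = -s r in polar coordinates, so \<eta> is
  the identity. The case n = 1 is np = nm = 1, where the order would be 0.\<close>

lemma realizes_model_pred:
  assumes n: "2 \<le> n"
  shows "\<exists>U f z0. realizes_model U f z0 np nm (n - 1)"
proof -
  let ?e = "cis (\<delta> * pi / 2)"
  let ?f = "pair_pred n \<delta>"
  have "\<exists>\<mu>::nat. has_multiplicity ?f 0 (enat \<mu>) \<and>
        (2 * int np - 1, 2 * int nm - 1) \<in>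
          (if even \<mu>
           then {(int (n - 1), int (n - 1)), (int (n - 1) + 1, int (n - 1) + 1)}
           else {(int (n - 1) + 1, int (n - 1) - 1), (int (n - 1) - 1, int (n - 1) + 1),
                 (int (n - 1), int (n - 1) + 2), (int (n - 1) + 2, int (n - 1))})"
  proof -
    define \<mu> where "\<mu> = (if Re ?e = 0 then (n - 1) * (n - 1) + n else n * (n - 1))"
    have "has_multiplicity ?f 0 (enat \<mu>)"
      unfolding pair_pred_def \<mu>_def using n Re_cis_delta by (intro has_multiplicity_poly_pair_pred)
          auto
    moreover have "even \<mu> \<longleftrightarrow> \<delta> = 0"
      using Re_cis_delta parity_n n by (auto simp: \<mu>_def)
    moreover have "int (n - 1) = int np + int nm - 2" using n_eq np by (simp add: of_nat_diff)
    moreover have "\<delta> = 0 \<longleftrightarrow> np = nm" using d_eq by auto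
    ultimately show ?thesis using np(3) by (intro exI[of _ \<mu>]) auto
  qed
  moreover
  define \<epsilon> where "\<epsilon> = sin (pi / (2 * real n))"
  have \<epsilon>: "0 < \<epsilon>"
    unfolding \<epsilon>_def using n by (intro sin_gt_zero) (auto simp: field_simps)
  have "\<exists>\<Delta> h1 g1 h2 g2. 0 \<in> \<Delta> \<and> \<Delta> \<subseteq> UNIV \<and>
        op_homeomorphism \<Delta> (ball 0 1) h1 g1 \<and> h1 0 = 0 \<and>
        op_homeomorphism UNIV UNIV h2 g2 \<and> h2 (?f 0) = 0 \<and>
        (\<forall>r \<theta>. 0 \<le> r \<and> r < 1 \<and> 0 \<le> \<theta> \<and> \<theta> \<le> pi \<longrightarrow>
           h2 (?f (g1 (of_real r * cis \<theta>))) = of_real r * cis (real (2 * np - 1) * \<theta>)) \<and>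
        (\<forall>r \<theta>. 0 \<le> r \<and> r < 1 \<and> pi \<le> \<theta> \<and> \<theta> \<le> 2 * pi \<longrightarrow>
           h2 (?f (g1 (of_real r * cis \<theta>))) = of_real r * cis (- real (2 * nm - 1) * \<theta>))"
    unfolding pair_pred_def
  proof (rule twisted_model[where \<epsilon> = \<epsilon> and \<eta> = "\<lambda>r. r" and \<kappa> = "\<lambda>s z. 1 / z - \<i> * of_real s"])
    show "(twisted n (real n / real (n - 1)) (n - 1) (-1) n s has_field_derivative
        (1 / z - \<i> * of_real s) * (of_nat n * cis (s * pi / 2) * z ^ (n - 1))) (at z)" if "z \<noteq> 0"
            for s z
    proof -
      have "z ^ (n - 1) = z * z ^ (n - 2)"
        using n by (simp flip: power_Suc add: Suc_diff_Suc numeral_2_eq_2)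
      then have eq: "(1 / z - \<i> * of_real s) * (of_nat n * cis (s * pi / 2) * z ^ (n - 1)) =
          (1 - \<i> * of_real s * z) * (of_nat n * cis (s * pi / 2) * z ^ (n - 2))"
        using that by (simp add: field_simps)
      show ?thesis unfolding eq by (rule DERIV_pred_twisted[OF n])
    qed
    show "Im (1 / (of_real r * cis t) - \<i> * of_real s) < 0" if "0 < r" "- s * r < sin t" for s r t
    proof -
      have e: "1 / (of_real r * cis t) = of_real (1 / r) * cis (- t)"
        using that(1) by (simp add: cis_inverse[symmetric] field_simps)
      have "Im (1 / (of_real r * cis t) - \<i> * of_real s) = - (sin t / r) - s"
        unfolding e by simp
      also have "\<dots> = - ((sin t + s * r) / r)" using that(1) by (simp add: field_simps)
      finally show ?thesis using that by simp
    qed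
  qed (use model_degrees delta_cases \<epsilon> n in \<open>auto simp: \<epsilon>_def intro!: continuous_intros\<close>)
  moreover have "real (2 * np - 1) = 2 * real np - 1" "- real (2 * nm - 1) = - (2 * real nm - 1)"
    using np by (simp_all add: of_nat_diff)
  ultimately have "realizes_model UNIV ?f 0 np nm (n - 1)"
    unfolding realizes_model_def
    using harmonic_map_pair_pred smooth_critical_point_pair_pred[OF n delta_cases]
        pair_pred_has_order[OF n]
    by simp
  then show ?thesis by blast
qed

end

text \<open>k is n - 1, realized by \<open>pair_pred\<close>, and k + 1 is n, realized by
  \<open>pair_Suc\<close>.\<close>

lemma realizes_consecutive_orders:
  assumes np: "1 \<le> np" "1 \<le> nm" "np = nm \<or> \<bar>int np - int nm\<bar> = 1"
  shows "if np = 1 \<and> nm = 1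
    then (\<exists>U f z0. realizes_model U f z0 np nm 1)
    else (\<exists>k::nat. (\<exists>U f z0. realizes_model U f z0 np nm k) \<and> (\<exists>U f z0. realizes_model U f z0 np nm
        (k + 1)))"
proof (cases "np = 1 \<and> nm = 1")
  case True
  then show ?thesis using realizes_model_Suc[OF np refl refl] by simp
next
  case False
  define n where "n = np + nm - 1"
  have n: "2 \<le> n" "n - 1 + 1 = n" using False np by (auto simp: n_def)
  show ?thesis
    using realizes_model_Suc[OF np n_def refl] realizes_model_pred[OF np n_def refl n(1)] False n(2)
    by (metis (no_types))
qed

theorem corollary2p3:
  shows "(\<forall>(m::nat) (j::enat) (\<mu>::enat).
            1 \<le> m \<and> enat m \<le> j \<and> j + enat (m ^ 2) = \<mu> \<longrightarrow>
            (\<exists>U g z0 \<gamma>.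
               harmonic_map U g \<and> smooth_critical_point U g z0 \<and>
               has_order g z0 m \<and> has_multiplicity g z0 \<mu> \<and>
               natural_parametrization U g z0 \<gamma> \<and> has_order_pair (g \<circ> \<gamma>) j (j + 1)))
       \<and> (\<forall>(np::nat) (nm::nat).
            1 \<le> np \<and> 1 \<le> nm \<and> (np = nm \<or> \<bar>int np - int nm\<bar> = 1) \<longrightarrow>
            (if np = 1 \<and> nm = 1
             then (\<exists>U f z0. realizes_model U f z0 np nm 1)
             else (\<exists>k::nat. (\<exists>U f z0. realizes_model U f z0 np nm k) \<and>
                            (\<exists>U f z0. realizes_model U f z0 np nm (k + 1)))))"
proof (intro conjI allI impI)
  fix m :: nat and j \<mu> :: enat
  assume "1 \<le> m \<and> enat m \<le> j \<and> j + enat (m ^ 2) = \<mu>"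
  then show "\<exists>U g z0 \<gamma>. harmonic_map U g \<and> smooth_critical_point U g z0 \<and>
      has_order g z0 m \<and> has_multiplicity g z0 \<mu> \<and>
      natural_parametrization U g z0 \<gamma> \<and> has_order_pair (g \<circ> \<gamma>) j (j + 1)"
    using realizes_order_pair by blast
next
  fix np nm :: nat
  assume "1 \<le> np \<and> 1 \<le> nm \<and> (np = nm \<or> \<bar>int np - int nm\<bar> = 1)"
  then show "if np = 1 \<and> nm = 1
      then (\<exists>U f z0. realizes_model U f z0 np nm 1)
      else (\<exists>k::nat. (\<exists>U f z0. realizes_model U f z0 np nm k) \<and>
                     (\<exists>U f z0. realizes_model U f z0 np nm (k + 1)))"
    using realizes_consecutive_orders by blast
qed

end
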